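(* Let $\mathcal{H}$ be a complex separable Hilbert space, let $\mathbf{T}=(T_{1},\ldots,T_{m})\in\mathcal{L}(\mathcal{H})^{m}$ be an $m$-tuple of commuting operators, and let $k,n_{1},\ldots,n_{k}$ be positive integers. Then the following are equivalent: (1) There are a decomposition $\mathcal{H}=\bigoplus_{i=1}^{k}\mathcal{H}_{i}^{(n_{i})}$ and $m$-tuples $\mathbf{A}_{i}=(A_{1,i},\ldots,A_{m,i})\in\mathcal{L}(\mathcal{H}_i)^m$, $1\le i\le k$, such that each $\mathbf{A}_{i}$ is strongly irreducible, $\mathbf{A}_{i}\not\sim_{s}\mathbf{A}_{j}$ for $i\neq j$, and $$\mathbf{T}\sim_{s}\bigoplus_{i=1}^{k}\mathbf{A}_{i}^{(n_{i})}=\Big(\bigoplus_{i=1}^{k}A_{1,i}^{(n_{i})},\ldots,\bigoplus_{i=1}^{k}A_{m,i}^{(n_{i})}\Big);$$ and, for each natural number $n$, $\mathbf{T}^{(n)}$ has unique finite strongly irreducible decomposition up to similarity. (2) $\bigvee(\mathcal{A}^{\prime}(\mathbf{T}))\cong\mathbb{N}^{k}$, and the isomorphism $h:\bigvee(\mathcal{A}^{\prime}(\mathbf{T}))\rightarrow\mathbb{N}^{k}$ sends $[I]$ to $(n_{1},\ldots,n_{k})$; that is, $h([I])=n_{1}e_{1}+\cdots+n_{k}e_{k}$, where $0\neq n_j\in\mathbb{N}$ for $1\le j\le k$ and $\{e_{i}\}_{i=1}^{k}$ are the generators of $\mathbb{N}^{k}$.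
   Context: $\mathcal{L}(\mathcal{H})$ is the algebra of bounded linear operators on $\mathcal H$. For a Hilbert space $\mathcal K$, $\mathcal{K}^{(n)}$ is the direct sum of $n$ copies of $\mathcal{K}$; for a tuple $\mathbf A=(A_1,\dots,A_m)$ on $\mathcal K$, $\mathbf{A}^{(n)}=(\bigoplus_{1}^{n}A_1,\ldots,\bigoplus_1^n A_m)$ acts on $\mathcal{K}^{(n)}$. Two tuples $\mathbf{T},\mathbf{S}$ are similar, $\mathbf{T}\sim_s\mathbf{S}$, if there is a bounded invertible $X$ with $XT_i=S_iX$ for all $i$. The commutant is $\mathcal{A}'(\mathbf{T})=\bigcap_{i=1}^m\{X\in\mathcal{L}(\mathcal{H}):XT_i=T_iX\}$, and $GL(\mathcal{A}'(\mathbf{T}))$ is its group of invertible elements. $\mathbf{T}$ is strongly irreducible if $\mathcal{A}'(\mathbf{T})$ contains no nontrivial idempotent (i.e. none other than $0$ and $I$). A unit finite decomposition of $\mathbf{T}$ is a finite set of idempotents $\{P_i\}_{i=1}^n\subset\mathcal{A}'(\mathbf{T})$ with $P_iP_j=0$ for $i\ne j$ and $\sum_i P_i=I$. It is a unit finite strongly irreducible decomposition if in addition each $\mathbf{T}|_{P_i\mathcal{H}}=(T_1|_{P_i\mathcal H},\dots,T_m|_{P_i\mathcal H})$ is strongly irreducible. $\mathbf{T}$ has finite strongly irreducible decomposition if for every idempotent $P\in\mathcal{A}'(\mathbf{T})$, $\mathbf{T}|_{P\mathcal{H}}$ has a unit finite strongly irreducible decomposition. $\mathbf{T}$ has unique finite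 strongly irreducible decomposition up to similarity if it has finite strongly irreducible decomposition and for any two unit finite strongly irreducible decompositions $\{P_i\}_{i=1}^n$, $\{Q_i\}_{i=1}^k$ of $\mathbf{T}$ one has $n=k$ and there are $X\in GL(\mathcal{A}'(\mathbf{T}))$ and a permutation $\Pi$ of $\{1,\dots,n\}$ with $XP_iX^{-1}=Q_{\Pi(i)}$ for all $i$. For a unital Banach algebra $\mathcal{A}$, $M_\infty(\mathcal{A})=\bigcup_n M_n(\mathcal{A})$ (with $M_n(\mathcal A)$ embedded in larger matrix algebras via $a\mapsto a\oplus 0$), and $\bigvee(\mathcal{A})$ is the abelian semigroup (under $[p]+[q]=[p\oplus q]$) of algebraic equivalence classes of idempotents in $M_\infty(\mathcal{A})$, where $a\sim b$ iff $a=xy$, $b=yx$ for some $x,y$; on $M_\infty(\mathcal A)$ this coincides with similarity of idempotents. $\mathbb{N}$ is the additive semigroup of nonnegative integers. *)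

theory Defs
  imports "HOL-Analysis.Analysis" "HOL-Algebra.Ring" "HOL-Algebra.Product_Groups"
begin

section \<open>Complex inner product spaces\<close>

text \<open>The real structure of the class \<^class>\<open>real_inner\<close> (norm and topology included) is the
  one underlying the complex structure; the inner product is linear in its first argument.\<close>

class complex_inner = real_inner +
  fixes scaleC :: "complex \<Rightarrow> 'a \<Rightarrow> 'a"  (infixr \<open>*\<^sub>C\<close> 75)
    and cinner :: "'a \<Rightarrow> 'a \<Rightarrow> complex"
  assumes scaleC_add_right: "c *\<^sub>C (x + y) = c *\<^sub>C x + c *\<^sub>C y"
    and scaleC_add_left: "(c + d) *\<^sub>C x = c *\<^sub>C x + d *\<^sub>C x"
    and scaleC_scaleC: "c *\<^sub>C d *\<^sub>C x = (c * d) *\<^sub>C x"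
    and scaleR_scaleC: "r *\<^sub>R x = complex_of_real r *\<^sub>C x"
    and cinner_commute: "cinner x y = cnj (cinner y x)"
    and cinner_add_left: "cinner (x + y) z = cinner x z + cinner y z"
    and cinner_scaleC_left: "cinner (c *\<^sub>C x) y = c * cinner x y"
    and inner_eq_Re_cinner: "inner x y = Re (cinner x y)"
begin

lemma scaleC_zero_right: "c *\<^sub>C 0 = 0"
  using scaleC_add_right [of c 0 0] by simp

lemma cinner_zero_left: "cinner 0 x = 0"
  using cinner_add_left [of 0 0 x] by simp

lemma cinner_zero_right: "cinner x 0 = 0"
  using cinner_commute [of x 0] by (simp add: cinner_zero_left)

end

class complex_hilbert = complex_inner + complete_space

definition csubspace :: "'a::complex_inner set \<Rightarrow> bool" where
  "csubspace V \<longleftrightarrow> 0 \<in> V \<and> (\<forall>x\<in>V. \<forall>y\<in>V. x + y \<in> V) \<and> (\<forall>c. \<forall>x\<in>V. c *\<^sub>C x \<in> V)"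


section \<open>Finite direct sums\<close>

text \<open>Finitely supported sequences form one ambient type for all finite orthogonal direct sums
  of subspaces of \<^typ>\<open>'a\<close>.  It is not complete, but a direct sum of finitely many complete
  subspaces is a complete subspace of it.\<close>

typedef (overloaded) 'a fin_seq = "{x :: nat \<Rightarrow> 'a::zero. finite {i. x i \<noteq> 0}}"
  morphisms component Abs_fin_seq
  by (rule exI [of _ "\<lambda>_. 0"]) simp

setup_lifting type_definition_fin_seq

lemma fin_seq_eqI: "(\<And>i. component x i = component y i) \<Longrightarrow> x = y"
  by (simp add: component_inject [symmetric] fun_eq_iff)

lemma finite_support: "finite {i. component x i \<noteq> 0}"
  using component [of x] by simp

instantiation fin_seq :: (complex_inner) complex_inner
begin

lift_definition zero_fin_seq :: "'a fin_seq" is "\<lambda>_. 0" by simp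

lift_definition plus_fin_seq :: "'a fin_seq \<Rightarrow> 'a fin_seq \<Rightarrow> 'a fin_seq"
  is "\<lambda>x y i. x i + y i"
proof -
  fix x y :: "nat \<Rightarrow> 'a"
  assume "finite {i. x i \<noteq> 0}" "finite {i. y i \<noteq> 0}"
  then have "finite ({i. x i \<noteq> 0} \<union> {i. y i \<noteq> 0})" by simp
  then show "finite {i. x i + y i \<noteq> 0}" by (rule rev_finite_subset) auto
qed

lift_definition minus_fin_seq :: "'a fin_seq \<Rightarrow> 'a fin_seq \<Rightarrow> 'a fin_seq"
  is "\<lambda>x y i. x i - y i"
proof -
  fix x y :: "nat \<Rightarrow> 'a"
  assume "finite {i. x i \<noteq> 0}" "finite {i. y i \<noteq> 0}"
  then have "finite ({i. x i \<noteq> 0} \<union> {i. y i \<noteq> 0})" by simp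
  then show "finite {i. x i - y i \<noteq> 0}" by (rule rev_finite_subset) auto
qed

lift_definition uminus_fin_seq :: "'a fin_seq \<Rightarrow> 'a fin_seq" is "\<lambda>x i. - x i" by simp

lift_definition scaleR_fin_seq :: "real \<Rightarrow> 'a fin_seq \<Rightarrow> 'a fin_seq" is "\<lambda>r x i. r *\<^sub>R x i"
  by (erule rev_finite_subset) auto

lift_definition scaleC_fin_seq :: "complex \<Rightarrow> 'a fin_seq \<Rightarrow> 'a fin_seq" is "\<lambda>c x i. c *\<^sub>C x i"
  by (erule rev_finite_subset) (auto simp: scaleC_zero_right)

definition cinner_fin_seq :: "'a fin_seq \<Rightarrow> 'a fin_seq \<Rightarrow> complex" where
  "cinner_fin_seq x y = (\<Sum>i | component x i \<noteq> 0. cinner (component x i) (component y i))"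

definition inner_fin_seq :: "'a fin_seq \<Rightarrow> 'a fin_seq \<Rightarrow> real" where
  "inner_fin_seq x y = Re (cinner x y)"

definition norm_fin_seq :: "'a fin_seq \<Rightarrow> real" where
  "norm_fin_seq x = sqrt (inner x x)"

definition sgn_fin_seq :: "'a fin_seq \<Rightarrow> 'a fin_seq" where
  "sgn_fin_seq x = inverse (norm x) *\<^sub>R x"

definition dist_fin_seq :: "'a fin_seq \<Rightarrow> 'a fin_seq \<Rightarrow> real" where
  "dist_fin_seq x y = norm (x - y)"

definition uniformity_fin_seq :: "('a fin_seq \<times> 'a fin_seq) filter" where
  "uniformity_fin_seq = (INF e\<in>{0<..}. principal {(x, y). dist x y < e})"

definition open_fin_seq :: "'a fin_seq set \<Rightarrow> bool" where
  "open_fin_seq U \<longleftrightarrow> (\<forall>x\<in>U. \<forall>\<^sub>F (x', y) in uniformity. x' = x \<longrightarrow> y \<in> U)"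

lemma cinner_fin_seq_superset:
  assumes "finite S" and "{i. component x i \<noteq> 0} \<subseteq> S"
  shows "cinner x y = (\<Sum>i\<in>S. cinner (component x i) (component y i))"
  unfolding cinner_fin_seq_def
  by (rule sum.mono_neutral_left) (use assms in \<open>auto simp: cinner_zero_left\<close>)

instance
proof
  fix x y z :: "'a fin_seq" and r s :: real and c d :: complex
  show "x + y + z = x + (y + z)" by transfer (simp add: add.assoc)
  show "x + y = y + x" by transfer (simp add: add.commute)
  show "0 + x = x" by transfer simp
  show "- x + x = 0" by transfer simp
  show "x - y = x + - y" by transfer simp
  show "r *\<^sub>R (x + y) = r *\<^sub>R x + r *\<^sub>R y" by transfer (simp add: scaleR_add_right)
  show "(r + s) *\<^sub>R x = r *\<^sub>R x + s *\<^sub>R x" by transfer (simp add: scaleR_add_left)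
  show "r *\<^sub>R s *\<^sub>R x = (r * s) *\<^sub>R x" by transfer simp
  show "1 *\<^sub>R x = x" by transfer simp
  show "sgn x = inverse (norm x) *\<^sub>R x" by (rule sgn_fin_seq_def)
  show "dist x y = norm (x - y)" by (rule dist_fin_seq_def)
  show "(uniformity :: ('a fin_seq \<times> 'a fin_seq) filter)
      = (INF e\<in>{0<..}. principal {(x, y). dist x y < e})"
    by (rule uniformity_fin_seq_def)
  show "open U \<longleftrightarrow> (\<forall>x\<in>U. \<forall>\<^sub>F (x', y) in uniformity. x' = x \<longrightarrow> y \<in> U)" for U :: "'a fin_seq set"
    by (rule open_fin_seq_def)
  show "norm x = sqrt (inner x x)" by (rule norm_fin_seq_def)
  show "inner x y = Re (cinner x y)" by (rule inner_fin_seq_def)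
  show "c *\<^sub>C (x + y) = c *\<^sub>C x + c *\<^sub>C y" by transfer (simp add: scaleC_add_right)
  show "(c + d) *\<^sub>C x = c *\<^sub>C x + d *\<^sub>C x" by transfer (simp add: scaleC_add_left)
  show "c *\<^sub>C d *\<^sub>C x = (c * d) *\<^sub>C x" by transfer (simp add: scaleC_scaleC)
  show scaleR: "r *\<^sub>R x = complex_of_real r *\<^sub>C x" for r and x :: "'a fin_seq"
    by transfer (simp add: scaleR_scaleC)
  define S where "S = {i. component x i \<noteq> 0} \<union> {i. component y i \<noteq> 0}"
  have S: "finite S" "{i. component x i \<noteq> 0} \<subseteq> S" "{i. component y i \<noteq> 0} \<subseteq> S"
    by (auto simp: S_def finite_support)
  show commute: "cinner x y = cnj (cinner y x)"
    unfolding cinner_fin_seq_superset [OF S(1,2)] cinner_fin_seq_superset [OF S(1,3)] cnj_sum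
    by (rule sum.cong [OF refl]) (rule cinner_commute)
  have supp: "{i. component (x + y) i \<noteq> 0} \<subseteq> S"
    by (auto simp: S_def plus_fin_seq.rep_eq)
  show add: "cinner (x + y) z = cinner x z + cinner y z"
    unfolding cinner_fin_seq_superset [OF S(1,2)] cinner_fin_seq_superset [OF S(1,3)]
      cinner_fin_seq_superset [OF S(1) supp]
    by (simp add: plus_fin_seq.rep_eq cinner_add_left sum.distrib)
  have supp: "{i. component (c *\<^sub>C x) i \<noteq> 0} \<subseteq> S" for c
    using S(2) by (auto simp: scaleC_fin_seq.rep_eq scaleC_zero_right)
  show scaleC: "cinner (c *\<^sub>C x) y = c * cinner x y" for c
    unfolding cinner_fin_seq_superset [OF S(1,2)] cinner_fin_seq_superset [OF S(1) supp]
    by (simp add: scaleC_fin_seq.rep_eq cinner_scaleC_left sum_distrib_left)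
  show "inner x y = inner y x" by (simp add: inner_fin_seq_def commute)
  show "inner (x + y) z = inner x z + inner y z" by (simp add: inner_fin_seq_def add)
  show "inner (r *\<^sub>R x) y = r * inner x y" by (simp add: inner_fin_seq_def scaleR scaleC)
  have inner_xx: "inner x x = (\<Sum>i | component x i \<noteq> 0. inner (component x i) (component x i))"
    by (simp add: inner_fin_seq_def cinner_fin_seq_def inner_eq_Re_cinner)
  show "0 \<le> inner x x" unfolding inner_xx by (rule sum_nonneg) simp
  show "inner x x = 0 \<longleftrightarrow> x = 0"
  proof
    assume "inner x x = 0"
    then have "\<forall>i\<in>{i. component x i \<noteq> 0}. inner (component x i) (component x i) = 0"
      unfolding inner_xx by (subst (asm) sum_nonneg_eq_0_iff) (simp_all add: finite_support)
    then show "x = 0" by (intro fin_seq_eqI) (auto simp: zero_fin_seq.rep_eq)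
  next
    assume "x = 0"
    then show "inner x x = 0" unfolding inner_xx by (simp add: zero_fin_seq.rep_eq)
  qed
qed

end

definition direct_sum :: "nat \<Rightarrow> (nat \<Rightarrow> 'a::complex_inner set) \<Rightarrow> 'a fin_seq set" where
  "direct_sum k V = {x. (\<forall>i<k. component x i \<in> V i) \<and> (\<forall>i\<ge>k. component x i = 0)}"

definition direct_sum_op :: "nat \<Rightarrow> (nat \<Rightarrow> 'a::complex_inner set) \<Rightarrow> (nat \<Rightarrow> 'a \<Rightarrow> 'a)
    \<Rightarrow> 'a fin_seq \<Rightarrow> 'a fin_seq" where
  "direct_sum_op k V A = (\<lambda>x\<in>direct_sum k V. Abs_fin_seq (\<lambda>i. if i < k then A i (component x i) else 0))"

text \<open>The direct sum of the tuples \<open>(A i 0, \<dots>, A i (m - 1))\<close>, \<open>i < k\<close>.\<close>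

definition direct_sum_tuple :: "nat \<Rightarrow> (nat \<Rightarrow> 'a::complex_inner set) \<Rightarrow> (nat \<Rightarrow> nat \<Rightarrow> 'a \<Rightarrow> 'a)
    \<Rightarrow> nat \<Rightarrow> 'a fin_seq \<Rightarrow> 'a fin_seq" where
  "direct_sum_tuple k V A = (\<lambda>j. direct_sum_op k V (\<lambda>i. A i j))"

abbreviation copies :: "nat \<Rightarrow> 'a::complex_inner set \<Rightarrow> 'a fin_seq set" where
  "copies n V \<equiv> direct_sum n (\<lambda>_. V)"

abbreviation copies_tuple :: "nat \<Rightarrow> 'a::complex_inner set \<Rightarrow> (nat \<Rightarrow> 'a \<Rightarrow> 'a)
    \<Rightarrow> nat \<Rightarrow> 'a fin_seq \<Rightarrow> 'a fin_seq" where
  "copies_tuple n V T \<equiv> direct_sum_tuple n (\<lambda>_. V) (\<lambda>_. T)"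


section \<open>Operators on subspaces\<close>

text \<open>Operators are extensional (equal to \<^const>\<open>undefined\<close> outside of their domain \<open>V\<close>), so
  that equality of functions is equality of operators.  An \<open>m\<close>-tuple of operators is a
  function on \<^typ>\<open>nat\<close> of which only the values at \<open>j < m\<close> matter.\<close>

definition bdd_ops :: "'a::complex_inner set \<Rightarrow> 'b::complex_inner set \<Rightarrow> ('a \<Rightarrow> 'b) set" where
  "bdd_ops V W = {X \<in> V \<rightarrow>\<^sub>E W.
     (\<forall>x\<in>V. \<forall>y\<in>V. X (x + y) = X x + X y) \<and>
     (\<forall>c. \<forall>x\<in>V. X (c *\<^sub>C x) = c *\<^sub>C X x) \<and>
     (\<exists>B. \<forall>x\<in>V. norm (X x) \<le> B * norm x)}"

definition unitarily_equivalent :: "'a::complex_inner set \<Rightarrow> 'b::complex_inner set \<Rightarrow> bool" where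
  "unitarily_equivalent V W \<longleftrightarrow> (\<exists>U\<in>bdd_ops V W. U ` V = W \<and>
     (\<forall>x\<in>V. \<forall>y\<in>V. cinner (U x) (U y) = cinner x y))"

definition similar :: "nat \<Rightarrow> 'a::complex_inner set \<Rightarrow> (nat \<Rightarrow> 'a \<Rightarrow> 'a)
    \<Rightarrow> 'b::complex_inner set \<Rightarrow> (nat \<Rightarrow> 'b \<Rightarrow> 'b) \<Rightarrow> bool" where
  "similar m V T W S \<longleftrightarrow> (\<exists>X\<in>bdd_ops V W. \<exists>Y\<in>bdd_ops W V.
     (\<forall>x\<in>V. Y (X x) = x) \<and> (\<forall>y\<in>W. X (Y y) = y) \<and>
     (\<forall>j<m. \<forall>x\<in>V. X (T j x) = S j (X x)))"

definition commutant :: "nat \<Rightarrow> 'a::complex_inner set \<Rightarrow> (nat \<Rightarrow> 'a \<Rightarrow> 'a) \<Rightarrow> ('a \<Rightarrow> 'a) ring" where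
  "commutant m V T =
     \<lparr>carrier = {X \<in> bdd_ops V V. \<forall>j<m. \<forall>x\<in>V. X (T j x) = T j (X x)},
      mult = compose V,
      one = (\<lambda>x\<in>V. x),
      zero = (\<lambda>x\<in>V. 0),
      add = (\<lambda>X Y. \<lambda>x\<in>V. X x + Y x)\<rparr>"

definition restrict_tuple :: "'a set \<Rightarrow> (nat \<Rightarrow> 'a \<Rightarrow> 'a) \<Rightarrow> nat \<Rightarrow> 'a \<Rightarrow> 'a" where
  "restrict_tuple W T = (\<lambda>j. restrict (T j) W)"


section \<open>Strongly irreducible decompositions\<close>

definition idempotents :: "('a, 'b) ring_scheme \<Rightarrow> 'a set" where
  "idempotents R = {p \<in> carrier R. p \<otimes>\<^bsub>R\<^esub> p = p}"

text \<open>The zero space does not count as strongly irreducible: otherwise zero summands could be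
  appended to every decomposition, and no decomposition would be unique.\<close>

definition strongly_irreducible ::
    "nat \<Rightarrow> 'a::complex_inner set \<Rightarrow> (nat \<Rightarrow> 'a \<Rightarrow> 'a) \<Rightarrow> bool" where
  "strongly_irreducible m V T \<longleftrightarrow> V \<noteq> {0} \<and>
     idempotents (commutant m V T) \<subseteq> {\<zero>\<^bsub>commutant m V T\<^esub>, \<one>\<^bsub>commutant m V T\<^esub>}"

definition unit_finite_decomposition ::
    "nat \<Rightarrow> 'a::complex_inner set \<Rightarrow> (nat \<Rightarrow> 'a \<Rightarrow> 'a) \<Rightarrow> nat \<Rightarrow> (nat \<Rightarrow> 'a \<Rightarrow> 'a) \<Rightarrow> bool" where
  "unit_finite_decomposition m V T n P \<longleftrightarrow>
     (let R = commutant m V T in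
       (\<forall>i<n. P i \<in> idempotents R) \<and>
       (\<forall>i<n. \<forall>j<n. i \<noteq> j \<longrightarrow> P i \<otimes>\<^bsub>R\<^esub> P j = \<zero>\<^bsub>R\<^esub>) \<and>
       (\<Oplus>\<^bsub>R\<^esub>i\<in>{..<n}. P i) = \<one>\<^bsub>R\<^esub>)"

text \<open>The empty family (\<open>n = 0\<close>) is a decomposition exactly on the zero space; it is the one
  needed for the idempotent \<open>0\<close> in \<open>has_finite_SI_decomposition\<close>.\<close>

definition unit_finite_SI_decomposition ::
    "nat \<Rightarrow> 'a::complex_inner set \<Rightarrow> (nat \<Rightarrow> 'a \<Rightarrow> 'a) \<Rightarrow> nat \<Rightarrow> (nat \<Rightarrow> 'a \<Rightarrow> 'a) \<Rightarrow> bool" where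
  "unit_finite_SI_decomposition m V T n P \<longleftrightarrow>
     unit_finite_decomposition m V T n P \<and>
     (\<forall>i<n. strongly_irreducible m (P i ` V) (restrict_tuple (P i ` V) T))"

definition has_finite_SI_decomposition ::
    "nat \<Rightarrow> 'a::complex_inner set \<Rightarrow> (nat \<Rightarrow> 'a \<Rightarrow> 'a) \<Rightarrow> bool" where
  "has_finite_SI_decomposition m V T \<longleftrightarrow>
     (\<forall>P\<in>idempotents (commutant m V T).
        \<exists>n Q. unit_finite_SI_decomposition m (P ` V) (restrict_tuple (P ` V) T) n Q)"

definition has_unique_finite_SI_decomposition ::
    "nat \<Rightarrow> 'a::complex_inner set \<Rightarrow> (nat \<Rightarrow> 'a \<Rightarrow> 'a) \<Rightarrow> bool" where
  "has_unique_finite_SI_decomposition m V T \<longleftrightarrow>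
     has_finite_SI_decomposition m V T \<and>
     (\<forall>n P k Q. unit_finite_SI_decomposition m V T n P \<longrightarrow>
        unit_finite_SI_decomposition m V T k Q \<longrightarrow>
        n = k \<and>
        (let R = commutant m V T in
          \<exists>X\<in>Units R. \<exists>\<pi>. bij_betw \<pi> {..<n} {..<n} \<and>
            (\<forall>i<n. X \<otimes>\<^bsub>R\<^esub> P i \<otimes>\<^bsub>R\<^esub> inv\<^bsub>R\<^esub> X = Q (\<pi> i))))"


section \<open>The semigroup of idempotent classes over a ring\<close>

text \<open>A matrix is a function of two indices with only finitely many nonzero entries, so the
  embedding \<open>a \<mapsto> a \<oplus> 0\<close> of \<open>n \<times> n\<close> matrices into larger ones is an inclusion.\<close>

definition matrices :: "('a, 'b) ring_scheme \<Rightarrow> nat \<Rightarrow> (nat \<Rightarrow> nat \<Rightarrow> 'a) set" where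
  "matrices R n = {a. (\<forall>i j. a i j \<in> carrier R) \<and>
     (\<forall>i j. n \<le> i \<or> n \<le> j \<longrightarrow> a i j = \<zero>\<^bsub>R\<^esub>)}"

definition M_inf :: "('a, 'b) ring_scheme \<Rightarrow> (nat \<Rightarrow> nat \<Rightarrow> 'a) set" where
  "M_inf R = (\<Union>n. matrices R n)"

definition matrix_mult :: "('a, 'b) ring_scheme \<Rightarrow> (nat \<Rightarrow> nat \<Rightarrow> 'a) \<Rightarrow> (nat \<Rightarrow> nat \<Rightarrow> 'a)
    \<Rightarrow> nat \<Rightarrow> nat \<Rightarrow> 'a" where
  "matrix_mult R a b = (\<lambda>i j. \<Oplus>\<^bsub>R\<^esub>l\<in>{l. a i l \<noteq> \<zero>\<^bsub>R\<^esub>}. a i l \<otimes>\<^bsub>R\<^esub> b l j)"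

definition matrix_idempotents :: "('a, 'b) ring_scheme \<Rightarrow> (nat \<Rightarrow> nat \<Rightarrow> 'a) set" where
  "matrix_idempotents R = {p \<in> M_inf R. matrix_mult R p p = p}"

definition alg_equiv ::
    "('a, 'b) ring_scheme \<Rightarrow> ((nat \<Rightarrow> nat \<Rightarrow> 'a) \<times> (nat \<Rightarrow> nat \<Rightarrow> 'a)) set" where
  "alg_equiv R = {(p, q). p \<in> matrix_idempotents R \<and> q \<in> matrix_idempotents R \<and>
     (\<exists>x\<in>M_inf R. \<exists>y\<in>M_inf R. p = matrix_mult R x y \<and> q = matrix_mult R y x)}"

definition idempotent_class ::
    "('a, 'b) ring_scheme \<Rightarrow> (nat \<Rightarrow> nat \<Rightarrow> 'a) \<Rightarrow> (nat \<Rightarrow> nat \<Rightarrow> 'a) set" where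
  "idempotent_class R p = alg_equiv R `` {p}"

text \<open>The matrix \<open>p \<oplus> q\<close>, where \<open>p\<close> is regarded as an \<open>n \<times> n\<close> matrix.\<close>

definition block_diag :: "('a, 'b) ring_scheme \<Rightarrow> nat \<Rightarrow> (nat \<Rightarrow> nat \<Rightarrow> 'a) \<Rightarrow> (nat \<Rightarrow> nat \<Rightarrow> 'a)
    \<Rightarrow> nat \<Rightarrow> nat \<Rightarrow> 'a" where
  "block_diag R n p q = (\<lambda>i j. if i < n \<and> j < n then p i j
     else if n \<le> i \<and> n \<le> j then q (i - n) (j - n) else \<zero>\<^bsub>R\<^esub>)"

definition scalar_matrix :: "('a, 'b) ring_scheme \<Rightarrow> 'a \<Rightarrow> nat \<Rightarrow> nat \<Rightarrow> 'a" where
  "scalar_matrix R r = (\<lambda>i j. if i = 0 \<and> j = 0 then r else \<zero>\<^bsub>R\<^esub>)"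

text \<open>\<open>[p] + [q] = [p \<oplus> q]\<close>: the union below is over all choices of representatives and of
  matrix sizes, on which the class of \<open>p \<oplus> q\<close> does not depend.\<close>

definition idempotent_semigroup ::
    "('a, 'b) ring_scheme \<Rightarrow> (nat \<Rightarrow> nat \<Rightarrow> 'a) set monoid" where
  "idempotent_semigroup R =
     \<lparr>carrier = matrix_idempotents R // alg_equiv R,
      mult = (\<lambda>C D. \<Union>p\<in>C. \<Union>q\<in>D. \<Union>n\<in>{n. p \<in> matrices R n}.
        idempotent_class R (block_diag R n p q)),
      one = idempotent_class R (scalar_matrix R \<zero>\<^bsub>R\<^esub>)\<rparr>"

definition nat_add_monoid :: "nat monoid" where
  "nat_add_monoid = \<lparr>carrier = UNIV, mult = (+), one = 0\<rparr>"

end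

theory Submission
  imports Defs
begin

text \<open>Finite matrices over the commutant of \<open>T\<close> act on finitely supported sequences, where they form
  the non-unital ring \<open>M\<close> of those bounded operators commuting with the coordinatewise action of
  \<open>T\<close> that live on finitely many coordinates. The commutant of the tuple induced on the range of
  an idempotent \<open>p\<close> is \<open>p M p\<close>, so strongly irreducible summands are primitive idempotents,
  similarity of summands is algebraic equivalence of idempotents, and both statements of the
  theorem become statements about \<open>M\<close>. If decompositions into primitive idempotents exist and are
  unique, counting the summands of each type is an isomorphism onto \<open>\<nat>\<^sup>k\<close>. Conversely, such an
  isomorphism identifies the primitive idempotents with the unit vectors, and an idempotent
  decomposes as its image does. The subspaces \<open>H i\<close> are then ranges of idempotents of the commutant;
  the direct sum of their copies is boundedly isomorphic to the whole space, and the polar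
  decomposition makes the isomorphism unitary.\<close>

section \<open>Idempotents of a ring of finite matrices\<close>

text \<open>Inside a fixed commutant there need not be room for two orthogonal copies of an
  idempotent. In \<open>M\<close> there always is, since a finite matrix can be moved down the
  diagonal; the assumption \<open>shift\<close> records this and turns addition of classes into
  addition of orthogonal idempotents. From (1) to (2) the obstacle is that uniqueness is given for
  decompositions of \<open>E N\<close> alone, while a dimension has to be assigned to every
  idempotent p. Two decompositions of p are therefore completed by one decomposition of
  \<open>E N - p\<close>, and its counts are cancelled. From (2) to (1) an isomorphism supplies
  classes only: a splitting of the image of p is realised somewhere in \<open>M\<close> and has to
  be pulled back below p by conjugation. Uniqueness itself has two forms, conjugation by one
  invertible element of the commutant and equivalence summand by summand. They agree because both
  families add up to the identity, so that the partial equivalences add up to an invertible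
  operator.\<close>

locale matrix_algebra =
  fixes M :: "'r::ring set"
  assumes M_zero: "0 \<in> M"
    and M_add: "x \<in> M \<Longrightarrow> y \<in> M \<Longrightarrow> x + y \<in> M"
    and M_minus: "x \<in> M \<Longrightarrow> - x \<in> M"
    and M_mult: "x \<in> M \<Longrightarrow> y \<in> M \<Longrightarrow> x * y \<in> M"
begin

definition idem :: "'r \<Rightarrow> bool" where
  "idem p \<longleftrightarrow> p \<in> M \<and> p * p = p"

definition orth :: "'r \<Rightarrow> 'r \<Rightarrow> bool" where
  "orth p q \<longleftrightarrow> p * q = 0 \<and> q * p = 0"

text \<open>This is the relation \<open>a \<sim> b\<close> of algebraic equivalence, restricted to
  idempotents of \<open>M\<close>.\<close>

definition eqv :: "'r \<Rightarrow> 'r \<Rightarrow> bool" where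
  "eqv p q \<longleftrightarrow> idem p \<and> idem q \<and> (\<exists>x\<in>M. \<exists>y\<in>M. x * y = p \<and> y * x = q)"

text \<open>The equations p q = q and q p = q say that q lies below p, that is, in the corner p M
  p.\<close>

definition prim :: "'r \<Rightarrow> bool" where
  "prim p \<longleftrightarrow> idem p \<and> p \<noteq> 0 \<and> (\<forall>q. idem q \<longrightarrow> p * q = q \<longrightarrow> q * p = q \<longrightarrow> q = 0 \<or> q = p)"

text \<open>A set serves as well as a family: orthogonal primitive idempotents are nonzero, hence
  distinct, so no multiplicity is lost.\<close>

definition pdec :: "'r \<Rightarrow> 'r set \<Rightarrow> bool" where
  "pdec p B \<longleftrightarrow> finite B \<and> (\<forall>b\<in>B. prim b) \<and> pairwise orth B \<and> \<Sum>B = p"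

lemma M_sum: "(\<And>i. i \<in> I \<Longrightarrow> f i \<in> M) \<Longrightarrow> sum f I \<in> M"
  by (induction I rule: infinite_finite_induct) (auto intro: M_zero M_add)

lemma M_diff: "x \<in> M \<Longrightarrow> y \<in> M \<Longrightarrow> x - y \<in> M"
  by (metis M_add M_minus uminus_add_conv_diff add.commute)

lemma idem_zero: "idem 0"
  by (simp add: idem_def M_zero)

lemma idemD: "idem p \<Longrightarrow> p \<in> M" "idem p \<Longrightarrow> p * p = p"
  by (auto simp: idem_def)

lemma orth_sym: "orth p q \<Longrightarrow> orth q p"
  by (auto simp: orth_def)

lemma idem_add: "idem p \<Longrightarrow> idem q \<Longrightarrow> orth p q \<Longrightarrow> idem (p + q)"
  by (auto simp: idem_def orth_def M_add algebra_simps)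

lemma idem_diff: "idem p \<Longrightarrow> idem q \<Longrightarrow> p * q = q \<Longrightarrow> q * p = q \<Longrightarrow> idem (p - q)"
  by (auto simp: idem_def M_diff algebra_simps)

lemma orth_diff: "idem q \<Longrightarrow> p * q = q \<Longrightarrow> q * p = q \<Longrightarrow> orth q (p - q)"
  by (auto simp: idem_def orth_def algebra_simps)

lemma orth_sum: "(\<And>b. b \<in> B \<Longrightarrow> orth p b) \<Longrightarrow> orth p (\<Sum>B)"
  by (auto simp: orth_def sum_distrib_left sum_distrib_right)

lemma idem_sum:
  assumes "finite B" "\<And>b. b \<in> B \<Longrightarrow> idem b" "pairwise orth B"
  shows "idem (\<Sum>B)"
  using assms
proof (induction B)
  case empty
  then show ?case by (simp add: idem_zero)
next
  case (insert b B)
  then have "orth b (\<Sum>B)"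
    by (intro orth_sum) (auto simp: pairwise_def)
  with insert show ?case
    by (auto intro!: idem_add simp: pairwise_insert)
qed

lemma orth_member_sum:
  assumes "finite B" "\<And>b. b \<in> B \<Longrightarrow> idem b" "pairwise orth B" "b \<in> B"
  shows "b * \<Sum>B = b" "\<Sum>B * b = b"
proof -
  have "orth b (\<Sum>(B - {b}))"
    using assms by (intro orth_sum) (auto simp: pairwise_def)
  moreover have "\<Sum>B = b + \<Sum>(B - {b})"
    using assms by (simp add: sum.remove)
  ultimately show "b * \<Sum>B = b" "\<Sum>B * b = b"
    using assms(2,4) by (auto simp: orth_def idem_def algebra_simps)
qed

lemma pdec_idem: "pdec p B \<Longrightarrow> idem p"
  unfolding pdec_def prim_def by (metis idem_sum)

text \<open>Arbitrary witnesses are cut down to \<open>p * x * q\<close> and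
  \<open>q * y * p\<close>; as \<open>x * q * y = x * y * x * y = p\<close>, the products survive.
  So normalised, x and y act as mutually inverse maps between the ranges of p and q.\<close>

lemma eqvE:
  assumes "eqv p q"
  obtains x y where "x \<in> M" "y \<in> M" "x * y = p" "y * x = q"
    "p * x = x" "x * q = x" "q * y = y" "y * p = y" "idem p" "idem q"
proof -
  from assms obtain x y where xy: "x \<in> M" "y \<in> M" "x * y = p" "y * x = q"
    and p: "p \<in> M" "p * p = p" and q: "q \<in> M" "q * q = q"
    by (auto simp: eqv_def idem_def)
  have "p * x * q * (q * y * p) = p * x * q * y * p"
    using q by (metis mult.assoc)
  also have "\<dots> = p"
    using xy p by (metis mult.assoc)
  finally have 1: "p * x * q * (q * y * p) = p" .
  have "q * y * p * (p * x * q) = q * y * p * x * q"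
    using p by (metis mult.assoc)
  also have "\<dots> = q"
    using xy q by (metis mult.assoc)
  finally have 2: "q * y * p * (p * x * q) = q" .
  show thesis
  proof (rule that [OF _ _ 1 2])
    show "p * x * q \<in> M" "q * y * p \<in> M"
      using xy p q by (auto intro!: M_mult)
    show "p * (p * x * q) = p * x * q" "q * (q * y * p) = q * y * p"
      using p q by (simp_all add: mult.assoc [symmetric])
    show "p * x * q * q = p * x * q" "q * y * p * p = q * y * p"
      using p q by (simp_all add: mult.assoc)
  qed (use assms in \<open>auto simp: eqv_def\<close>)
qed

lemma eqvI: "idem p \<Longrightarrow> idem q \<Longrightarrow> x \<in> M \<Longrightarrow> y \<in> M \<Longrightarrow> x * y = p \<Longrightarrow> y * x = q \<Longrightarrow> eqv p q"
  by (auto simp: eqv_def)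

lemma eqv_refl: "idem p \<Longrightarrow> eqv p p"
  by (auto simp: eqv_def idem_def)

lemma eqv_sym: "eqv p q \<Longrightarrow> eqv q p"
  by (auto simp: eqv_def)

lemma eqv_trans:
  assumes "eqv p q" "eqv q r"
  shows "eqv p r"
proof -
  from assms(1) obtain x y where 1: "x \<in> M" "y \<in> M" "x * y = p" "y * x = q"
    "x * q = x" "q * y = y" "idem p"
    by (rule eqvE)
  from assms(2) obtain z w where 2: "z \<in> M" "w \<in> M" "z * w = q" "w * z = r"
    "q * z = z" "w * q = w" "idem r"
    by (rule eqvE)
  have "x * z * (w * y) = p" "w * y * (x * z) = r"
    using 1 2 by (metis mult.assoc)+
  then show ?thesis
    using 1 2 by (auto intro!: eqvI [of _ _ "x * z" "w * y"] M_mult)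
qed

lemma eqv_zero: "eqv p 0 \<longleftrightarrow> p = 0"
proof
  assume "eqv p 0"
  then obtain x y where "p * x = x" "x * 0 = x" "x * y = p"
    by (rule eqvE)
  then show "p = 0" by auto
qed (simp add: eqv_refl idem_zero)

text \<open>Normalised witnesses are added. The mixed products vanish because an orthogonal pair can
  be inserted, as in \<open>x * w = x * (p' * q') * w\<close>.\<close>

lemma eqv_add:
  assumes "eqv p p'" "eqv q q'" "orth p q" "orth p' q'"
  shows "eqv (p + q) (p' + q')"
proof -
  from assms(1) obtain x y where 1: "x \<in> M" "y \<in> M" "x * y = p" "y * x = p'"
    "p * x = x" "x * p' = x" "p' * y = y" "y * p = y" "idem p" "idem p'"
    by (rule eqvE)
  from assms(2) obtain z w where 2: "z \<in> M" "w \<in> M" "z * w = q" "w * z = q'"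
    "q * z = z" "z * q' = z" "q' * w = w" "w * q = w" "idem q" "idem q'"
    by (rule eqvE)
  have "x * w = x * (p' * q') * w" "z * y = z * (q' * p') * y"
    "y * z = y * (p * q) * z" "w * x = w * (q * p) * x"
    using 1 2 by (metis mult.assoc)+
  then have "x * w = 0" "z * y = 0" "y * z = 0" "w * x = 0"
    using assms(3,4) by (auto simp: orth_def)
  then show ?thesis
    using 1 2 assms(3,4)
    by (intro eqvI [of _ _ "x + z" "y + w"]) (auto simp: algebra_simps intro: M_add idem_add)
qed

text \<open>Conjugation carries idempotents below p to idempotents below q; \<open>b * x\<close> and
  \<open>y * b\<close> witness that b is equivalent to its image.\<close>

lemma eqv_conj:
  assumes "x \<in> M" "y \<in> M" "x * y = p" "y * x = q" "p * x = x" "y * p = y" "idem b" "p * b = b" "b * p = b"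
  shows "eqv b (y * b * x)" "idem (y * b * x)"
proof -
  have "y * b * x * (y * b * x) = y * b * (x * y) * b * x"
    by (simp add: mult.assoc)
  also have "\<dots> = y * b * x"
    using assms by (metis idem_def mult.assoc)
  finally show i: "idem (y * b * x)"
    using assms by (auto simp: idem_def intro: M_mult)
  have "b * x * (y * b) = b" "y * b * (b * x) = y * b * x"
    using assms by (metis idem_def mult.assoc)+
  with i assms show "eqv b (y * b * x)"
    by (intro eqvI [of _ _ "b * x" "y * b"]) (auto intro: M_mult simp: idem_def)
qed

text \<open>An idempotent r below q is moved back to \<open>x * r * y\<close> below p, where
  primitivity decides, and is recovered from it by conjugation.\<close>

lemma prim_eqv:
  assumes "prim p" "eqv p q"
  shows "prim q"
proof -
  from assms(2) obtain x y where 1: "x \<in> M" "y \<in> M" "x * y = p" "y * x = q"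
    "p * x = x" "x * q = x" "q * y = y" "y * p = y" "idem p" "idem q"
    by (rule eqvE)
  have "r = 0 \<or> r = q" if r: "idem r" "q * r = r" "r * q = r" for r
  proof -
    have "idem (x * r * y)"
      using eqv_conj(2) [of y x q p r] 1 r by auto
    moreover have "p * (x * r * y) = x * r * y" "x * r * y * p = x * r * y"
      using 1 by (metis mult.assoc)+
    ultimately have "x * r * y = 0 \<or> x * r * y = p"
      using assms(1) by (auto simp: prim_def)
    moreover have "r = y * (x * r * y) * x"
      using 1 r by (metis mult.assoc)
    moreover have "y * p * x = q"
      using 1 by metis
    ultimately show ?thesis
      by (metis mult_zero_left mult_zero_right)
  qed
  moreover have "q \<noteq> 0"
    using assms by (auto simp: eqv_zero prim_def)
  ultimately show ?thesis
    using 1 by (auto simp: prim_def)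
qed

text \<open>Conjugation is multiplicative below p, because the inner factor \<open>x * y = p\<close>
  is absorbed. It thus preserves orthogonality and transports the whole decomposition.\<close>

lemma pdec_eqv:
  assumes "pdec p B" "eqv p q"
  obtains \<phi> where "inj_on \<phi> B" "pdec q (\<phi> ` B)" "\<And>b. b \<in> B \<Longrightarrow> eqv b (\<phi> b)"
proof -
  from assms(2) obtain x y where 1: "x \<in> M" "y \<in> M" "x * y = p" "y * x = q"
    "p * x = x" "x * q = x" "q * y = y" "y * p = y" "idem p" "idem q"
    by (rule eqvE)
  have B: "finite B" "\<Sum>B = p" "\<And>b. b \<in> B \<Longrightarrow> prim b" "\<And>b. b \<in> B \<Longrightarrow> idem b" "pairwise orth B"
    using assms(1) by (auto simp: pdec_def prim_def)
  define \<phi> where "\<phi> b = y * b * x" for b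
  have pb: "p * b = b" "b * p = b" if "b \<in> B" for b
    using orth_member_sum B that by auto
  have eqv: "eqv b (\<phi> b)" if "b \<in> B" for b
    unfolding \<phi>_def using eqv_conj(1) [OF 1(1-4) 1(5) 1(8)] B(4) pb that by blast
  have mult: "\<phi> b * \<phi> c = \<phi> (b * c)" if "b \<in> B" for b c
  proof -
    have "\<phi> b * \<phi> c = y * (b * p) * c * x"
      unfolding 1(3) [symmetric] \<phi>_def by (simp add: mult.assoc)
    then show ?thesis
      using pb that by (simp add: \<phi>_def mult.assoc)
  qed
  have orth: "orth (\<phi> b) (\<phi> c)" if "b \<in> B" "c \<in> B" "b \<noteq> c" for b c
    using B(5) that by (auto simp: orth_def mult pairwise_def) (simp add: \<phi>_def)
  have inj: "inj_on \<phi> B"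
  proof (rule inj_onI, rule ccontr)
    fix b c assume bc: "b \<in> B" "c \<in> B" "\<phi> b = \<phi> c" "b \<noteq> c"
    then have "\<phi> b * \<phi> b = 0" using orth [of b c] by (auto simp: orth_def)
    moreover have "prim (\<phi> b)" using prim_eqv B(3) eqv bc by blast
    ultimately show False by (auto simp: prim_def idem_def)
  qed
  have "\<Sum>(\<phi> ` B) = y * \<Sum>B * x"
    by (simp add: sum.reindex [OF inj]) (simp add: \<phi>_def sum_distrib_left sum_distrib_right)
  then have "\<Sum>(\<phi> ` B) = q"
    using B 1 by simp
  moreover have "pairwise orth (\<phi> ` B)"
    unfolding pairwise_def using orth by (metis imageE)
  moreover have "\<forall>b\<in>\<phi> ` B. prim b"
    using B(3) eqv prim_eqv by blast
  ultimately have "pdec q (\<phi> ` B)"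
    using B(1) by (simp add: pdec_def)
  with inj eqv that show thesis by blast
qed

text \<open>Conjugation moves q and r into p. This turns an identity between classes into an actual
  splitting of a given idempotent.\<close>

lemma eqv_addE:
  assumes "eqv p (q + r)" "idem q" "idem r" "orth q r"
  obtains q' r' where "p = q' + r'" "eqv q q'" "eqv r r'" "orth q' r'"
proof -
  from assms(1) obtain x y where 1: "x \<in> M" "y \<in> M" "x * y = p" "y * x = q + r"
    "p * x = x" "x * (q + r) = x" "(q + r) * y = y" "y * p = y" "idem p"
    by (rule eqvE)
  have 2: "(q + r) * q = q" "q * (q + r) = q" "(q + r) * r = r" "r * (q + r) = r"
    using assms by (auto simp: algebra_simps orth_def idem_def)
  have "x * (q * (y * x) * r) * y = 0" "x * (r * (y * x) * q) * y = 0"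
    using 1(4) 2 assms(4) by (simp_all add: orth_def)
  then have "orth (x * q * y) (x * r * y)"
    by (simp add: orth_def mult.assoc)
  moreover have "p = x * q * y + x * r * y"
    using 1 by (metis distrib_left distrib_right mult.assoc)
  ultimately show thesis
    using that eqv_conj(1) [OF 1(2,1,4,3), of q] eqv_conj(1) [OF 1(2,1,4,3), of r] 1 2 assms by metis
qed

lemma pdec_add:
  assumes "pdec p B" "pdec q C" "orth p q"
  shows "pdec (p + q) (B \<union> C)" "B \<inter> C = {}"
proof -
  have orth: "orth b c" if "b \<in> B" "c \<in> C" for b c
  proof -
    have "b * p = b" "p * b = b" "c * q = c" "q * c = c"
      using assms that orth_member_sum [of B b] orth_member_sum [of C c] by (auto simp: pdec_def prim_def)
    then have "b * c = b * (p * q) * c" "c * b = c * (q * p) * b"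
      by (metis mult.assoc)+
    with assms(3) show ?thesis by (auto simp: orth_def)
  qed
  show "B \<inter> C = {}"
  proof (rule ccontr)
    assume "B \<inter> C \<noteq> {}"
    then obtain b where "b \<in> B" "b \<in> C" by blast
    with orth assms show False by (force simp: orth_def pdec_def prim_def idem_def)
  qed
  then show "pdec (p + q) (B \<union> C)"
    using assms orth by (auto simp: pdec_def sum.union_disjoint pairwise_def intro: orth_sym)
qed

lemma pdec_prim: "prim p \<Longrightarrow> pdec p {p}"
  by (simp add: pdec_def)

lemma pdec_zero: "pdec 0 {}"
  by (simp add: pdec_def)

text \<open>Matched pairs are joined one at a time by \<open>eqv_add\<close>.\<close>

lemma eqv_pdec:
  assumes "pdec p B" "pdec q C" "bij_betw \<pi> B C" "\<And>b. b \<in> B \<Longrightarrow> eqv b (\<pi> b)"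
  shows "eqv p q"
proof -
  have *: "eqv (\<Sum>B) (\<Sum>b\<in>B. \<pi> b)"
    if "finite B" "pairwise orth B" "inj_on \<pi> B" "pairwise orth (\<pi> ` B)" "\<And>b. b \<in> B \<Longrightarrow> eqv b (\<pi> b)"
    using that
  proof (induction B)
    case empty
    then show ?case by (simp add: eqv_refl idem_zero)
  next
    case (insert b B)
    have "orth b x" "orth (\<pi> b) (\<pi> x)" if "x \<in> B" for x
    proof -
      have "b \<noteq> x" "\<pi> b \<noteq> \<pi> x"
        using insert.hyps insert.prems(2) that by auto
      then show "orth b x" "orth (\<pi> b) (\<pi> x)"
        using insert.prems(1,3) that by (auto simp: pairwise_def)
    qed
    then have "orth b (\<Sum>B)" "orth (\<pi> b) (\<Sum>(\<pi> ` B))"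
      by (auto intro!: orth_sum)
    moreover have "eqv (\<Sum>B) (sum \<pi> B)"
      using insert by (intro insert.IH) (auto simp: pairwise_insert)
    moreover have "\<Sum>(\<pi> ` B) = sum \<pi> B"
      using insert by (simp add: sum.reindex)
    ultimately show ?case
      using insert by (simp add: eqv_add)
  qed
  show ?thesis
    using * assms by (auto simp: pdec_def bij_betw_def sum.reindex)
qed

end

section \<open>Counting by type\<close>

lemma fibrewise_bij:
  assumes "finite B" "finite C" "\<And>i. card {b \<in> B. s b = i} = card {c \<in> C. t c = i}"
  obtains \<pi> where "bij_betw \<pi> B C" "\<And>b. b \<in> B \<Longrightarrow> t (\<pi> b) = s b"
proof -
  have "\<exists>f. bij_betw f {b \<in> B. s b = i} {c \<in> C. t c = i}" for i
    using assms by (intro finite_same_card_bij) auto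
  then obtain f where f: "\<And>i. bij_betw (f i) {b \<in> B. s b = i} {c \<in> C. t c = i}"
    by metis
  then have 1: "f (s b) b \<in> C" "t (f (s b) b) = s b" if "b \<in> B" for b
    using that by (auto simp: bij_betw_def)
  have "inj_on (\<lambda>b. f (s b) b) B"
  proof (rule inj_onI)
    fix b c assume bc: "b \<in> B" "c \<in> B" "f (s b) b = f (s c) c"
    then have "s b = s c" using 1 by metis
    with bc f [of "s b"] show "b = c"
      by (auto simp: bij_betw_def inj_on_def)
  qed
  moreover have "c \<in> (\<lambda>b. f (s b) b) ` B" if "c \<in> C" for c
  proof -
    from that have "c \<in> f (t c) ` {b \<in> B. s b = t c}"
      using f [of "t c"] by (auto simp: bij_betw_def)
    then obtain b where "b \<in> B" "s b = t c" "c = f (t c) b" by auto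
    then show ?thesis by (intro image_eqI [of _ _ b]) auto
  qed
  ultimately have "bij_betw (\<lambda>b. f (s b) b) B C"
    using 1 by (auto simp: bij_betw_def)
  with 1 that show thesis by blast
qed

lemma card_fibre_bij:
  assumes "bij_betw \<pi> B C" "\<And>b. b \<in> B \<Longrightarrow> t (\<pi> b) = s b"
  shows "card {b \<in> B. s b = i} = card {c \<in> C. t c = i}"
proof (rule bij_betw_same_card)
  show "bij_betw \<pi> {b \<in> B. s b = i} {c \<in> C. t c = i}"
    using assms by (force simp: bij_betw_def inj_on_def)
qed

lemma card_fibre_union:
  assumes "finite B" "finite C" "B \<inter> C = {}"
  shows "card {b \<in> B \<union> C. t b = i} = card {b \<in> B. t b = i} + card {b \<in> C. t b = i}"
proof -
  have "{b \<in> B \<union> C. t b = i} = {b \<in> B. t b = i} \<union> {b \<in> C. t b = i}" by auto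
  then show ?thesis using assms by (auto intro!: card_Un_disjoint)
qed

section \<open>Unique decompositions and dimension maps\<close>

text \<open>\<open>E N\<close> plays the role of the identity matrix of size \<open>N\<close>, regarded as an element of the
  algebra of all finite matrices.\<close>

locale stable_matrix_algebra = matrix_algebra +
  fixes E :: "nat \<Rightarrow> 'a"
  assumes shift: "idem p \<Longrightarrow> idem q \<Longrightarrow> \<exists>q'. eqv q q' \<and> orth p q'"
    and E_idem: "idem (E N)"
    and E_0: "E 0 = 0"
    and E_Suc: "\<exists>e. eqv (E 1) e \<and> orth (E N) e \<and> E (Suc N) = E N + e"
    and E_cover: "idem p \<Longrightarrow> \<exists>N\<ge>1. E N * p = p \<and> p * E N = p"
begin

text \<open>Since \<open>E N\<close> stands for the tuple repeated N times, this is the second half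
  of statement (1).\<close>

definition unique_pdec :: bool where
  "unique_pdec \<longleftrightarrow> (\<forall>p. idem p \<longrightarrow> (\<exists>B. pdec p B)) \<and>
     (\<forall>N\<ge>1. \<forall>B C. pdec (E N) B \<longrightarrow> pdec (E N) C \<longrightarrow> (\<exists>\<pi>. bij_betw \<pi> B C \<and> (\<forall>b\<in>B. eqv b (\<pi> b))))"

text \<open>The map t gives the similarity type of a summand, and \<open>n i\<close> is the
  multiplicity of type i. This is the algebraic form of the similarity of T to a direct sum of
  copies of the \<open>A i\<close>.\<close>

definition unit_pdec :: "nat \<Rightarrow> (nat \<Rightarrow> nat) \<Rightarrow> 'a set \<Rightarrow> ('a \<Rightarrow> nat) \<Rightarrow> bool" where
  "unit_pdec k n B t \<longleftrightarrow> pdec (E 1) B \<and> t ` B \<subseteq> {..<k} \<and>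
     (\<forall>b\<in>B. \<forall>c\<in>B. eqv b c \<longleftrightarrow> t b = t c) \<and> (\<forall>i<k. card {b \<in> B. t b = i} = n i)"

text \<open>An isomorphism of the semigroup of classes onto N^k, written on representatives. The
  clauses are range, well-definedness together with injectivity, additivity, and
  surjectivity.\<close>

definition dimension_map :: "nat \<Rightarrow> ('a \<Rightarrow> nat \<Rightarrow> nat) \<Rightarrow> bool" where
  "dimension_map k H \<longleftrightarrow>
     (\<forall>p. idem p \<longrightarrow> H p \<in> {..<k} \<rightarrow>\<^sub>E UNIV) \<and>
     (\<forall>p q. idem p \<longrightarrow> idem q \<longrightarrow> (H p = H q \<longleftrightarrow> eqv p q)) \<and>
     (\<forall>p q. idem p \<longrightarrow> idem q \<longrightarrow> orth p q \<longrightarrow> H (p + q) = (\<lambda>i\<in>{..<k}. H p i + H q i)) \<and>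
     (\<forall>c \<in> {..<k} \<rightarrow>\<^sub>E UNIV. \<exists>p. idem p \<and> H p = c)"

lemma classwise_bij:
  assumes B: "pdec p B" and C: "pdec q C" and cls: "\<And>b. prim b \<Longrightarrow> cls b < (k::nat)"
    and cls_eq: "\<And>b c. prim b \<Longrightarrow> prim c \<Longrightarrow> eqv b c \<longleftrightarrow> cls b = cls c"
    and card: "\<And>i. i < k \<Longrightarrow> card {b \<in> B. cls b = i} = card {b \<in> C. cls b = i}"
  obtains \<pi> where "bij_betw \<pi> B C" "\<And>b. b \<in> B \<Longrightarrow> eqv b (\<pi> b)"
proof -
  have "card {b \<in> B. cls b = i} = card {b \<in> C. cls b = i}" for i
  proof (cases "i < k")
    case False
    then have "{b \<in> B. cls b = i} = {}" "{b \<in> C. cls b = i} = {}"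
      using cls B C by (auto simp: pdec_def)
    then show ?thesis by (simp only:)
  qed (rule card)
  then obtain \<pi> where \<pi>: "bij_betw \<pi> B C" "\<And>b. b \<in> B \<Longrightarrow> cls (\<pi> b) = cls b"
    using fibrewise_bij [of B C cls cls] B C by (auto simp: pdec_def)
  have "eqv b (\<pi> b)" if "b \<in> B" for b
  proof -
    have "prim b" "prim (\<pi> b)" using that \<pi>(1) B C by (auto simp: pdec_def bij_betw_def)
    with \<pi>(2) [OF that] show ?thesis by (simp add: cls_eq)
  qed
  with \<pi>(1) show thesis by (rule that)
qed

text \<open>The value \<open>H p\<close> counts the members of each type in a primitive
  decomposition of p.\<close>

lemma dimension_map_of_unique_pdec:
  assumes u: "unique_pdec" and B: "unit_pdec k n B t" and n: "\<forall>i<k. 1 \<le> n i"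
  shows "\<exists>H. dimension_map k H \<and> H (E 1) = (\<lambda>i\<in>{..<k}. n i)"
proof -
  have B1: "pdec (E 1) B" and t: "\<And>b. b \<in> B \<Longrightarrow> t b < k"
    and eqv_t: "\<And>b c. b \<in> B \<Longrightarrow> c \<in> B \<Longrightarrow> eqv b c \<longleftrightarrow> t b = t c"
    and card_t: "\<And>i. i < k \<Longrightarrow> card {b \<in> B. t b = i} = n i"
    using B by (auto simp: unit_pdec_def)
  \<comment> \<open>Positivity of \<open>n i\<close> provides a representative \<open>c i\<close> of
    each type.\<close>
  have "\<exists>c. c \<in> B \<and> t c = i" if "i < k" for i
  proof (rule ccontr)
    assume "\<nexists>c. c \<in> B \<and> t c = i"
    then have "{b \<in> B. t b = i} = {}" by auto
    with card_t [OF that] n that show False by fastforce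
  qed
  then obtain c where c: "\<And>i. i < k \<Longrightarrow> c i \<in> B \<and> t (c i) = i"
    by metis
  \<comment> \<open>As \<open>E N\<close> is built from N orthogonal copies of \<open>E 1\<close>,
    it has a decomposition in which only the types of the \<open>c i\<close> occur.\<close>
  have E_dec: "\<exists>D. pdec (E N) D \<and> (\<forall>d\<in>D. \<exists>i<k. eqv d (c i))" for N
  proof (induction N)
    case 0
    then show ?case using E_0 pdec_zero by auto
  next
    case (Suc N)
    then obtain D where D: "pdec (E N) D" "\<forall>d\<in>D. \<exists>i<k. eqv d (c i)" by auto
    from E_Suc [of N] obtain e where e: "eqv (E 1) e" "orth (E N) e" "E (Suc N) = E N + e" by auto
    from pdec_eqv [OF B1 e(1)] obtain \<phi>
      where \<phi>: "inj_on \<phi> B" "pdec e (\<phi> ` B)" "\<And>b. b \<in> B \<Longrightarrow> eqv b (\<phi> b)" by blast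
    have "eqv (\<phi> b) (c (t b))" if "b \<in> B" for b
      using eqv_trans eqv_sym \<phi>(3) eqv_t c t that by metis
    with D \<phi> t have "\<forall>d\<in>D \<union> \<phi> ` B. \<exists>i<k. eqv d (c i)" by blast
    with pdec_add [OF D(1) \<phi>(2) e(2)] e(3) show ?case by auto
  qed
  have complement: "\<exists>N F. N \<ge> 1 \<and> orth p (E N - p) \<and> pdec (E N - p) F" if "idem p" for p
  proof -
    from E_cover that obtain N where N: "N \<ge> 1" "E N * p = p" "p * E N = p" by blast
    with that have "idem (E N - p)" "orth p (E N - p)"
      using idem_diff orth_diff E_idem by blast+
    with N u show ?thesis unfolding unique_pdec_def by blast
  qed
  have uniq: "\<exists>\<pi>. bij_betw \<pi> B C \<and> (\<forall>b\<in>B. eqv b (\<pi> b))" if "N \<ge> 1" "pdec (E N) B" "pdec (E N) C" for N B C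
    using u that by (auto simp: unique_pdec_def)
  \<comment> \<open>Completed by a decomposition of its complement, q becomes a member of a
    decomposition of some \<open>E N\<close>; uniqueness matches it with a member of D, whose types
    are known.\<close>
  have prim_class: "\<exists>i<k. eqv q (c i)" if q: "prim q" for q
  proof -
    have "idem q" using q by (simp add: prim_def)
    from complement [OF this] obtain N F where F: "N \<ge> 1" "orth q (E N - q)" "pdec (E N - q) F"
      by blast
    from pdec_add(1) [OF pdec_prim [OF q] F(3) F(2)]
    have 1: "pdec (E N) ({q} \<union> F)" by simp
    from E_dec obtain D where D: "pdec (E N) D" "\<forall>d\<in>D. \<exists>i<k. eqv d (c i)" by blast
    from uniq [OF F(1) 1 D(1)] obtain \<pi>
      where "bij_betw \<pi> ({q} \<union> F) D" "\<forall>b\<in>{q} \<union> F. eqv b (\<pi> b)" by blast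
    then have "\<pi> q \<in> D" "eqv q (\<pi> q)" by (auto simp: bij_betw_def)
    with D eqv_trans show ?thesis by blast
  qed
  define cls where "cls q = (SOME i. i < k \<and> eqv q (c i))" for q
  have cls: "cls q < k" "eqv q (c (cls q))" if "prim q" for q
    using someI_ex [OF prim_class [OF that, unfolded Bex_def]] by (auto simp: cls_def)
  have cls_eq: "eqv q r \<longleftrightarrow> cls q = cls r" if "prim q" "prim r" for q r
    using cls [OF that(1)] cls [OF that(2)] c eqv_t by (metis eqv_sym eqv_trans)
  have cls_B: "cls b = t b" if "b \<in> B" for b
    using that B1 cls [of b] c eqv_t by (auto simp: pdec_def)
  define cnt where "cnt B = (\<lambda>i\<in>{..<k}. card {b \<in> B. cls b = i})" for B
  define H where "H p = cnt (SOME B. pdec p B)" for p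
  have cnt_eq: "card {b \<in> B. cls b = i} = card {b \<in> C. cls b = i}"
    if "bij_betw \<pi> B C" "\<And>b. b \<in> B \<Longrightarrow> eqv b (\<pi> b)" "\<And>b. b \<in> B \<Longrightarrow> prim b" "\<And>b. b \<in> C \<Longrightarrow> prim b" for \<pi> B C i
  proof (rule card_fibre_bij [OF that(1)])
    show "cls (\<pi> b) = cls b" if "b \<in> B" for b
      using cls_eq [of b "\<pi> b"] \<open>\<And>b. b \<in> B \<Longrightarrow> eqv b (\<pi> b)\<close> [OF that] prim_eqv
        \<open>\<And>b. b \<in> B \<Longrightarrow> prim b\<close> [OF that] by metis
  qed
  \<comment> \<open>Two decompositions of p are completed by the same F, uniqueness is applied to
    \<open>E N\<close>, and the counts of F cancel.\<close>
  have H: "H p = cnt B" if "pdec p B" for p B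
  proof -
    define C where "C = (SOME B. pdec p B)"
    have C: "pdec p C" unfolding C_def using that by (rule someI)
    from complement [OF pdec_idem [OF that]] obtain N F
      where F: "N \<ge> 1" "orth p (E N - p)" "pdec (E N - p) F" by blast
    have 1: "pdec (E N) (B \<union> F)" "pdec (E N) (C \<union> F)" "B \<inter> F = {}" "C \<inter> F = {}"
      using pdec_add [OF that F(3,2)] pdec_add [OF C F(3,2)] by auto
    from uniq [OF F(1) 1(1,2)] obtain \<pi>
      where "bij_betw \<pi> (B \<union> F) (C \<union> F)" "\<And>b. b \<in> B \<union> F \<Longrightarrow> eqv b (\<pi> b)" by blast
    then have u1: "card {b \<in> B \<union> F. cls b = i} = card {b \<in> C \<union> F. cls b = i}" for i
      using 1 by (rule_tac cnt_eq) (auto simp: pdec_def)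
    have u2: "card {b \<in> B \<union> F. cls b = i} = card {b \<in> B. cls b = i} + card {b \<in> F. cls b = i}"
      "card {b \<in> C \<union> F. cls b = i} = card {b \<in> C. cls b = i} + card {b \<in> F. cls b = i}" for i
      by (rule card_fibre_union; use 1(3,4) that C F(3) in \<open>simp add: pdec_def\<close>)+
    have "card {b \<in> B. cls b = i} = card {b \<in> C. cls b = i}" for i
      using u1 [of i] u2 [of i] by linarith
    then show ?thesis by (simp add: H_def C_def [symmetric] cnt_def)
  qed
  have dec: "\<exists>B. pdec p B" if "idem p" for p
    using u that by (auto simp: unique_pdec_def)
  have H_range: "H p \<in> {..<k} \<rightarrow>\<^sub>E UNIV" for p
    by (auto simp: H_def cnt_def)
  have H_eqv: "H p = H q" if "eqv p q" for p q
  proof -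
    have "idem p" using that by (simp add: eqv_def)
    from dec [OF this] obtain B where B: "pdec p B" ..
    from pdec_eqv [OF B that] obtain \<phi>
      where \<phi>: "inj_on \<phi> B" "pdec q (\<phi> ` B)" "\<And>b. b \<in> B \<Longrightarrow> eqv b (\<phi> b)" by blast
    have "card {b \<in> B. cls b = i} = card {b \<in> \<phi> ` B. cls b = i}" for i
      using \<phi> B by (intro cnt_eq [of \<phi>]) (auto simp: bij_betw_def pdec_def)
    then show ?thesis by (simp add: H [OF B] H [OF \<phi>(2)] cnt_def)
  qed
  have H_inj: "eqv p q" if pq: "idem p" "idem q" "H p = H q" for p q
  proof -
    from dec [OF pq(1)] dec [OF pq(2)] obtain B C where B: "pdec p B" and C: "pdec q C" by blast
    have "card {b \<in> B. cls b = i} = card {b \<in> C. cls b = i}" if "i < k" for i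
      using fun_cong [OF pq(3), of i] that by (simp add: H [OF B] H [OF C] cnt_def)
    from classwise_bij [of p B q C cls k, OF B C cls(1) cls_eq this] obtain \<pi>
      where "bij_betw \<pi> B C" "\<And>b. b \<in> B \<Longrightarrow> eqv b (\<pi> b)" by blast
    with eqv_pdec B C show ?thesis by blast
  qed
  have H_add: "H (p + q) = (\<lambda>i\<in>{..<k}. H p i + H q i)" if pq: "idem p" "idem q" "orth p q" for p q
  proof -
    from dec [OF pq(1)] dec [OF pq(2)] obtain B C where B: "pdec p B" and C: "pdec q C" by blast
    from pdec_add [OF B C pq(3)] have BC: "pdec (p + q) (B \<union> C)" "B \<inter> C = {}" by auto
    have "card {b \<in> B \<union> C. cls b = i} = card {b \<in> B. cls b = i} + card {b \<in> C. cls b = i}" for i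
      by (rule card_fibre_union) (use B C BC(2) in \<open>simp_all add: pdec_def\<close>)
    then show ?thesis
      unfolding H [OF B] H [OF C] H [OF BC(1)] cnt_def by (intro restrict_ext) (simp only: restrict_apply if_True)
  qed
  have H_c: "H (c i) = (\<lambda>j\<in>{..<k}. if j = i then 1 else 0)" if "i < k" for i
  proof -
    have "prim (c i)" using c [OF that] B1 by (auto simp: pdec_def)
    moreover have "{b. b = c i \<and> cls b = j} = (if j = i then {c i} else {})" for j
      using c [OF that] cls_B by auto
    ultimately show ?thesis by (auto simp: H [OF pdec_prim] cnt_def)
  qed
  \<comment> \<open>Induction on the sum of the coordinates: a copy of \<open>c i\<close>, shifted
    to be orthogonal to what is already built, raises coordinate i by one.\<close>
  have H_surj: "\<exists>p. idem p \<and> H p = d" if "d \<in> {..<k} \<rightarrow>\<^sub>E UNIV" for d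
    using that
  proof (induction "\<Sum>i<k. d i" arbitrary: d)
    case 0
    then have "d i = 0" if "i < k" for i
      using that by simp
    with 0 have "d = (\<lambda>i\<in>{..<k}. 0)"
      by (auto simp: fun_eq_iff PiE_def extensional_def)
    moreover have "H 0 = (\<lambda>i\<in>{..<k}. 0)"
      by (simp add: H [OF pdec_zero] cnt_def)
    ultimately show ?case using idem_zero by metis
  next
    case (Suc s)
    then obtain i where i: "i < k" "d i \<noteq> 0"
      by (metis lessThan_iff sum.neutral nat.distinct(1))
    define d' where "d' = d (i := d i - 1)"
    have "(\<Sum>j<k. d j) = d i + (\<Sum>j\<in>{..<k} - {i}. d j)" "(\<Sum>j<k. d' j) = d' i + (\<Sum>j\<in>{..<k} - {i}. d' j)"
      using i by (auto intro: sum.remove)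
    moreover have "(\<Sum>j\<in>{..<k} - {i}. d' j) = (\<Sum>j\<in>{..<k} - {i}. d j)"
      by (rule sum.cong) (auto simp: d'_def)
    ultimately have "s = (\<Sum>j<k. d' j)"
      using Suc(2) i by (simp add: d'_def)
    moreover have "d' \<in> {..<k} \<rightarrow>\<^sub>E UNIV"
      using Suc.prems i by (auto simp: d'_def PiE_def extensional_def)
    ultimately obtain p where p: "idem p" "H p = d'"
      using Suc.hyps(1) by blast
    have ci: "idem (c i)" using c [OF i(1)] B1 by (auto simp: pdec_def prim_def)
    from shift [OF p(1) ci] obtain q where q: "eqv (c i) q" "orth p q" by blast
    then have "idem q" by (simp add: eqv_def)
    with p q have "H (p + q) = (\<lambda>j\<in>{..<k}. d' j + (if j = i then 1 else 0))"
      by (auto simp: H_add H_eqv [OF q(1), symmetric] H_c [OF i(1)])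
    also have "\<dots> = d"
      using Suc.prems i by (auto simp: d'_def fun_eq_iff PiE_def extensional_def)
    finally show ?case using idem_add [OF p(1) \<open>idem q\<close> q(2)] by blast
  qed
  have "H (E 1) = (\<lambda>i\<in>{..<k}. card {b \<in> B. t b = i})"
    unfolding H [OF B1] cnt_def by (intro restrict_ext arg_cong [of _ _ card]) (auto simp: cls_B)
  also have "\<dots> = (\<lambda>i\<in>{..<k}. n i)"
    using card_t by auto
  finally have "H (E 1) = (\<lambda>i\<in>{..<k}. n i)" .
  moreover have "dimension_map k H"
    unfolding dimension_map_def using H_range H_inj H_eqv H_add H_surj by blast
  ultimately show ?thesis by blast
qed

lemma unique_pdec_of_dimension_map:
  assumes H: "dimension_map k H" and n: "H (E 1) = (\<lambda>i\<in>{..<k}. n i)"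
  shows "unique_pdec \<and> (\<exists>B t. unit_pdec k n B t)"
proof -
  have H_range: "H p \<in> {..<k} \<rightarrow>\<^sub>E UNIV" if "idem p" for p
    using H that by (auto simp: dimension_map_def)
  have H_eq: "H p = H q \<longleftrightarrow> eqv p q" if "idem p" "idem q" for p q
    using H that by (auto simp: dimension_map_def)
  have H_add: "H (p + q) = (\<lambda>i\<in>{..<k}. H p i + H q i)" if "idem p" "idem q" "orth p q" for p q
    using H that by (auto simp: dimension_map_def)
  have H_surj: "\<exists>p. idem p \<and> H p = d" if "d \<in> {..<k} \<rightarrow>\<^sub>E UNIV" for d
    using H that by (auto simp: dimension_map_def)
  have H_ext: "H p = H q" if "idem p" "idem q" "\<And>i. i < k \<Longrightarrow> H p i = H q i" for p q
    using H_range [OF that(1)] H_range [OF that(2)] that(3) by (auto intro: PiE_ext)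
  have H_add_i: "H (p + q) i = H p i + H q i" if "idem p" "idem q" "orth p q" "i < k" for p q i
    using H_add [OF that(1-3)] that(4) by simp
  have H_0: "H 0 i = 0" if "i < k" for i
    using H_add_i [of 0 0 i] that by (simp add: idem_zero orth_def)
  \<comment> \<open>A zero vector equals H 0, so by injectivity p is equivalent to 0 and hence equal
    to it.\<close>
  have H_nz: "\<exists>i<k. H p i \<noteq> 0" if "idem p" "p \<noteq> 0" for p
  proof (rule ccontr)
    assume "\<not> (\<exists>i<k. H p i \<noteq> 0)"
    then have "H p = H 0" using that H_0 by (intro H_ext idem_zero) auto
    then have "eqv p 0" using that H_eq idem_zero by blast
    with that show False by (simp add: eqv_zero)
  qed
  define \<delta> where "\<delta> i = (\<lambda>j\<in>{..<k}. if j = i then 1 else 0 :: nat)" for i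
  have \<delta>_inj: "i = j" if "\<delta> i = \<delta> j" "i < k" for i j
    using fun_cong [OF that(1), of i] that(2) by (auto simp: \<delta>_def split: if_splits)
  \<comment> \<open>A unit vector is not the sum of two nonzero vectors, whereas both parts of a
    proper splitting have nonzero image by \<open>H_nz\<close>.\<close>
  have prim_\<delta>: "prim p" if p: "idem p" "i < k" "H p = \<delta> i" for p i
  proof -
    have "p \<noteq> 0"
      using H_0 [OF p(2)] p(2,3) by (auto simp: \<delta>_def)
    moreover have "q = 0 \<or> q = p" if q: "idem q" "p * q = q" "q * p = q" for q
    proof (rule ccontr)
      assume nt: "\<not> (q = 0 \<or> q = p)"
      have d: "idem (p - q)" "orth q (p - q)" "p - q \<noteq> 0"
        using idem_diff orth_diff p q nt by auto
      from H_nz [OF q(1)] nt obtain j where j: "j < k" "H q j \<noteq> 0" by blast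
      from H_nz [OF d(1,3)] obtain l where l: "l < k" "H (p - q) l \<noteq> 0" by blast
      have sum: "\<delta> i a = H q a + H (p - q) a" if "a < k" for a
        using H_add_i [OF q(1) d(1,2) that] p(3) by simp
      from sum [OF j(1)] sum [OF l(1)] j l show False
        by (auto simp: \<delta>_def split: if_splits)
    qed
    ultimately show ?thesis using p by (auto simp: prim_def)
  qed
  \<comment> \<open>Surjectivity realises \<delta> i and the remainder, \<open>shift\<close> makes
    the two orthogonal, injectivity makes their sum equivalent to p, and \<open>eqv_addE\<close>
    moves both parts below p.\<close>
  have split: "\<exists>q r. p = q + r \<and> orth q r \<and> idem q \<and> idem r \<and> H q = \<delta> i \<and> (\<forall>j<k. H p j = \<delta> i j + H r j)"
    if p: "idem p" "i < k" "H p i \<noteq> 0" for p i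
  proof -
    from H_surj [of "\<delta> i"] obtain q where q: "idem q" "H q = \<delta> i" by (auto simp: \<delta>_def)
    from H_surj [of "\<lambda>j\<in>{..<k}. H p j - \<delta> i j"] obtain r
      where r: "idem r" "H r = (\<lambda>j\<in>{..<k}. H p j - \<delta> i j)" by auto
    from shift [OF q(1) r(1)] obtain r' where r': "eqv r r'" "orth q r'" by blast
    then have "idem r'" by (simp add: eqv_def)
    then have Hr': "H r' = H r" using H_eq [OF _ r(1)] eqv_sym [OF r'(1)] by simp
    \<comment> \<open>The truncated subtraction is exact: \<open>H p i\<close> is nonzero, and
      \<delta> i vanishes at the other coordinates.\<close>
    have *: "H p j = \<delta> i j + H r j" if "j < k" for j
      using p that r by (auto simp: \<delta>_def)
    have "H (q + r') j = H p j" if "j < k" for j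
      using H_add_i [OF q(1) \<open>idem r'\<close> r'(2) that] * [OF that] q Hr' by simp
    then have "H p = H (q + r')"
      using p q \<open>idem r'\<close> r' by (intro H_ext) (auto intro: idem_add)
    then have "eqv p (q + r')"
      using H_eq [OF p(1) idem_add [OF q(1) \<open>idem r'\<close> r'(2)]] by simp
    then obtain q2 r2 where 2: "p = q2 + r2" "eqv q q2" "eqv r' r2" "orth q2 r2"
      using eqv_addE [OF _ q(1) \<open>idem r'\<close> r'(2)] by blast
    moreover have i2: "idem q2" "idem r2" using 2 by (auto simp: eqv_def)
    moreover have "H q2 = \<delta> i" "H r2 = H r"
      using H_eq [OF q(1) i2(1)] H_eq [OF \<open>idem r'\<close> i2(2)] 2 q(2) Hr' by auto
    ultimately show ?thesis using * by metis
  qed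
  \<comment> \<open>The part q with unit image that splits off from a primitive p is nonzero, hence
    all of p.\<close>
  have prim_type: "\<exists>i<k. H p = \<delta> i" if p: "prim p" for p
  proof -
    have "idem p" "p \<noteq> 0" using p by (auto simp: prim_def)
    then obtain i where i: "i < k" "H p i \<noteq> 0" using H_nz by blast
    from split [OF \<open>idem p\<close> i] obtain q r
      where q: "p = q + r" "orth q r" "idem q" "H q = \<delta> i" by blast
    have "p * q = q" "q * p = q"
      using q by (auto simp: orth_def idem_def algebra_simps)
    moreover have "q \<noteq> 0"
      using prim_\<delta> [OF q(3) i(1) q(4)] by (auto simp: prim_def)
    ultimately have "q = p" using p q(3) by (auto simp: prim_def)
    with q i show ?thesis by auto
  qed
  define cls where "cls q = (SOME i. i < k \<and> H q = \<delta> i)" for q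
  have cls: "cls q < k" "H q = \<delta> (cls q)" if "prim q" for q
    using someI_ex [OF prim_type [OF that, unfolded Bex_def]] by (auto simp: cls_def)
  have cls_eq: "eqv q r \<longleftrightarrow> cls q = cls r" if "prim q" "prim r" for q r
    using cls [OF that(1)] cls [OF that(2)] H_eq [of q r] that \<delta>_inj by (metis prim_def)
  have H_sum: "H (\<Sum>B) i = card {b \<in> B. cls b = i}"
    if "finite B" "\<forall>b\<in>B. prim b" "pairwise orth B" "i < k" for B i
    using that
  proof (induction B)
    case empty
    then show ?case by (simp add: H_0)
  next
    case (insert b B)
    have "orth b (\<Sum>B)"
    proof (rule orth_sum)
      fix c assume "c \<in> B"
      moreover from this have "b \<noteq> c" using insert.hyps by auto
      ultimately show "orth b c" using insert.prems by (auto simp: pairwise_def)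
    qed
    moreover have "idem b" "idem (\<Sum>B)"
      using insert.prems insert.hyps by (auto intro!: idem_sum simp: prim_def pairwise_insert)
    ultimately have "H (b + \<Sum>B) i = H b i + H (\<Sum>B) i"
      using H_add_i insert by blast
    moreover have "H b i = (if cls b = i then 1 else 0)"
      using cls [of b] insert.prems by (auto simp: \<delta>_def)
    moreover have "{c \<in> insert b B. cls c = i} = (if cls b = i then insert b {c \<in> B. cls c = i} else {c \<in> B. cls c = i})"
      by auto
    moreover have "H (\<Sum>B) i = card {c \<in> B. cls c = i}"
      using insert by (auto simp: pairwise_insert)
    ultimately show ?case
      using insert by simp
  qed
  have H_pdec: "H p i = card {b \<in> B. cls b = i}" if "pdec p B" "i < k" for p B i
    using H_sum [of B i] that by (auto simp: pdec_def)
  \<comment> \<open>Induction on the sum of the coordinates of \<open>H p\<close>: each splitting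
    removes one primitive summand and lowers the sum by one.\<close>
  have dec: "\<exists>B. pdec p B" if "idem p" for p
    using that
  proof (induction "\<Sum>i<k. H p i" arbitrary: p)
    case 0
    then have "\<not> (\<exists>i<k. H p i \<noteq> 0)" by simp
    with H_nz [OF \<open>idem p\<close>] have "p = 0" by blast
    then show ?case using pdec_zero by blast
  next
    case (Suc s)
    then obtain i where i: "i < k" "H p i \<noteq> 0"
      by (metis lessThan_iff sum.neutral nat.distinct(1))
    from split [OF Suc.prems i] obtain q r where q: "p = q + r" "orth q r" "idem q" "idem r"
      "H q = \<delta> i" "\<forall>j<k. H p j = \<delta> i j + H r j" by blast
    then have "(\<Sum>j<k. H p j) = (\<Sum>j<k. \<delta> i j + H r j)" by auto
    also have "\<dots> = (\<Sum>j<k. \<delta> i j) + (\<Sum>j<k. H r j)" by (rule sum.distrib)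
    also have "(\<Sum>j<k. \<delta> i j) = (\<Sum>j<k. if j = i then 1 else 0)"
      by (rule sum.cong) (auto simp: \<delta>_def)
    also have "\<dots> = 1" using i by simp
    finally have "s = (\<Sum>j<k. H r j)" using Suc(2) by simp
    with Suc.hyps(1) q obtain C where "pdec r C" by blast
    from pdec_add [OF pdec_prim this q(2)] prim_\<delta> [OF q(3) i(1) q(5)] q(1) show ?case by blast
  qed
  have uniq: "\<exists>\<pi>. bij_betw \<pi> B C \<and> (\<forall>b\<in>B. eqv b (\<pi> b))" if B: "pdec p B" and C: "pdec p C" for p B C
  proof -
    have card: "card {b \<in> B. cls b = i} = card {b \<in> C. cls b = i}" if "i < k" for i
      using H_pdec [OF B that] H_pdec [OF C that] by simp
    obtain \<pi> where "bij_betw \<pi> B C" "\<And>b. b \<in> B \<Longrightarrow> eqv b (\<pi> b)"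
      using classwise_bij [of p B p C cls k, OF B C cls(1) cls_eq card] by blast
    then show ?thesis by (intro exI [of _ \<pi>]) simp
  qed
  from dec [OF E_idem] obtain B where B: "pdec (E 1) B" ..
  have "unit_pdec k n B cls"
    unfolding unit_pdec_def
  proof (intro conjI ballI allI impI B)
    show "cls ` B \<subseteq> {..<k}"
      using cls(1) B unfolding pdec_def by blast
    show "eqv b c \<longleftrightarrow> cls b = cls c" if "b \<in> B" "c \<in> B" for b c
      using cls_eq that B by (auto simp: pdec_def)
    show "card {b \<in> B. cls b = i} = n i" if "i < k" for i
      using H_pdec [OF B that] n that by simp
  qed
  moreover have "unique_pdec"
    unfolding unique_pdec_def using dec uniq by blast
  ultimately show ?thesis by (intro conjI exI)
qed

end

section \<open>Bounded operators and their intertwiners\<close>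

text \<open>Additivity alone already gives a ring; complex linearity and boundedness are added by
  \<open>intertwiner\<close>.\<close>

typedef (overloaded) 'b endo = "{f :: 'b \<Rightarrow> 'b::ab_group_add. \<forall>x y. f (x + y) = f x + f y}"
  morphisms app Endo
  by (rule exI [of _ "\<lambda>x. x"]) simp

setup_lifting type_definition_endo

instantiation endo :: (ab_group_add) ring
begin

lift_definition zero_endo :: "'a endo" is "\<lambda>_. 0" by simp
lift_definition plus_endo :: "'a endo \<Rightarrow> 'a endo \<Rightarrow> 'a endo" is "\<lambda>f g x. f x + g x"
  by (simp add: algebra_simps)
lift_definition minus_endo :: "'a endo \<Rightarrow> 'a endo \<Rightarrow> 'a endo" is "\<lambda>f g x. f x - g x"
  by (simp add: algebra_simps)
lift_definition uminus_endo :: "'a endo \<Rightarrow> 'a endo" is "\<lambda>f x. - f x"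
  by (simp add: algebra_simps)
lift_definition times_endo :: "'a endo \<Rightarrow> 'a endo \<Rightarrow> 'a endo" is "\<lambda>f g x. f (g x)"
  by simp

instance
  by standard (transfer; simp add: fun_eq_iff algebra_simps)+

end

lemma endo_eqI: "(\<And>x. app f x = app g x) \<Longrightarrow> f = g"
  by transfer auto

lemma app_sum_endo: "app (sum f I) x = (\<Sum>i\<in>I. app (f i) x)"
  by (induction I rule: infinite_finite_induct) (simp_all add: zero_endo.rep_eq plus_endo.rep_eq)

lemma app_Endo: "(\<And>x y. f (x + y) = f x + f y) \<Longrightarrow> app (Endo f) = f"
  by (rule Endo_inverse) simp

section \<open>Bounded complex-linear maps on subspaces\<close>

lemma scaleC_one: "1 *\<^sub>C x = (x :: 'b::complex_inner)"
  using scaleR_scaleC [of 1 x] by simp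

lemma scaleC_minus_one: "(- 1) *\<^sub>C x = - (x :: 'b::complex_inner)"
  using scaleR_scaleC [of "- 1" x] by simp

lemma cinner_scaleC_right: "cinner x (c *\<^sub>C y) = cnj c * cinner x (y :: 'b::complex_inner)"
  by (metis cinner_commute cinner_scaleC_left complex_cnj_mult)

lemma norm_scaleC: "norm (c *\<^sub>C x) = cmod c * norm (x :: 'b::complex_inner)"
proof -
  have "cinner (c *\<^sub>C x) (c *\<^sub>C x) = (c * cnj c) * cinner x x"
    by (simp add: cinner_scaleC_left cinner_scaleC_right)
  then have "inner (c *\<^sub>C x) (c *\<^sub>C x) = (cmod c)\<^sup>2 * inner x x"
    by (simp add: inner_eq_Re_cinner complex_mult_cnj cmod_power2)
  then show ?thesis
    by (simp add: norm_eq_sqrt_inner real_sqrt_mult)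
qed

text \<open>This is \<open>bdd_ops\<close> freed from extensionality and from a codomain, so that it
  applies to composites written as plain lambda terms.\<close>

definition bdd_linear_on :: "'b::complex_inner set \<Rightarrow> ('b \<Rightarrow> 'c::complex_inner) \<Rightarrow> bool" where
  "bdd_linear_on V X \<longleftrightarrow> (\<forall>x\<in>V. \<forall>y\<in>V. X (x + y) = X x + X y) \<and>
     (\<forall>c. \<forall>x\<in>V. X (c *\<^sub>C x) = c *\<^sub>C X x) \<and> (\<exists>B. \<forall>x\<in>V. norm (X x) \<le> B * norm x)"

lemma bdd_ops_iff: "X \<in> bdd_ops V W \<longleftrightarrow> X \<in> V \<rightarrow>\<^sub>E W \<and> bdd_linear_on V X"
  by (auto simp: bdd_ops_def bdd_linear_on_def)

lemma bdd_linear_onI: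
  assumes "\<And>x y. x \<in> V \<Longrightarrow> y \<in> V \<Longrightarrow> X (x + y) = X x + X y"
    and "\<And>c x. x \<in> V \<Longrightarrow> X (c *\<^sub>C x) = c *\<^sub>C X x"
    and "\<And>x. x \<in> V \<Longrightarrow> norm (X x) \<le> B * norm x"
  shows "bdd_linear_on V X"
  unfolding bdd_linear_on_def using assms by blast

lemma bdd_linear_on_bound:
  assumes "bdd_linear_on V X"
  obtains B where "B > 0" "\<And>x. x \<in> V \<Longrightarrow> norm (X x) \<le> B * norm x"
proof -
  from assms obtain B where B: "\<And>x. x \<in> V \<Longrightarrow> norm (X x) \<le> B * norm x"
    unfolding bdd_linear_on_def by blast
  have "norm (X x) \<le> (\<bar>B\<bar> + 1) * norm x" if "x \<in> V" for x
  proof -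
    have "B * norm x \<le> (\<bar>B\<bar> + 1) * norm x" by (rule mult_right_mono) auto
    with B [OF that] show ?thesis by linarith
  qed
  with that [of "\<bar>B\<bar> + 1"] show thesis by simp
qed

lemma bdd_linear_on_cong: "(\<And>x. x \<in> V \<Longrightarrow> X x = Y x) \<Longrightarrow> csubspace V \<Longrightarrow> bdd_linear_on V X = bdd_linear_on V Y"
  by (simp add: bdd_linear_on_def csubspace_def)

lemma bdd_linear_on_subset: "bdd_linear_on W X \<Longrightarrow> V \<subseteq> W \<Longrightarrow> bdd_linear_on V X"
  unfolding bdd_linear_on_def by blast

lemma bdd_linear_on_id: "bdd_linear_on V (\<lambda>x. x)"
  by (rule bdd_linear_onI [of _ _ 1]) auto

lemma bdd_linear_on_zero: "bdd_linear_on V (\<lambda>x. 0)"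
  by (rule bdd_linear_onI [of _ _ 0]) (auto simp: scaleC_zero_right)

lemma bdd_linear_on_compose:
  assumes "bdd_linear_on V X" "bdd_linear_on W Y" "\<And>x. x \<in> V \<Longrightarrow> X x \<in> W"
  shows "bdd_linear_on V (\<lambda>x. Y (X x))"
proof -
  from assms(1) obtain B where B: "B > 0" "\<And>x. x \<in> V \<Longrightarrow> norm (X x) \<le> B * norm x"
    by (rule bdd_linear_on_bound) blast
  from assms(2) obtain C where C: "C > 0" "\<And>x. x \<in> W \<Longrightarrow> norm (Y x) \<le> C * norm x"
    by (rule bdd_linear_on_bound) blast
  show ?thesis
  proof (rule bdd_linear_onI)
    show "norm (Y (X x)) \<le> C * B * norm x" if "x \<in> V" for x
      using B(2) [OF that] C(2) [OF assms(3) [OF that]] C(1)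
      by (smt (verit, ccfv_SIG) mult.assoc mult_left_mono)
  qed (use assms in \<open>auto simp: bdd_linear_on_def\<close>)
qed

lemma bdd_linear_on_add:
  assumes "bdd_linear_on V X" "bdd_linear_on V Y"
  shows "bdd_linear_on V (\<lambda>x. X x + Y x)"
proof -
  from assms(1) obtain B where B: "\<And>x. x \<in> V \<Longrightarrow> norm (X x) \<le> B * norm x"
    by (rule bdd_linear_on_bound) blast
  from assms(2) obtain C where C: "\<And>x. x \<in> V \<Longrightarrow> norm (Y x) \<le> C * norm x"
    by (rule bdd_linear_on_bound) blast
  show ?thesis
  proof (rule bdd_linear_onI)
    show "norm (X x + Y x) \<le> (B + C) * norm x" if "x \<in> V" for x
      using B [OF that] C [OF that] norm_triangle_ineq [of "X x" "Y x"] by (simp add: algebra_simps)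
  qed (use assms in \<open>auto simp: bdd_linear_on_def scaleC_add_right\<close>)
qed

lemma bdd_linear_on_sum:
  "(\<And>i. i \<in> I \<Longrightarrow> bdd_linear_on V (X i)) \<Longrightarrow> bdd_linear_on V (\<lambda>x. \<Sum>i\<in>I. X i x)"
  by (induction I rule: infinite_finite_induct) (auto intro: bdd_linear_on_zero bdd_linear_on_add)

lemma bdd_linear_on_minus: "bdd_linear_on V X \<Longrightarrow> bdd_linear_on V (\<lambda>x. - X x)"
  unfolding bdd_linear_on_def
  by (metis add.inverse_distrib_swap add.commute norm_minus_cancel scaleC_minus_one scaleC_scaleC mult.commute)

lemma csubspace_UNIV: "csubspace UNIV"
  by (simp add: csubspace_def)

lemma csubspace_uminus: "csubspace V \<Longrightarrow> x \<in> V \<Longrightarrow> - x \<in> V"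
  unfolding csubspace_def by (metis scaleC_minus_one)

lemma csubspace_sum: "csubspace V \<Longrightarrow> (\<And>i. i \<in> I \<Longrightarrow> f i \<in> V) \<Longrightarrow> sum f I \<in> V"
  by (induction I rule: infinite_finite_induct) (auto simp: csubspace_def)

lemma bdd_linear_on_0: "bdd_linear_on V X \<Longrightarrow> csubspace V \<Longrightarrow> X 0 = 0"
  unfolding bdd_linear_on_def csubspace_def by (metis add_cancel_right_right)

lemma bdd_linear_on_apply_sum:
  assumes "bdd_linear_on V X" "csubspace V" "\<And>i. i \<in> I \<Longrightarrow> f i \<in> V"
  shows "X (sum f I) = (\<Sum>i\<in>I. X (f i))"
  using assms(3)
proof (induction I rule: infinite_finite_induct)
  case (insert i I)
  then have "sum f I \<in> V" by (intro csubspace_sum assms(2)) auto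
  with insert assms(1) show ?case by (simp add: bdd_linear_on_def)
qed (use bdd_linear_on_0 [OF assms(1,2)] in auto)

section \<open>Coordinates of finitely supported sequences\<close>

lift_definition single :: "nat \<Rightarrow> 'b::complex_inner \<Rightarrow> 'b fin_seq" is
  "\<lambda>i v j. if j = i then v else 0"
  by (erule finite_subset [rotated, of "{i}" for i, OF finite.intros(2)] | simp)+

lemma component_single: "component (single i v) j = (if j = i then v else 0)"
  by (simp add: single.rep_eq)

lemmas component_simps = zero_fin_seq.rep_eq plus_fin_seq.rep_eq minus_fin_seq.rep_eq
  scaleC_fin_seq.rep_eq component_single

lemma component_sum: "component (sum f I) j = (\<Sum>i\<in>I. component (f i) j)"
  by (induction I rule: infinite_finite_induct) (simp_all add: component_simps)

lemma component_Abs: "(\<And>i. i \<ge> N \<Longrightarrow> f i = 0) \<Longrightarrow> component (Abs_fin_seq f) = f"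
  by (rule Abs_fin_seq_inverse) (auto intro!: finite_subset [of _ "{..<N}"] simp: not_less [symmetric])

lemma single_add: "single i (x + y) = single i x + single i y"
  by (rule fin_seq_eqI) (simp add: component_simps)

lemma single_scaleC: "single i (c *\<^sub>C x) = c *\<^sub>C single i x"
  by (rule fin_seq_eqI) (simp add: component_simps scaleC_zero_right)

lemma norm_single: "norm (single i v) = norm v"
proof -
  have "cinner (single i v) (single i v) = cinner v v"
    by (subst cinner_fin_seq_superset [of "{i}"]) (auto simp: component_single)
  then show ?thesis by (simp add: norm_eq_sqrt_inner inner_eq_Re_cinner)
qed

lemma norm_component_le: "norm (component x i) \<le> norm x"
proof -
  define S where "S = insert i {i. component x i \<noteq> 0}"
  have S: "finite S" "{i. component x i \<noteq> 0} \<subseteq> S" "i \<in> S" by (auto simp: S_def finite_support)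
  have "inner x x = (\<Sum>i\<in>S. inner (component x i) (component x i))"
    unfolding inner_eq_Re_cinner [of x] cinner_fin_seq_superset [OF S(1,2)] by (simp add: inner_eq_Re_cinner)
  moreover have "inner (component x i) (component x i) \<le> (\<Sum>i\<in>S. inner (component x i) (component x i))"
    by (rule member_le_sum) (use S in auto)
  ultimately show ?thesis by (simp add: norm_eq_sqrt_inner)
qed

lemma bdd_linear_on_single: "bdd_linear_on V (single i)"
  by (rule bdd_linear_onI [of _ _ 1]) (auto simp: norm_single single_add single_scaleC)

lemma bdd_linear_on_component: "bdd_linear_on V (\<lambda>x. component x i)"
  by (rule bdd_linear_onI [of _ _ 1]) (auto simp: norm_component_le component_simps)

lemma sum_single_component:
  assumes "\<And>i. i \<ge> N \<Longrightarrow> component x i = 0"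
  shows "(\<Sum>i<N. single i (component x i)) = x"
  by (rule fin_seq_eqI) (use assms in \<open>auto simp: component_simps component_sum not_less\<close>)

section \<open>Intertwiners\<close>

text \<open>The pairs \<open>(V, S)\<close> are the objects of a category whose morphisms are the intertwiners.\<close>

definition obj :: "nat \<Rightarrow> 'b::complex_inner set \<Rightarrow> (nat \<Rightarrow> 'b \<Rightarrow> 'b) \<Rightarrow> bool" where
  "obj m V S \<longleftrightarrow> csubspace V \<and>
     (\<forall>j<m. (\<forall>x\<in>V. S j x \<in> V) \<and> (\<forall>x\<in>V. \<forall>y\<in>V. S j (x + y) = S j x + S j y))"

text \<open>Values outside of V are unrestricted, in contrast to \<open>bdd_ops\<close>;
  \<open>restrict_in_commutant\<close> passes to the extensional version.\<close>

definition intertwiner :: "nat \<Rightarrow> 'b::complex_inner set \<Rightarrow> (nat \<Rightarrow> 'b \<Rightarrow> 'b)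
    \<Rightarrow> 'c::complex_inner set \<Rightarrow> (nat \<Rightarrow> 'c \<Rightarrow> 'c) \<Rightarrow> ('b \<Rightarrow> 'c) \<Rightarrow> bool" where
  "intertwiner m V S W R X \<longleftrightarrow> bdd_linear_on V X \<and> (\<forall>x\<in>V. X x \<in> W) \<and>
     (\<forall>j<m. \<forall>x\<in>V. X (S j x) = R j (X x))"

lemma intertwinerI:
  "bdd_linear_on V X \<Longrightarrow> (\<And>x. x \<in> V \<Longrightarrow> X x \<in> W) \<Longrightarrow>
   (\<And>j x. j < m \<Longrightarrow> x \<in> V \<Longrightarrow> X (S j x) = R j (X x)) \<Longrightarrow> intertwiner m V S W R X"
  by (simp add: intertwiner_def)

lemma obj_csubspace: "obj m V S \<Longrightarrow> csubspace V"
  by (simp add: obj_def)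

lemma obj_zero: "obj m V S \<Longrightarrow> 0 \<in> V"
  by (simp add: obj_def csubspace_def)

lemma obj_add: "obj m V S \<Longrightarrow> x \<in> V \<Longrightarrow> y \<in> V \<Longrightarrow> x + y \<in> V"
  by (simp add: obj_def csubspace_def)

lemma obj_apply: "obj m V S \<Longrightarrow> j < m \<Longrightarrow> x \<in> V \<Longrightarrow> S j x \<in> V"
  by (simp add: obj_def)

lemma obj_apply_add: "obj m V S \<Longrightarrow> j < m \<Longrightarrow> x \<in> V \<Longrightarrow> y \<in> V \<Longrightarrow> S j (x + y) = S j x + S j y"
  by (simp add: obj_def)

lemma obj_apply_0: "obj m V S \<Longrightarrow> j < m \<Longrightarrow> S j 0 = 0"
  using obj_apply_add [of m V S j 0 0] by (simp add: obj_zero)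

lemma obj_apply_minus:
  assumes "obj m V S" "j < m" "x \<in> V"
  shows "S j (- x) = - S j x"
proof -
  have "S j (- x + x) = S j (- x) + S j x"
    using assms by (intro obj_apply_add) (auto intro: csubspace_uminus obj_csubspace)
  with assms show ?thesis by (simp add: obj_apply_0 eq_neg_iff_add_eq_0)
qed

lemma intertwiner_bdd: "intertwiner m V S W R X \<Longrightarrow> bdd_linear_on V X"
  by (simp add: intertwiner_def)

lemma intertwiner_mem: "intertwiner m V S W R X \<Longrightarrow> x \<in> V \<Longrightarrow> X x \<in> W"
  by (simp add: intertwiner_def)

lemma intertwiner_apply: "intertwiner m V S W R X \<Longrightarrow> j < m \<Longrightarrow> x \<in> V \<Longrightarrow> X (S j x) = R j (X x)"
  by (simp add: intertwiner_def)

lemma intertwiner_add: "intertwiner m V S W R X \<Longrightarrow> x \<in> V \<Longrightarrow> y \<in> V \<Longrightarrow> X (x + y) = X x + X y"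
  by (simp add: intertwiner_def bdd_linear_on_def)

lemma intertwiner_0: "intertwiner m V S W R X \<Longrightarrow> csubspace V \<Longrightarrow> X 0 = 0"
  by (rule bdd_linear_on_0 [OF intertwiner_bdd])

lemma intertwiner_apply_sum:
  "intertwiner m V S W R X \<Longrightarrow> csubspace V \<Longrightarrow> (\<And>i. i \<in> I \<Longrightarrow> f i \<in> V) \<Longrightarrow> X (sum f I) = (\<Sum>i\<in>I. X (f i))"
  by (rule bdd_linear_on_apply_sum [OF intertwiner_bdd])

lemma intertwiner_id: "intertwiner m V S V S (\<lambda>x. x)"
  by (simp add: intertwiner_def bdd_linear_on_id)

lemma intertwiner_zero: "obj m W R \<Longrightarrow> intertwiner m V S W R (\<lambda>x. 0)"
  by (simp add: intertwiner_def bdd_linear_on_zero obj_zero obj_apply_0)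

lemma intertwiner_compose:
  assumes "intertwiner m V S W R X" "intertwiner m W R U Q Y"
  shows "intertwiner m V S U Q (\<lambda>x. Y (X x))"
  using assms by (auto simp: intertwiner_def intro: bdd_linear_on_compose)

lemma intertwiner_plus:
  assumes "intertwiner m V S W R X" "intertwiner m V S W R Y" "obj m W R"
  shows "intertwiner m V S W R (\<lambda>x. X x + Y x)"
  using assms by (auto simp: intertwiner_def obj_apply_add intro: bdd_linear_on_add obj_add)

lemma intertwiner_uminus:
  assumes "intertwiner m V S W R X" "obj m W R"
  shows "intertwiner m V S W R (\<lambda>x. - X x)"
  using assms by (auto simp: intertwiner_def obj_apply_minus intro: bdd_linear_on_minus csubspace_uminus obj_csubspace)

lemma intertwiner_sum:
  assumes "\<And>i. i \<in> I \<Longrightarrow> intertwiner m V S W R (X i)" "obj m W R"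
  shows "intertwiner m V S W R (\<lambda>x. \<Sum>i\<in>I. X i x)"
  using assms(1)
  by (induction I rule: infinite_finite_induct) (auto intro: intertwiner_zero intertwiner_plus assms(2))

lemma intertwiner_cong:
  assumes "intertwiner m V S W R X" "obj m V S" "\<And>x. x \<in> V \<Longrightarrow> X x = Y x"
  shows "intertwiner m V S W R Y"
  using assms bdd_linear_on_cong [of V X Y] unfolding intertwiner_def
  by (auto simp: obj_apply obj_csubspace)

lemma obj_restrict:
  assumes "obj m V S" "W \<subseteq> V" "csubspace W" "\<And>j x. j < m \<Longrightarrow> x \<in> W \<Longrightarrow> S j x \<in> W"
  shows "obj m W (restrict_tuple W S)"
  using assms unfolding obj_def restrict_tuple_def
  by (auto simp: csubspace_def subset_iff)

lemma intertwiner_incl: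
  "W \<subseteq> V \<Longrightarrow> intertwiner m W (restrict_tuple W S) V S (\<lambda>x. x)"
  by (auto simp: intertwiner_def restrict_tuple_def bdd_linear_on_id)

lemma intertwiner_corestrict:
  "intertwiner m U Q V S X \<Longrightarrow> (\<And>x. x \<in> U \<Longrightarrow> X x \<in> W) \<Longrightarrow> intertwiner m U Q W (restrict_tuple W S) X"
  by (auto simp: intertwiner_def restrict_tuple_def)

section \<open>The commutant as a ring\<close>

lemma carrier_commutant:
  assumes "obj m V S"
  shows "X \<in> carrier (commutant m V S) \<longleftrightarrow> X \<in> extensional V \<and> intertwiner m V S V S X"
  using assms by (auto simp: commutant_def bdd_ops_iff intertwiner_def PiE_def)

lemma restrict_in_commutant:
  assumes "obj m V S" "intertwiner m V S V S X"
  shows "restrict X V \<in> carrier (commutant m V S)"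
  using assms by (auto simp: carrier_commutant intro: intertwiner_cong)

lemma commutant_eqI:
  assumes "obj m V S" "X \<in> carrier (commutant m V S)" "Y \<in> carrier (commutant m V S)" "\<And>x. x \<in> V \<Longrightarrow> X x = Y x"
  shows "X = Y"
  using assms by (auto simp: carrier_commutant intro: extensionalityI)

lemma commutant_simps:
  fixes m V S
  defines "R \<equiv> commutant m V S"
  shows "x \<in> V \<Longrightarrow> (X \<otimes>\<^bsub>R\<^esub> Y) x = X (Y x)"
  "x \<in> V \<Longrightarrow> (X \<oplus>\<^bsub>R\<^esub> Y) x = X x + Y x"
  "x \<in> V \<Longrightarrow> \<one>\<^bsub>R\<^esub> x = x"
  "x \<in> V \<Longrightarrow> \<zero>\<^bsub>R\<^esub> x = 0"
  by (simp_all add: R_def commutant_def compose_def)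

lemma commutant_closed:
  fixes m V S
  defines "R \<equiv> commutant m V S"
  assumes "obj m V S"
  shows "\<one>\<^bsub>R\<^esub> \<in> carrier R"
    and "\<zero>\<^bsub>R\<^esub> \<in> carrier R"
    and "X \<in> carrier R \<Longrightarrow> Y \<in> carrier R \<Longrightarrow> X \<otimes>\<^bsub>R\<^esub> Y \<in> carrier R"
    and "X \<in> carrier R \<Longrightarrow> Y \<in> carrier R \<Longrightarrow> X \<oplus>\<^bsub>R\<^esub> Y \<in> carrier R"
proof -
  show "\<one>\<^bsub>R\<^esub> \<in> carrier R"
    using restrict_in_commutant [OF assms(2) intertwiner_id] by (simp add: R_def commutant_def)
  show "\<zero>\<^bsub>R\<^esub> \<in> carrier R"
    using restrict_in_commutant [OF assms(2) intertwiner_zero [OF assms(2)]] by (simp add: R_def commutant_def)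
  assume X: "X \<in> carrier R" "Y \<in> carrier R"
  then have *: "intertwiner m V S V S X" "intertwiner m V S V S Y"
    using assms(2) by (auto simp: R_def carrier_commutant)
  show "X \<otimes>\<^bsub>R\<^esub> Y \<in> carrier R"
    using restrict_in_commutant [OF assms(2) intertwiner_compose [OF *(2,1)]]
    by (simp add: R_def commutant_def compose_def)
  show "X \<oplus>\<^bsub>R\<^esub> Y \<in> carrier R"
    using restrict_in_commutant [OF assms(2) intertwiner_plus [OF * assms(2)]] by (simp add: R_def commutant_def)
qed

text \<open>Members of the commutant are extensional, so each ring law may be checked pointwise on
  V.\<close>

lemma ring_commutant:
  assumes "obj m V S"
  shows "ring (commutant m V S)" (is "ring ?R")
proof -
  have mem: "X x \<in> V" if "X \<in> carrier ?R" "x \<in> V" for X x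
    using that assms by (auto simp: carrier_commutant intro: intertwiner_mem)
  have add: "X (x + y) = X x + X y" if "X \<in> carrier ?R" "x \<in> V" "y \<in> V" for X x y
    using that assms by (auto simp: carrier_commutant intro: intertwiner_add)
  note [simp] = commutant_simps commutant_closed [OF assms] mem obj_add [OF assms] obj_zero [OF assms] add
  note eqI = commutant_eqI [OF assms]
  show ?thesis
  proof (rule ringI)
    show "abelian_group ?R"
    proof (rule abelian_groupI)
      fix X assume X: "X \<in> carrier ?R"
      then have *: "(\<lambda>x\<in>V. - X x) \<in> carrier ?R"
        using assms by (intro restrict_in_commutant intertwiner_uminus) (auto simp: carrier_commutant)
      show "\<exists>Y\<in>carrier ?R. Y \<oplus>\<^bsub>?R\<^esub> X = \<zero>\<^bsub>?R\<^esub>"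
        by (rule bexI [OF _ *], rule eqI) (use X * in auto)
    qed (auto intro!: eqI)
    show "monoid ?R"
      by (rule monoidI) (auto intro!: eqI)
  qed (auto intro!: eqI)
qed

lemma finsum_commutant:
  assumes "obj m V S" "finite I" "\<And>i. i \<in> I \<Longrightarrow> X i \<in> carrier (commutant m V S)"
  shows "(\<Oplus>\<^bsub>commutant m V S\<^esub>i\<in>I. X i) = (\<lambda>x\<in>V. \<Sum>i\<in>I. X i x)"
proof -
  interpret ring "commutant m V S" by (rule ring_commutant [OF assms(1)])
  show ?thesis
    using assms(2,3)
  proof (induction I)
    case empty
    then show ?case unfolding finsum_empty by (simp add: commutant_def)
  next
    case (insert i I)
    then have "(\<Oplus>\<^bsub>commutant m V S\<^esub>i\<in>insert i I. X i) = X i \<oplus>\<^bsub>commutant m V S\<^esub> (\<Oplus>\<^bsub>commutant m V S\<^esub>i\<in>I. X i)"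
      by (intro finsum_insert) auto
    also have "(\<Oplus>\<^bsub>commutant m V S\<^esub>i\<in>I. X i) = (\<lambda>x\<in>V. \<Sum>i\<in>I. X i x)"
      using insert by auto
    also have "X i \<oplus>\<^bsub>commutant m V S\<^esub> (\<lambda>x\<in>V. \<Sum>i\<in>I. X i x) = (\<lambda>x\<in>V. \<Sum>i\<in>insert i I. X i x)"
      using insert by (auto simp: commutant_def fun_eq_iff)
    finally show ?case .
  qed
qed

section \<open>Idempotents as restrictions of a tuple\<close>

lemma component_lincomb_single:
  assumes "inj_on \<sigma> I" "finite I"
  shows "i \<in> I \<Longrightarrow> component (\<Sum>i\<in>I. single (\<sigma> i) (v i)) (\<sigma> i) = v i"
    and "j \<notin> \<sigma> ` I \<Longrightarrow> component (\<Sum>i\<in>I. single (\<sigma> i) (v i)) j = 0"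
proof -
  assume i: "i \<in> I"
  have "component (\<Sum>i\<in>I. single (\<sigma> i) (v i)) (\<sigma> i) = (\<Sum>l\<in>I. if l = i then v l else 0)"
    unfolding component_sum component_single
    by (rule sum.cong) (use assms(1) i in \<open>auto simp: inj_on_def\<close>)
  with i assms(2) show "component (\<Sum>i\<in>I. single (\<sigma> i) (v i)) (\<sigma> i) = v i" by simp
next
  assume j: "j \<notin> \<sigma> ` I"
  show "component (\<Sum>i\<in>I. single (\<sigma> i) (v i)) j = 0"
    unfolding component_sum component_single
    by (rule sum.neutral) (use j in auto)
qed

locale operator_tuple =
  fixes T :: "nat \<Rightarrow> 'a::complex_inner \<Rightarrow> 'a" and m :: nat
  assumes T: "j < m \<Longrightarrow> T j \<in> bdd_ops UNIV UNIV"
begin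

text \<open>On the first N coordinates this is \<open>copies_tuple N UNIV T\<close>, so all the
  repeated tuples live in one space. Finite support of the image rests on \<open>T_0\<close>, hence
  on j < m.\<close>

definition T_inf :: "nat \<Rightarrow> 'a fin_seq \<Rightarrow> 'a fin_seq" where
  "T_inf j x = Abs_fin_seq (\<lambda>i. T j (component x i))"

lemma T_add: "j < m \<Longrightarrow> T j (x + y) = T j x + T j y"
  using T by (auto simp: bdd_ops_def)

lemma T_0: "j < m \<Longrightarrow> T j 0 = 0"
  using T_add [of j 0 0] by simp

lemma component_T_inf: "j < m \<Longrightarrow> component (T_inf j x) i = T j (component x i)"
  unfolding T_inf_def
  by (subst Abs_fin_seq_inverse) (auto intro!: finite_subset [OF _ finite_support [of x]] simp: T_0)

lemma obj_T: "obj m UNIV T"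
  by (simp add: obj_def csubspace_UNIV T_add)

lemma obj_T_inf: "obj m UNIV T_inf"
  by (auto simp: obj_def csubspace_UNIV component_T_inf component_simps T_add intro!: fin_seq_eqI)

lemma intertwiner_single: "intertwiner m UNIV T UNIV T_inf (single i)"
  by (rule intertwinerI) (auto simp: bdd_linear_on_single component_T_inf component_simps T_0 intro!: fin_seq_eqI)

lemma intertwiner_component: "intertwiner m UNIV T_inf UNIV T (\<lambda>x. component x i)"
  by (rule intertwinerI) (auto simp: bdd_linear_on_component component_T_inf)

section \<open>Shifts and truncations\<close>

definition shift_up :: "nat \<Rightarrow> nat \<Rightarrow> 'a fin_seq endo" where
  "shift_up n K = Endo (\<lambda>x. \<Sum>i<K. single (i + n) (component x i))"

definition shift_down :: "nat \<Rightarrow> nat \<Rightarrow> 'a fin_seq endo" where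
  "shift_down n K = Endo (\<lambda>x. \<Sum>i<K. single i (component x (i + n)))"

definition cut :: "nat \<Rightarrow> 'a fin_seq endo" where
  "cut N = shift_up 0 N"

lemma app_shift_up: "app (shift_up n K) x = (\<Sum>i<K. single (i + n) (component x i))"
  unfolding shift_up_def
  by (subst app_Endo) (simp_all add: component_simps single_add sum.distrib)

lemma app_shift_down: "app (shift_down n K) x = (\<Sum>i<K. single i (component x (i + n)))"
  unfolding shift_down_def
  by (subst app_Endo) (simp_all add: component_simps single_add sum.distrib)

lemma component_shift_up:
  "component (app (shift_up n K) x) j = (if n \<le> j \<and> j < n + K then component x (j - n) else 0)"
proof (cases "n \<le> j \<and> j < n + K")
  case True
  then show ?thesis
    using component_lincomb_single(1) [of "\<lambda>i. i + n" "{..<K}" "j - n" "component x"]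
    by (auto simp: app_shift_up)
next
  case False
  then have "j \<notin> (\<lambda>i. i + n) ` {..<K}" by auto
  then show ?thesis
    using component_lincomb_single(2) [of "\<lambda>i. i + n" "{..<K}" j "component x"] False
    by (auto simp: app_shift_up)
qed

lemma component_shift_down:
  "component (app (shift_down n K) x) j = (if j < K then component x (j + n) else 0)"
  using component_lincomb_single(1) [of "\<lambda>i. i" "{..<K}" j "\<lambda>i. component x (i + n)"]
    component_lincomb_single(2) [of "\<lambda>i. i" "{..<K}" j "\<lambda>i. component x (i + n)"]
  by (auto simp: app_shift_down)

lemma component_cut: "component (app (cut N) x) j = (if j < N then component x j else 0)"
  by (simp add: cut_def component_shift_up)

lemmas shift_simps = times_endo.rep_eq plus_endo.rep_eq component_shift_up component_shift_down component_cut component_simps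

lemma cut_cut: "cut N * cut K = cut (min N K)"
  by (intro endo_eqI fin_seq_eqI) (simp add: shift_simps)

lemma intertwiner_shift_up: "intertwiner m UNIV T_inf UNIV T_inf (app (shift_up n K))"
  unfolding app_shift_up
  by (intro intertwiner_sum obj_T_inf intertwiner_compose [OF intertwiner_component intertwiner_single])

lemma intertwiner_shift_down: "intertwiner m UNIV T_inf UNIV T_inf (app (shift_down n K))"
  unfolding app_shift_down
  by (intro intertwiner_sum obj_T_inf intertwiner_compose [OF intertwiner_component intertwiner_single])

definition M :: "'a fin_seq endo set" where
  "M = {X. intertwiner m UNIV T_inf UNIV T_inf (app X) \<and> (\<exists>N. cut N * X = X \<and> X * cut N = X)}"

text \<open>Rows and columns may be bounded by different sizes; the larger one serves for
  both.\<close>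

lemma M_I: "intertwiner m UNIV T_inf UNIV T_inf (app X) \<Longrightarrow> cut N * X = X \<Longrightarrow> X * cut K = X \<Longrightarrow> X \<in> M"
  unfolding M_def
proof (intro CollectI conjI exI)
  assume X: "cut N * X = X" "X * cut K = X"
  show "cut (max N K) * X = X" "X * cut (max N K) = X"
    by (metis X cut_cut min_absorb2 mult.assoc max.cobounded1, metis X cut_cut min_absorb1 mult.assoc max.cobounded2)
qed

lemma M_cut_le:
  assumes "X \<in> M"
  obtains N where "\<And>K. K \<ge> N \<Longrightarrow> cut K * X = X" "\<And>K. K \<ge> N \<Longrightarrow> X * cut K = X"
proof -
  from assms obtain N where N: "cut N * X = X" "X * cut N = X" by (auto simp: M_def)
  show thesis
  proof (rule that [of N])
    fix K assume "N \<le> K"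
    then have "cut K * cut N = cut N" "cut N * cut K = cut N" by (simp_all add: cut_cut)
    with N show "cut K * X = X" "X * cut K = X" by (metis mult.assoc)+
  qed
qed

lemma M_intertwiner: "X \<in> M \<Longrightarrow> intertwiner m UNIV T_inf UNIV T_inf (app X)"
  by (simp add: M_def)

sublocale matrix_algebra M
proof
  show "0 \<in> M"
    by (rule M_I [of _ 0 0]) (simp_all add: zero_endo.rep_eq intertwiner_zero obj_T_inf)
next
  fix x y assume x: "x \<in> M" and y: "y \<in> M"
  from x obtain N where N: "\<And>K. K \<ge> N \<Longrightarrow> cut K * x = x" "\<And>K. K \<ge> N \<Longrightarrow> x * cut K = x"
    by (rule M_cut_le) blast
  from y obtain L where L: "\<And>K. K \<ge> L \<Longrightarrow> cut K * y = y" "\<And>K. K \<ge> L \<Longrightarrow> y * cut K = y"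
    by (rule M_cut_le) blast
  show "x + y \<in> M"
    by (rule M_I [of _ "max N L" "max N L"])
       (use N L M_intertwiner [OF x] M_intertwiner [OF y] in
         \<open>auto simp: distrib_left distrib_right plus_endo.rep_eq intro: intertwiner_plus obj_T_inf\<close>)
  show "- x \<in> M"
    by (rule M_I [of _ N N])
       (use N M_intertwiner [OF x] in \<open>auto simp: uminus_endo.rep_eq intro: intertwiner_uminus obj_T_inf\<close>)
  have "cut N * (x * y) = x * y" "x * y * cut L = x * y"
    using N L by (metis mult.assoc order_refl)+
  then show "x * y \<in> M"
    using intertwiner_compose [OF M_intertwiner [OF y] M_intertwiner [OF x]]
    by (intro M_I [of "x * y" N L]) (simp_all add: times_endo.rep_eq [abs_def])
qed

lemma shift_up_in_M: "shift_up n K \<in> M"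
  by (rule M_I [of _ "n + K" K]) (auto simp: intertwiner_shift_up shift_simps intro!: endo_eqI fin_seq_eqI)

lemma shift_down_in_M: "shift_down n K \<in> M"
  by (rule M_I [of _ K "n + K"]) (auto simp: intertwiner_shift_down shift_simps intro!: endo_eqI fin_seq_eqI)

lemma cut_in_M: "cut N \<in> M"
  by (simp add: cut_def shift_up_in_M)

lemma shift_down_up: "shift_down n K * shift_up n K = cut K"
  by (intro endo_eqI fin_seq_eqI) (simp add: shift_simps)

lemma cut_shift_up: "cut n * shift_up n K = 0" "shift_down n K * cut n = 0"
  by (intro endo_eqI fin_seq_eqI; simp add: shift_simps zero_endo.rep_eq)+

text \<open>Moving q down the diagonal by n is conjugation by the two shifts, whose product
  \<open>shift_down n K * shift_up n K = cut K\<close> is absorbed by q.\<close>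

lemma eqv_shift:
  assumes "idem q" "cut K * q = q" "q * cut K = q"
  shows "eqv q (shift_up n K * q * shift_down n K)"
proof -
  let ?q = "shift_up n K * q * shift_down n K"
  have 1: "q * shift_down n K * (shift_up n K * q) = q"
    using assms by (metis idem_def mult.assoc shift_down_up)
  have 2: "shift_up n K * q * (q * shift_down n K) = ?q"
    using assms by (metis idem_def mult.assoc)
  have "?q * ?q = shift_up n K * (q * shift_down n K * (shift_up n K * q)) * shift_down n K"
    by (simp add: mult.assoc)
  then have "idem ?q"
    unfolding 1 using idemD [OF assms(1)] by (auto simp: idem_def shift_up_in_M shift_down_in_M intro!: M_mult)
  with 1 2 assms show ?thesis
    by (intro eqvI [of _ _ "q * shift_down n K" "shift_up n K * q"])
       (auto simp: shift_up_in_M shift_down_in_M idem_def intro!: M_mult)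
qed

text \<open>The moved block starts at coordinate n, beyond the coordinates below n where p
  lives.\<close>

lemma orth_shift:
  assumes "cut n * p = p" "p * cut n = p"
  shows "orth p (shift_up n K * q * shift_down n K)"
  unfolding orth_def
proof
  have "p * (shift_up n K * q * shift_down n K) = p * (cut n * shift_up n K) * q * shift_down n K"
    using assms by (metis mult.assoc)
  then show "p * (shift_up n K * q * shift_down n K) = 0"
    by (simp add: cut_shift_up)
  have "shift_up n K * q * shift_down n K * p = shift_up n K * q * (shift_down n K * cut n) * p"
    using assms by (metis mult.assoc)
  then show "shift_up n K * q * shift_down n K * p = 0"
    by (simp add: cut_shift_up)
qed

sublocale stable_matrix_algebra M cut
proof
  fix p q :: "'a fin_seq endo" assume pq: "idem p" "idem q"
  from idemD(1) [OF pq(1)] obtain n where n: "\<And>K. K \<ge> n \<Longrightarrow> cut K * p = p" "\<And>K. K \<ge> n \<Longrightarrow> p * cut K = p"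
    by (rule M_cut_le) blast
  from idemD(1) [OF pq(2)] obtain K where K: "\<And>L. L \<ge> K \<Longrightarrow> cut L * q = q" "\<And>L. L \<ge> K \<Longrightarrow> q * cut L = q"
    by (rule M_cut_le) blast
  show "\<exists>q'. eqv q q' \<and> orth p q'"
    using eqv_shift [OF pq(2), of K] orth_shift [of n p] n K by blast
  show "\<exists>N\<ge>1. cut N * p = p \<and> p * cut N = p"
    using n [of "max n 1"] by (intro exI [of _ "max n 1"]) auto
next
  show idem: "idem (cut N)" for N
    by (simp add: idem_def cut_in_M cut_cut)
  show "cut 0 = 0"
    by (intro endo_eqI fin_seq_eqI) (simp add: shift_simps zero_endo.rep_eq)
  fix N
  \<comment> \<open>The diagonal entry at position N is the entry at position 0 moved down by
    N.\<close>
  have "cut (Suc N) = cut N + shift_up N 1 * cut 1 * shift_down N 1"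
    by (intro endo_eqI fin_seq_eqI) (auto simp: shift_simps less_Suc_eq)
  then show "\<exists>e. eqv (cut 1) e \<and> orth (cut N) e \<and> cut (Suc N) = cut N + e"
    using eqv_shift [OF idem, of 1 1 N] orth_shift [of N "cut N" 1 "cut 1"] by (auto simp: cut_cut)
qed

section \<open>Commutants as corners of \<open>M\<close>\<close>

text \<open>Up to the similarity given by \<open>f\<close> and \<open>g\<close>, the tuple \<open>S\<close> on \<open>V\<close> is the restriction of
  \<open>T_inf\<close> to the range of \<open>p\<close>.\<close>

definition rep :: "('a fin_seq \<Rightarrow> 'b::complex_inner) \<Rightarrow> ('b \<Rightarrow> 'a fin_seq) \<Rightarrow> 'b set \<Rightarrow> (nat \<Rightarrow> 'b \<Rightarrow> 'b)
    \<Rightarrow> 'a fin_seq endo \<Rightarrow> bool" where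
  "rep f g V S p \<longleftrightarrow> obj m V S \<and> intertwiner m UNIV T_inf V S f \<and> intertwiner m V S UNIV T_inf g \<and>
     (\<forall>x\<in>V. f (g x) = x) \<and> (\<forall>x. g (f x) = app p x) \<and> p \<in> M"

context
  fixes f :: "'a fin_seq \<Rightarrow> 'b::complex_inner" and g V S p
  assumes rep: "rep f g V S p"
begin

lemma rep_obj: "obj m V S" and rep_f: "intertwiner m UNIV T_inf V S f"
  and rep_g: "intertwiner m V S UNIV T_inf g" and rep_fg: "x \<in> V \<Longrightarrow> f (g x) = x"
  and rep_gf: "g (f y) = app p y" and rep_M: "p \<in> M"
  using rep by (auto simp: rep_def)

lemma rep_f_mem: "f x \<in> V"
  using intertwiner_mem [OF rep_f] by simp

lemma rep_idem: "idem p"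
  by (auto simp: idem_def rep_M times_endo.rep_eq rep_gf [symmetric] rep_fg rep_f_mem intro!: endo_eqI)

text \<open>Since f after g is the identity of V and g after f is p, \<open>enc\<close> and
  \<open>dec\<close> are mutually inverse ring isomorphisms between the commutant of S and the
  corner p M p.\<close>

definition enc :: "('b \<Rightarrow> 'b) \<Rightarrow> 'a fin_seq endo" where
  "enc X = Endo (\<lambda>x. g (X (f x)))"

definition dec :: "'a fin_seq endo \<Rightarrow> 'b \<Rightarrow> 'b" where
  "dec z = (\<lambda>v\<in>V. f (app z (g v)))"

abbreviation "R \<equiv> commutant m V S"

lemma commutant_intertwiner: "X \<in> carrier R \<Longrightarrow> intertwiner m V S V S X"
  by (simp add: carrier_commutant rep_obj)

lemma commutant_mem: "X \<in> carrier R \<Longrightarrow> x \<in> V \<Longrightarrow> X x \<in> V"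
  by (rule intertwiner_mem [OF commutant_intertwiner])

lemma intertwiner_enc: "X \<in> carrier R \<Longrightarrow> intertwiner m UNIV T_inf UNIV T_inf (\<lambda>x. g (X (f x)))"
  by (intro intertwiner_compose [OF _ rep_g] intertwiner_compose [OF rep_f] commutant_intertwiner)

lemma app_enc: "X \<in> carrier R \<Longrightarrow> app (enc X) x = g (X (f x))"
  unfolding enc_def by (subst app_Endo) (auto simp: intertwiner_add [OF intertwiner_enc])

lemma enc_absorb:
  assumes "X \<in> carrier R"
  shows "p * enc X = enc X" "enc X * p = enc X"
  using assms
  by (auto intro!: endo_eqI simp: times_endo.rep_eq app_enc rep_gf [symmetric] rep_fg rep_f_mem commutant_mem)

text \<open>Finiteness is inherited from p: by \<open>enc_absorb\<close>, a truncation that fixes p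
  from both sides also fixes \<open>enc X\<close>.\<close>

lemma enc_in_M:
  assumes "X \<in> carrier R"
  shows "enc X \<in> M"
proof -
  from rep_M obtain N where N: "cut N * p = p" "p * cut N = p" by (auto simp: M_def)
  show ?thesis
  proof (rule M_I)
    show "intertwiner m UNIV T_inf UNIV T_inf (app (enc X))"
      using intertwiner_enc [OF assms] by (simp add: app_enc [OF assms, abs_def])
    show "cut N * enc X = enc X" "enc X * cut N = enc X"
      using N enc_absorb [OF assms] by (metis mult.assoc)+
  qed
qed

lemma dec_closed: "z \<in> M \<Longrightarrow> dec z \<in> carrier R"
  unfolding dec_def
  by (intro restrict_in_commutant rep_obj intertwiner_compose [OF _ rep_f] intertwiner_compose [OF rep_g] M_intertwiner)

lemma enc_dec:
  assumes "z \<in> M" "p * z = z" "z * p = z"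
  shows "enc (dec z) = z"
proof (rule endo_eqI)
  fix x
  have "app (enc (dec z)) x = app (p * (z * p)) x"
    unfolding app_enc [OF dec_closed [OF assms(1)]]
    by (simp add: dec_def rep_f_mem rep_gf times_endo.rep_eq)
  then show "app (enc (dec z)) x = app z x" by (simp add: assms)
qed

lemma enc_inj:
  assumes "X \<in> carrier R" "Y \<in> carrier R" "enc X = enc Y"
  shows "X = Y"
proof (rule commutant_eqI [OF rep_obj assms(1,2)])
  fix x assume x: "x \<in> V"
  have "f (app (enc X) (g x)) = f (app (enc Y) (g x))" by (simp add: assms(3))
  with x show "X x = Y x"
    by (simp add: app_enc assms(1,2) rep_fg commutant_mem)
qed

lemma enc_mult: "X \<in> carrier R \<Longrightarrow> Y \<in> carrier R \<Longrightarrow> enc (X \<otimes>\<^bsub>R\<^esub> Y) = enc X * enc Y"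
  by (rule endo_eqI)
     (simp add: app_enc commutant_closed rep_obj commutant_simps rep_f_mem times_endo.rep_eq rep_fg commutant_mem)

lemma enc_one: "enc \<one>\<^bsub>R\<^esub> = p"
  by (rule endo_eqI) (simp add: app_enc commutant_closed rep_obj commutant_simps rep_f_mem rep_gf)

lemma g_0: "g 0 = 0"
  by (rule intertwiner_0 [OF rep_g obj_csubspace [OF rep_obj]])

lemma enc_zero: "enc \<zero>\<^bsub>R\<^esub> = 0"
  by (rule endo_eqI) (simp add: app_enc commutant_closed rep_obj commutant_simps rep_f_mem g_0 zero_endo.rep_eq)

lemma finsum_closed: "(\<And>i. i \<in> I \<Longrightarrow> P i \<in> carrier R) \<Longrightarrow> (\<Oplus>\<^bsub>R\<^esub>i\<in>I. P i) \<in> carrier R"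
  using abelian_monoid.finsum_closed [OF abelian_group.axioms(1) [OF ring.is_abelian_group [OF ring_commutant [OF rep_obj]]]]
  by (auto simp: Pi_def)

lemma enc_finsum:
  assumes "finite I" "\<And>i. i \<in> I \<Longrightarrow> P i \<in> carrier R"
  shows "enc (\<Oplus>\<^bsub>R\<^esub>i\<in>I. P i) = (\<Sum>i\<in>I. enc (P i))"
proof (rule endo_eqI)
  fix x
  have "app (enc (\<Oplus>\<^bsub>R\<^esub>i\<in>I. P i)) x = g ((\<Oplus>\<^bsub>R\<^esub>i\<in>I. P i) (f x))"
    by (rule app_enc [OF finsum_closed]) (rule assms)
  also have "\<dots> = g (\<Sum>i\<in>I. P i (f x))"
    using finsum_commutant [OF rep_obj assms] by (simp add: rep_f_mem)
  also have "\<dots> = (\<Sum>i\<in>I. g (P i (f x)))"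
    by (rule intertwiner_apply_sum [OF rep_g obj_csubspace [OF rep_obj]]) (simp add: commutant_mem assms rep_f_mem)
  also have "\<dots> = app (\<Sum>i\<in>I. enc (P i)) x"
    by (simp add: app_sum_endo app_enc assms)
  finally show "app (enc (\<Oplus>\<^bsub>R\<^esub>i\<in>I. P i)) x = app (\<Sum>i\<in>I. enc (P i)) x" .
qed

lemma idem_enc: "X \<in> idempotents R \<Longrightarrow> idem (enc X)"
  by (metis (mono_tags, lifting) enc_in_M enc_mult idem_def idempotents_def mem_Collect_eq)

lemma idempotents_dec:
  assumes "idem q" "p * q = q" "q * p = q"
  shows "dec q \<in> idempotents R"
proof -
  have q: "q \<in> M" "q * q = q" using assms by (auto simp: idem_def)
  have "enc (dec q \<otimes>\<^bsub>R\<^esub> dec q) = enc (dec q)"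
    using q by (simp add: enc_mult dec_closed enc_dec assms(2,3))
  then have "dec q \<otimes>\<^bsub>R\<^esub> dec q = dec q"
    by (rule enc_inj [rotated 2]) (auto intro: commutant_closed rep_obj dec_closed q)
  with q show ?thesis by (auto simp: idempotents_def dec_closed)
qed

text \<open>By \<open>enc\<close>, idempotents of the commutant correspond to idempotents below p,
  with zero and one going to 0 and p. The exclusion of the zero space matches the demand that p be
  nonzero.\<close>

lemma strongly_irreducible_iff_prim: "strongly_irreducible m V S \<longleftrightarrow> prim p"
proof -
  have "V \<noteq> {0} \<longleftrightarrow> p \<noteq> 0"
  proof
    assume "V \<noteq> {0}"
    then obtain v where v: "v \<in> V" "v \<noteq> 0" using obj_zero [OF rep_obj] by blast
    then have "f (app p (g v)) = v" by (simp add: rep_gf [symmetric] rep_fg)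
    with v show "p \<noteq> 0"
      using intertwiner_0 [OF rep_f csubspace_UNIV] by (auto simp: zero_endo.rep_eq)
  next
    assume "p \<noteq> 0"
    then obtain x where "app p x \<noteq> 0" by (metis endo_eqI zero_endo.rep_eq)
    then have "f x \<noteq> 0" using rep_gf [of x] g_0 by auto
    with rep_f_mem [of x] show "V \<noteq> {0}" by blast
  qed
  moreover have "idempotents R \<subseteq> {\<zero>\<^bsub>R\<^esub>, \<one>\<^bsub>R\<^esub>} \<longleftrightarrow> (\<forall>q. idem q \<longrightarrow> p * q = q \<longrightarrow> q * p = q \<longrightarrow> q = 0 \<or> q = p)"
  proof (intro iffI allI impI)
    fix q assume R: "idempotents R \<subseteq> {\<zero>\<^bsub>R\<^esub>, \<one>\<^bsub>R\<^esub>}" and q: "idem q" "p * q = q" "q * p = q"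
    from R idempotents_dec [OF q] have "dec q = \<zero>\<^bsub>R\<^esub> \<or> dec q = \<one>\<^bsub>R\<^esub>" by auto
    moreover have "enc (dec q) = q" using q by (intro enc_dec) (auto simp: idem_def)
    ultimately show "q = 0 \<or> q = p" using enc_zero enc_one by auto
  next
    assume p: "\<forall>q. idem q \<longrightarrow> p * q = q \<longrightarrow> q * p = q \<longrightarrow> q = 0 \<or> q = p"
    show "idempotents R \<subseteq> {\<zero>\<^bsub>R\<^esub>, \<one>\<^bsub>R\<^esub>}"
    proof
      fix X assume X: "X \<in> idempotents R"
      then have Xc: "X \<in> carrier R" by (simp add: idempotents_def)
      from p idem_enc [OF X] enc_absorb [OF Xc] have "enc X = 0 \<or> enc X = p" by blast
      then show "X \<in> {\<zero>\<^bsub>R\<^esub>, \<one>\<^bsub>R\<^esub>}"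
        using enc_inj [OF Xc] commutant_closed(1,2) [OF rep_obj] enc_zero enc_one by auto
    qed
  qed
  ultimately show ?thesis
    by (simp add: strongly_irreducible_def prim_def rep_idem)
qed

text \<open>The range of P is presented by the same g and by f followed by P, whose composite is
  \<open>enc P\<close>. Every summand of a decomposition thereby falls under the results of this
  context.\<close>

lemma rep_idempotent:
  assumes "P \<in> idempotents R"
  shows "rep (\<lambda>x. P (f x)) g (P ` V) (restrict_tuple (P ` V) S) (enc P)"
proof -
  have P: "P \<in> carrier R" "P \<otimes>\<^bsub>R\<^esub> P = P" using assms by (auto simp: idempotents_def)
  note Pi = commutant_intertwiner [OF P(1)]
  have PP: "P (P x) = P x" if "x \<in> V" for x
    using commutant_simps(1) [OF that, of m S P P] P(2) by simp
  have sub: "P ` V \<subseteq> V" using commutant_mem P(1) by blast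
  have "csubspace (P ` V)"
    using Pi obj_csubspace [OF rep_obj] intertwiner_0 [OF Pi obj_csubspace [OF rep_obj]]
    unfolding csubspace_def intertwiner_def bdd_linear_on_def
    by (auto simp: image_iff; metis)
  moreover have "S j x \<in> P ` V" if "j < m" "x \<in> P ` V" for j x
  proof -
    from that obtain y where "y \<in> V" "x = P y" by auto
    with that show ?thesis
      using intertwiner_apply [OF Pi, symmetric] obj_apply [OF rep_obj] by simp
  qed
  ultimately have "obj m (P ` V) (restrict_tuple (P ` V) S)"
    by (intro obj_restrict [OF rep_obj sub])
  then show ?thesis
    unfolding rep_def
    using sub P PP
    by (auto intro!: intertwiner_corestrict [OF intertwiner_compose [OF rep_f Pi]]
        intertwiner_compose [OF intertwiner_incl [OF sub] rep_g] enc_in_M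
        simp: rep_fg rep_f_mem app_enc commutant_mem)
qed

end

end

section \<open>Similarity and decompositions in terms of idempotents\<close>

context operator_tuple
begin

text \<open>Composition with the witnesses replaces p by y p x = q. One tuple on one space can thus
  be placed at any equivalent idempotent, which later produces the copies of
  \<open>H i\<close>.\<close>

lemma rep_eqv:
  assumes "rep f g V S p" "eqv p q"
  obtains f' g' where "rep f' g' V S q"
proof -
  note r = rep_obj [OF assms(1)] rep_f [OF assms(1)] rep_g [OF assms(1)]
  from assms(2) obtain x y where xy: "x \<in> M" "y \<in> M" "x * y = p" "y * x = q"
    "p * x = x" "x * q = x" "q * y = y" "y * p = y" "idem p" "idem q" by (rule eqvE)
  have "app x (app y v) = app p v" "app y (app x v) = app q v" for v
    using xy(3,4) by (auto simp: times_endo.rep_eq)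
  moreover have "app y (app p (app x v)) = app q v" for v
    using xy(4,5) by (metis times_endo.rep_eq)
  moreover have "f (app p (g v)) = v" if "v \<in> V" for v
    using rep_gf [OF assms(1), of "g v"] that by (simp add: rep_fg [OF assms(1)])
  ultimately have "rep (\<lambda>v. f (app x v)) (\<lambda>v. app y (g v)) V S q"
    unfolding rep_def using idemD(1) [OF xy(10)]
    by (auto intro!: r intertwiner_compose [OF M_intertwiner [OF xy(1)] r(2)]
       intertwiner_compose [OF r(3) M_intertwiner [OF xy(2)]] simp: rep_gf [OF assms(1)])
  then show thesis by (rule that)
qed

text \<open>An isomorphism X with inverse Y yields the witnesses g' X f and g Y f'; conversely, f' y
  g and f x g' are inverse isomorphisms.\<close>

lemma similar_iff_eqv:
  assumes p: "rep f g V S p" and q: "rep f' g' W Q q"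
  shows "similar m V S W Q \<longleftrightarrow> eqv p q"
proof
  note rp = rep_obj [OF p] rep_f [OF p] rep_g [OF p] and rq = rep_obj [OF q] rep_f [OF q] rep_g [OF q]
  assume "similar m V S W Q"
  then obtain X Y where XY: "X \<in> bdd_ops V W" "Y \<in> bdd_ops W V"
    "\<And>x. x \<in> V \<Longrightarrow> Y (X x) = x" "\<And>y. y \<in> W \<Longrightarrow> X (Y y) = y"
    "\<And>j x. j < m \<Longrightarrow> x \<in> V \<Longrightarrow> X (S j x) = Q j (X x)"
    unfolding similar_def by blast
  have X: "intertwiner m V S W Q X"
    using XY by (intro intertwinerI) (auto simp: bdd_ops_iff)
  \<comment> \<open>The definition of \<open>similar\<close> states the intertwining relation for X;
    applying Y to it gives the relation for the inverse.\<close>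
  have Y: "intertwiner m W Q V S Y"
  proof (rule intertwinerI)
    show "bdd_linear_on W Y" "\<And>x. x \<in> W \<Longrightarrow> Y x \<in> V" using XY(2) by (auto simp: bdd_ops_iff)
    fix j x assume j: "j < m" "x \<in> W"
    then have "Y x \<in> V" using XY(2) by (auto simp: bdd_ops_iff)
    then show "Y (Q j x) = S j (Y x)"
      using XY(3) [of "S j (Y x)"] XY(5) [of j "Y x"] XY(4) [of x] j obj_apply [OF rp(1)] by simp
  qed
  define y where "y = Endo (\<lambda>v. g' (X (f v)))"
  define x where "x = Endo (\<lambda>v. g (Y (f' v)))"
  have iy: "intertwiner m UNIV T_inf UNIV T_inf (\<lambda>v. g' (X (f v)))"
    by (rule intertwiner_compose [OF intertwiner_compose [OF rp(2) X] rq(3)])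
  have ix: "intertwiner m UNIV T_inf UNIV T_inf (\<lambda>v. g (Y (f' v)))"
    by (rule intertwiner_compose [OF intertwiner_compose [OF rq(2) Y] rp(3)])
  have ay: "app y = (\<lambda>v. g' (X (f v)))"
    unfolding y_def by (rule app_Endo) (auto simp: intertwiner_add [OF iy])
  have ax: "app x = (\<lambda>v. g (Y (f' v)))"
    unfolding x_def by (rule app_Endo) (auto simp: intertwiner_add [OF ix])
  note mem = rep_f_mem [OF p] rep_f_mem [OF q] intertwiner_mem [OF X] intertwiner_mem [OF Y]
  note [simp] = times_endo.rep_eq rep_gf [OF p, symmetric] rep_gf [OF q, symmetric]
    rep_fg [OF p] rep_fg [OF q] mem XY(3,4) ax ay
  have 1: "p * x = x" "x * q = x" "q * y = y" "y * p = y" "x * y = p" "y * x = q"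
    by (auto intro!: endo_eqI)
  from rep_M [OF p] obtain N where N: "cut N * p = p" "p * cut N = p" by (auto simp: M_def)
  from rep_M [OF q] obtain K where K: "cut K * q = q" "q * cut K = q" by (auto simp: M_def)
  have "x \<in> M"
  proof (rule M_I)
    show "cut N * x = x" "x * cut K = x" using N K 1 by (metis mult.assoc)+
  qed (use ix in \<open>simp only: ax\<close>)
  moreover have "y \<in> M"
  proof (rule M_I)
    show "cut K * y = y" "y * cut N = y" using N K 1 by (metis mult.assoc)+
  qed (use iy in \<open>simp only: ay\<close>)
  ultimately show "eqv p q"
    using 1 rep_idem [OF p] rep_idem [OF q] eqvI by blast
next
  note rp = rep_obj [OF p] rep_f [OF p] rep_g [OF p] and rq = rep_obj [OF q] rep_f [OF q] rep_g [OF q]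
  assume "eqv p q"
  then obtain x y where xy: "x \<in> M" "y \<in> M" "x * y = p" "y * x = q"
    "p * x = x" "x * q = x" "q * y = y" "y * p = y" "idem p" "idem q" by (rule eqvE)
  define X where "X = (\<lambda>v\<in>V. f' (app y (g v)))"
  define Y where "Y = (\<lambda>v\<in>W. f (app x (g' v)))"
  have X: "intertwiner m V S W Q X"
    by (rule intertwiner_cong [OF intertwiner_compose [OF intertwiner_compose [OF rp(3) M_intertwiner [OF xy(2)]] rq(2)] rp(1)])
       (simp add: X_def)
  have Y: "intertwiner m W Q V S Y"
    by (rule intertwiner_cong [OF intertwiner_compose [OF intertwiner_compose [OF rq(3) M_intertwiner [OF xy(1)]] rp(2)] rq(1)])
       (simp add: Y_def)
  have fpg: "f (app p (g v)) = v" if "v \<in> V" for v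
    using rep_gf [OF p, of "g v"] that by (simp add: rep_fg [OF p])
  have fqg: "f' (app q (g' v)) = v" if "v \<in> W" for v
    using rep_gf [OF q, of "g' v"] that by (simp add: rep_fg [OF q])
  have "x * q * y = p" "y * p * x = q" using xy by simp_all
  then have "app (x * q * y) v = app p v" "app (y * p * x) v = app q v" for v
    by (simp_all only:)
  then have xqy: "app x (app q (app y v)) = app p v" "app y (app p (app x v)) = app q v" for v
    by (simp_all add: times_endo.rep_eq)
  have "Y (X v) = v" if "v \<in> V" for v
    using that fpg [OF that] by (simp add: X_def Y_def rep_f_mem [OF q] rep_gf [OF q] xqy)
  moreover have "X (Y v) = v" if "v \<in> W" for v
    using that fqg [OF that] by (simp add: X_def Y_def rep_f_mem [OF p] rep_gf [OF p] xqy)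
  moreover have "X \<in> bdd_ops V W" "Y \<in> bdd_ops W V"
    using X Y by (auto simp: bdd_ops_iff intertwiner_def) (auto simp: X_def Y_def split: if_splits)
  ultimately show "similar m V S W Q"
    unfolding similar_def using intertwiner_apply [OF X] by blast
qed

text \<open>The left side speaks of an indexed family and \<open>pdec\<close> of a set. Injectivity
  bridges the two: equal orthogonal idempotents would be zero, which primitive ones are not.\<close>

lemma unit_finite_SI_decomposition_iff:
  assumes r: "rep f g V S p"
  shows "unit_finite_SI_decomposition m V S n P \<longleftrightarrow>
    (\<forall>i<n. P i \<in> carrier (commutant m V S)) \<and> inj_on (\<lambda>i. enc f g (P i)) {..<n} \<and>
    pdec p ((\<lambda>i. enc f g (P i)) ` {..<n})"
    (is "?L \<longleftrightarrow> ?R")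
proof
  let ?C = "commutant m V S"
  assume L: ?L
  then have P: "\<And>i. i < n \<Longrightarrow> P i \<in> idempotents ?C"
    and PP: "\<And>i j. i < n \<Longrightarrow> j < n \<Longrightarrow> i \<noteq> j \<Longrightarrow> P i \<otimes>\<^bsub>?C\<^esub> P j = \<zero>\<^bsub>?C\<^esub>"
    and sum: "(\<Oplus>\<^bsub>?C\<^esub>i\<in>{..<n}. P i) = \<one>\<^bsub>?C\<^esub>"
    and SI: "\<And>i. i < n \<Longrightarrow> strongly_irreducible m (P i ` V) (restrict_tuple (P i ` V) S)"
    by (auto simp: unit_finite_SI_decomposition_def unit_finite_decomposition_def Let_def)
  have Pc: "P i \<in> carrier ?C" if "i < n" for i
    using P [OF that] by (simp add: idempotents_def)
  have prim: "prim (enc f g (P i))" if "i < n" for i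
    using strongly_irreducible_iff_prim [OF rep_idempotent [OF r P [OF that]]] SI [OF that] by simp
  have orth: "orth (enc f g (P i)) (enc f g (P j))" if "i < n" "j < n" "i \<noteq> j" for i j
    using PP [of i j] PP [of j i] that Pc enc_mult [OF r, of "P i" "P j"] enc_mult [OF r, of "P j" "P i"]
    by (simp add: orth_def enc_zero [OF r])
  have inj: "inj_on (\<lambda>i. enc f g (P i)) {..<n}"
  proof (rule inj_onI, rule ccontr)
    fix i j assume ij: "i \<in> {..<n}" "j \<in> {..<n}" "enc f g (P i) = enc f g (P j)" "i \<noteq> j"
    with orth [of i j] prim [of i] show False by (auto simp: orth_def prim_def idem_def)
  qed
  have "(\<Sum>i<n. enc f g (P i)) = p"
    using enc_finsum [OF r, of "{..<n}" P] Pc sum enc_one [OF r] by simp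
  with inj prim orth Pc show ?R
    by (auto simp: pdec_def sum.reindex pairwise_def)
next
  let ?C = "commutant m V S"
  assume R: ?R
  let ?e = "\<lambda>i. enc f g (P i)"
  have Pc: "P i \<in> carrier ?C" and prim: "prim (?e i)" if "i < n" for i
    using R that by (auto simp: pdec_def)
  note [simp] = commutant_closed [OF rep_obj [OF r]]
  have inj: "i = j" if "i < n" "j < n" "?e i = ?e j" for i j
    using R that by (auto simp: inj_on_def)
  have P: "P i \<in> idempotents ?C" if "i < n" for i
  proof -
    have "?e i * ?e i = ?e i" using prim [OF that] by (auto simp: prim_def idem_def)
    then have "enc f g (P i \<otimes>\<^bsub>?C\<^esub> P i) = ?e i" by (simp add: enc_mult [OF r] Pc that)
    with enc_inj [OF r] Pc [OF that] show ?thesis by (auto simp: idempotents_def)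
  qed
  have "P i \<otimes>\<^bsub>?C\<^esub> P j = \<zero>\<^bsub>?C\<^esub>" if ij: "i < n" "j < n" "i \<noteq> j" for i j
  proof -
    have "?e i * ?e j = 0"
      using R inj [of i j] ij by (auto simp: pdec_def pairwise_def orth_def)
    then have "enc f g (P i \<otimes>\<^bsub>?C\<^esub> P j) = enc f g \<zero>\<^bsub>?C\<^esub>"
      by (simp add: enc_mult [OF r] enc_zero [OF r] Pc ij)
    then show ?thesis
      by (rule enc_inj [OF r, rotated 2]) (simp_all add: Pc ij)
  qed
  moreover have "(\<Oplus>\<^bsub>?C\<^esub>i\<in>{..<n}. P i) = \<one>\<^bsub>?C\<^esub>"
  proof (rule enc_inj [OF r])
    show "enc f g (\<Oplus>\<^bsub>?C\<^esub>i\<in>{..<n}. P i) = enc f g \<one>\<^bsub>?C\<^esub>"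
      using R enc_finsum [OF r, of "{..<n}" P] Pc by (auto simp: enc_one [OF r] pdec_def sum.reindex)
    show "(\<Oplus>\<^bsub>?C\<^esub>i\<in>{..<n}. P i) \<in> carrier ?C" by (rule finsum_closed [OF r]) (simp add: Pc)
  qed simp
  moreover have "strongly_irreducible m (P i ` V) (restrict_tuple (P i ` V) S)" if "i < n" for i
    using strongly_irreducible_iff_prim [OF rep_idempotent [OF r P [OF that]]] prim [OF that] by simp
  ultimately show ?L
    using P by (auto simp: unit_finite_SI_decomposition_def unit_finite_decomposition_def Let_def)
qed

text \<open>All members lie below p, so \<open>dec\<close> returns each of them to the
  commutant.\<close>

lemma pdec_enumerate:
  assumes r: "rep f g V S p" and B: "pdec p B"
  obtains n P where "unit_finite_SI_decomposition m V S n P" "(\<lambda>i. enc f g (P i)) ` {..<n} = B"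
proof -
  have fin: "finite B" and idem: "\<And>b. b \<in> B \<Longrightarrow> idem b" and "pairwise orth B" "\<Sum>B = p"
    using B by (auto simp: pdec_def prim_def)
  then have pb: "p * b = b" "b * p = b" if "b \<in> B" for b
    using orth_member_sum [of B b] that by auto
  from ex_bij_betw_nat_finite [OF fin] obtain b where b: "bij_betw b {..<card B} B"
    by (auto simp: lessThan_atLeast0)
  then have mem: "b i \<in> B" if "i < card B" for i using that by (auto simp: bij_betw_def)
  define P where "P i = dec f g V (b i)" for i
  have Pb: "enc f g (P i) = b i" if "i < card B" for i
    unfolding P_def using mem [OF that] pb idem by (intro enc_dec [OF r]) (auto simp: idem_def)
  have im: "(\<lambda>i. enc f g (P i)) ` {..<card B} = B"
    using b Pb by (auto simp: bij_betw_def)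
  have "inj_on (\<lambda>i. enc f g (P i)) {..<card B}"
    using b Pb by (auto simp: bij_betw_def inj_on_def)
  moreover have "P i \<in> carrier (commutant m V S)" if "i < card B" for i
    unfolding P_def using idem mem that by (intro dec_closed [OF r]) (auto simp: idem_def)
  ultimately have "unit_finite_SI_decomposition m V S (card B) P"
    using B im by (simp add: unit_finite_SI_decomposition_iff [OF r])
  with im show thesis by (rule_tac that)
qed

text \<open>The idempotents P of the commutant correspond by \<open>enc\<close> to the idempotents q
  below p, and \<open>rep_idempotent\<close> presents the restriction to the range of P at
  \<open>enc P\<close>.\<close>

lemma has_finite_SI_decomposition_iff:
  assumes r: "rep f g V S p"
  shows "has_finite_SI_decomposition m V S \<longleftrightarrow>
    (\<forall>q. idem q \<longrightarrow> p * q = q \<longrightarrow> q * p = q \<longrightarrow> (\<exists>B. pdec q B))"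
proof (intro iffI allI impI)
  fix q assume L: "has_finite_SI_decomposition m V S" and q: "idem q" "p * q = q" "q * p = q"
  let ?P = "dec f g V q"
  note P = idempotents_dec [OF r q]
  from L P obtain n Q where
    "unit_finite_SI_decomposition m (?P ` V) (restrict_tuple (?P ` V) S) n Q"
    unfolding has_finite_SI_decomposition_def by blast
  then show "\<exists>B. pdec q B"
    unfolding unit_finite_SI_decomposition_iff [OF rep_idempotent [OF r P]]
    using enc_dec [OF r idemD(1) [OF q(1)] q(2,3)] by auto
next
  assume R: "\<forall>q. idem q \<longrightarrow> p * q = q \<longrightarrow> q * p = q \<longrightarrow> (\<exists>B. pdec q B)"
  show "has_finite_SI_decomposition m V S"
    unfolding has_finite_SI_decomposition_def
  proof
    fix P assume P: "P \<in> idempotents (commutant m V S)"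
    then have "P \<in> carrier (commutant m V S)" by (simp add: idempotents_def)
    with R idem_enc [OF r P] enc_absorb [OF r] obtain B where "pdec (enc f g P) B" by blast
    from pdec_enumerate [OF rep_idempotent [OF r P] this]
    show "\<exists>n Q. unit_finite_SI_decomposition m (P ` V) (restrict_tuple (P ` V) S) n Q" by blast
  qed
qed

text \<open>The equivalences of the single summands are added up. Mixed products vanish by
  orthogonality, and as both families sum to p, the two sums are inverse to each other in p M
  p.\<close>

lemma Units_commutant_conj:
  assumes r: "rep f g V S p"
    and B: "finite I" "pdec p (b ` I)" "inj_on b I" and C: "pdec p (c ` I)" "inj_on c I"
    and eqv: "\<And>i. i \<in> I \<Longrightarrow> eqv (b i) (c i)"
  obtains x y where "x \<in> M" "y \<in> M" "p * x = x" "x * p = x" "p * y = y" "y * p = y" "x * y = p" "y * x = p"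
    "\<And>i. i \<in> I \<Longrightarrow> y * b i * x = c i"
proof -
  have "\<exists>x y. x \<in> M \<and> y \<in> M \<and> x * y = b i \<and> y * x = c i \<and> b i * x = x \<and> x * c i = x \<and> c i * y = y \<and> y * b i = y"
    if "i \<in> I" for i
    using eqv [OF that] by (elim eqvE) metis
  then have "\<forall>i. \<exists>x y. i \<in> I \<longrightarrow> x \<in> M \<and> y \<in> M \<and> x * y = b i \<and> y * x = c i \<and> b i * x = x \<and> x * c i = x \<and> c i * y = y \<and> y * b i = y"
    by blast
  then obtain x y where xy: "\<And>i. i \<in> I \<Longrightarrow> x i \<in> M" "\<And>i. i \<in> I \<Longrightarrow> y i \<in> M"
    "\<And>i. i \<in> I \<Longrightarrow> x i * y i = b i" "\<And>i. i \<in> I \<Longrightarrow> y i * x i = c i"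
    "\<And>i. i \<in> I \<Longrightarrow> b i * x i = x i" "\<And>i. i \<in> I \<Longrightarrow> x i * c i = x i"
    "\<And>i. i \<in> I \<Longrightarrow> c i * y i = y i" "\<And>i. i \<in> I \<Longrightarrow> y i * b i = y i"
    unfolding choice_iff by blast
  have sums: "(\<Sum>i\<in>I. b i) = p" "(\<Sum>i\<in>I. c i) = p"
    using B C by (auto simp: pdec_def sum.reindex)
  have orth: "b i * b j = 0" "c i * c j = 0" if "i \<in> I" "j \<in> I" "i \<noteq> j" for i j
  proof -
    have "b i \<noteq> b j" "c i \<noteq> c j"
      using B(3) C(2) that by (auto dest: inj_onD)
    then have "orth (b i) (b j)" "orth (c i) (c j)"
      using B(2) C(1) that by (auto simp: pdec_def intro: pairwiseD)
    then show "b i * b j = 0" "c i * c j = 0" by (simp_all add: orth_def)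
  qed
  have pb: "p * b i = b i" "b i * p = b i" "p * c i = c i" "c i * p = c i" if "i \<in> I" for i
    using B C that orth_member_sum [of "b ` I" "b i"] orth_member_sum [of "c ` I" "c i"]
    by (auto simp: pdec_def prim_def)
  have xy0: "x i * y j = 0" "y i * x j = 0" if "i \<in> I" "j \<in> I" "i \<noteq> j" for i j
  proof -
    have "x i * y j = x i * (c i * c j) * y j" "y i * x j = y i * (b i * b j) * x j"
      using xy that by (metis mult.assoc)+
    with orth that show "x i * y j = 0" "y i * x j = 0" by auto
  qed
  define X where "X = (\<Sum>i\<in>I. x i)"
  define Y where "Y = (\<Sum>i\<in>I. y i)"
  have delta: "(\<Sum>j\<in>I. h j) = h i" if "i \<in> I" "\<And>j. j \<in> I \<Longrightarrow> j \<noteq> i \<Longrightarrow> h j = 0" for h :: "_ \<Rightarrow> 'a fin_seq endo" and i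
    using B(1) that by (simp add: sum.remove [of I i] sum.neutral)
  have "X * Y = (\<Sum>i\<in>I. x i * y i)" "Y * X = (\<Sum>i\<in>I. y i * x i)"
    unfolding X_def Y_def sum_product using xy0 by (auto intro!: sum.cong delta)
  then have XY: "X * Y = p" "Y * X = p" using xy sums by auto
  have X: "p * X = X" "X * p = X" "p * Y = Y" "Y * p = Y"
    unfolding X_def Y_def sum_distrib_left sum_distrib_right
    using xy pb by (auto intro!: sum.cong; metis mult.assoc)+
  have "X \<in> M" "Y \<in> M" unfolding X_def Y_def using xy by (auto intro: M_sum)
  have conj: "Y * b i * X = c i" if i: "i \<in> I" for i
  proof -
    have "y j * b i = 0" if "j \<in> I" "j \<noteq> i" for j
    proof -
      have "y j * b i = y j * (b j * b i)" using xy that by (metis mult.assoc)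
      with orth that i show ?thesis by simp
    qed
    then have Yb: "Y * b i = y i"
      unfolding Y_def sum_distrib_right by (subst delta [OF i]) (use xy(8) [OF i] in auto)
    have "b i * x j = 0" if "j \<in> I" "j \<noteq> i" for j
    proof -
      have "b i * x j = b i * b j * x j" using xy that by (metis mult.assoc)
      with orth that i show ?thesis by simp
    qed
    then have bX: "b i * X = x i"
      unfolding X_def sum_distrib_left by (subst delta [OF i]) (use xy(5) [OF i] in auto)
    have "Y * b i * X = y i * b i * X" using Yb xy(8) [OF i] by simp
    also have "\<dots> = y i * (b i * X)" by (simp only: mult.assoc)
    finally show ?thesis using bX xy(4) [OF i] by simp
  qed
  show thesis
    by (rule that [OF \<open>X \<in> M\<close> \<open>Y \<in> M\<close> X XY conj])
qed

lemma has_unique_finite_SI_decomposition_iff: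
  assumes r: "rep f g V S p"
  shows "has_unique_finite_SI_decomposition m V S \<longleftrightarrow>
    (\<forall>q. idem q \<longrightarrow> p * q = q \<longrightarrow> q * p = q \<longrightarrow> (\<exists>B. pdec q B)) \<and>
    (\<forall>B C. pdec p B \<longrightarrow> pdec p C \<longrightarrow> (\<exists>\<pi>. bij_betw \<pi> B C \<and> (\<forall>b\<in>B. eqv b (\<pi> b))))"
    (is "_ \<longleftrightarrow> ?F \<and> ?U")
proof -
  let ?C = "commutant m V S"
  interpret C: ring ?C by (rule ring_commutant [OF rep_obj [OF r]])
  have "?U \<longleftrightarrow> (\<forall>n P k Q. unit_finite_SI_decomposition m V S n P \<longrightarrow>
        unit_finite_SI_decomposition m V S k Q \<longrightarrow>
        n = k \<and> (\<exists>X\<in>Units ?C. \<exists>\<pi>. bij_betw \<pi> {..<n} {..<n} \<and>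
            (\<forall>i<n. X \<otimes>\<^bsub>?C\<^esub> P i \<otimes>\<^bsub>?C\<^esub> inv\<^bsub>?C\<^esub> X = Q (\<pi> i))))" (is "_ \<longleftrightarrow> ?S")
  proof (intro iffI allI impI)
    fix n P k Q
    assume U: ?U and P: "unit_finite_SI_decomposition m V S n P" and Q: "unit_finite_SI_decomposition m V S k Q"
    let ?p = "\<lambda>i. enc f g (P i)" and ?q = "\<lambda>i. enc f g (Q i)"
    have P': "\<And>i. i < n \<Longrightarrow> P i \<in> carrier ?C" "inj_on ?p {..<n}" "pdec p (?p ` {..<n})"
      using P by (auto simp: unit_finite_SI_decomposition_iff [OF r])
    have Q': "\<And>i. i < k \<Longrightarrow> Q i \<in> carrier ?C" "inj_on ?q {..<k}" "pdec p (?q ` {..<k})"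
      using Q by (auto simp: unit_finite_SI_decomposition_iff [OF r])
    from U P'(3) Q'(3) obtain \<rho> where \<rho>: "bij_betw \<rho> (?p ` {..<n}) (?q ` {..<k})"
      "\<And>b. b \<in> ?p ` {..<n} \<Longrightarrow> eqv b (\<rho> b)" by blast
    \<comment> \<open>The bijection between the two sets of idempotents, read on their
      indices.\<close>
    define \<pi> where "\<pi> = the_inv_into {..<k} ?q \<circ> \<rho> \<circ> ?p"
    have \<pi>: "bij_betw \<pi> {..<n} {..<k}"
      unfolding \<pi>_def
      by (intro bij_betw_trans [OF _ bij_betw_trans [OF \<rho>(1)]] bij_betw_the_inv_into)
         (use P' Q' in \<open>auto simp: bij_betw_def comp_assoc\<close>)
    then have nk: "n = k" using bij_betw_same_card by fastforce
    have q\<pi>: "?q (\<pi> i) = \<rho> (?p i)" if "i < n" for i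
      using that \<rho>(1) Q'(2) by (auto simp: \<pi>_def bij_betw_def intro!: f_the_inv_into_f)
    have "(\<lambda>i. ?q (\<pi> i)) ` {..<n} = ?q ` {..<k}"
      using bij_betw_imp_surj_on [OF \<pi>] by (metis image_image)
    with Q'(3) have pd: "pdec p ((\<lambda>i. ?q (\<pi> i)) ` {..<n})" by (simp only:)
    have ij: "inj_on (\<lambda>i. ?q (\<pi> i)) {..<n}"
      using comp_inj_on [of \<pi> "{..<n}" ?q] \<pi> Q'(2) by (auto simp: bij_betw_def comp_def)
    have ev: "eqv (?p i) (?q (\<pi> i))" if "i \<in> {..<n}" for i
      using that \<rho>(2) q\<pi> by simp
    obtain x y where xy: "x \<in> M" "y \<in> M" "p * x = x" "x * p = x" "p * y = y" "y * p = y"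
      "x * y = p" "y * x = p" "\<And>i. i \<in> {..<n} \<Longrightarrow> y * ?p i * x = ?q (\<pi> i)"
      using Units_commutant_conj [OF r finite_lessThan P'(3,2) pd ij ev] by blast
    \<comment> \<open>The conjugation has the form y b x, so the invertible element asked for is the
      one corresponding to y.\<close>
    define X where "X = dec f g V y"
    define Y where "Y = dec f g V x"
    have XY: "X \<in> carrier ?C" "Y \<in> carrier ?C" "enc f g X = y" "enc f g Y = x"
      unfolding X_def Y_def using xy dec_closed [OF r] enc_dec [OF r] by auto
    have one: "X \<otimes>\<^bsub>?C\<^esub> Y = \<one>\<^bsub>?C\<^esub>" "Y \<otimes>\<^bsub>?C\<^esub> X = \<one>\<^bsub>?C\<^esub>"
      by (rule enc_inj [OF r]; use XY xy in \<open>simp add: enc_mult [OF r] enc_one [OF r]\<close>)+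
    then have "X \<in> Units ?C" using XY by (auto simp: Units_def)
    moreover have "inv\<^bsub>?C\<^esub> X = Y"
      using C.inv_unique' [OF XY(1,2) one] by simp
    moreover have "X \<otimes>\<^bsub>?C\<^esub> P i \<otimes>\<^bsub>?C\<^esub> Y = Q (\<pi> i)" if "i < n" for i
    proof (rule enc_inj [OF r])
      have "\<pi> i < k" using \<pi> that by (auto simp: bij_betw_def)
      then show "Q (\<pi> i) \<in> carrier ?C" by (rule Q'(1))
      show "enc f g (X \<otimes>\<^bsub>?C\<^esub> P i \<otimes>\<^bsub>?C\<^esub> Y) = enc f g (Q (\<pi> i))"
        using XY xy(9) [of i] that P'(1) [OF that] by (simp add: enc_mult [OF r])
    qed (use XY P'(1) [OF that] in simp)
    ultimately show "n = k \<and> (\<exists>X\<in>Units ?C. \<exists>\<pi>. bij_betw \<pi> {..<n} {..<n} \<and>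
            (\<forall>i<n. X \<otimes>\<^bsub>?C\<^esub> P i \<otimes>\<^bsub>?C\<^esub> inv\<^bsub>?C\<^esub> X = Q (\<pi> i)))"
      using nk \<pi> by auto
  next
    fix B C assume S: ?S and B: "pdec p B" and C: "pdec p C"
    from pdec_enumerate [OF r B] obtain n P where P: "unit_finite_SI_decomposition m V S n P" "(\<lambda>i. enc f g (P i)) ` {..<n} = B" by blast
    from pdec_enumerate [OF r C] obtain k Q where Q: "unit_finite_SI_decomposition m V S k Q" "(\<lambda>i. enc f g (Q i)) ` {..<k} = C" by blast
    let ?p = "\<lambda>i. enc f g (P i)" and ?q = "\<lambda>i. enc f g (Q i)"
    from S P(1) Q(1) obtain X \<pi> where nk: "n = k" and X: "X \<in> Units ?C" and \<pi>: "bij_betw \<pi> {..<n} {..<n}"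
      and conj: "\<And>i. i < n \<Longrightarrow> X \<otimes>\<^bsub>?C\<^esub> P i \<otimes>\<^bsub>?C\<^esub> inv\<^bsub>?C\<^esub> X = Q (\<pi> i)" by metis
    have Pc: "P i \<in> carrier ?C" if "i < n" for i
      using P(1) that by (auto simp: unit_finite_SI_decomposition_iff [OF r])
    have inj: "inj_on ?p {..<n}" "inj_on ?q {..<k}"
      using P(1) Q(1) by (auto simp: unit_finite_SI_decomposition_iff [OF r])
    let ?x = "enc f g X" and ?y = "enc f g (inv\<^bsub>?C\<^esub> X)"
    have Xc: "X \<in> carrier ?C" "inv\<^bsub>?C\<^esub> X \<in> carrier ?C" using X by auto
    have yx: "?y * ?x = p"
      using enc_mult [OF r Xc(2,1)] enc_one [OF r] C.Units_l_inv [OF X] by simp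
    \<comment> \<open>Cutting the unit and its inverse down by \<open>?p i\<close> gives witnesses
      of equivalence.\<close>
    have "eqv (?p i) (?q (\<pi> i))" if "i < n" for i
    proof (rule eqvI)
      have "\<pi> i < k" using \<pi> that nk by (auto simp: bij_betw_def)
      then show "idem (?q (\<pi> i))" using Q C by (auto simp: pdec_def prim_def)
      show i: "idem (?p i)" using P B that by (auto simp: pdec_def prim_def)
      have q: "?x * ?p i * ?y = ?q (\<pi> i)"
        unfolding conj [OF that, symmetric] using Xc Pc [OF that] by (simp add: enc_mult [OF r])
      show "?p i * ?y * (?x * ?p i) = ?p i"
        using yx enc_absorb [OF r Pc [OF that]] idemD(2) [OF i] by (metis mult.assoc)
      show "?x * ?p i * (?p i * ?y) = ?q (\<pi> i)"
        using q idemD(2) [OF i] by (metis mult.assoc)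
      show "?p i * ?y \<in> M" "?x * ?p i \<in> M"
        using Xc Pc [OF that] by (auto intro!: M_mult enc_in_M [OF r])
    qed
    moreover define \<rho> where "\<rho> = ?q \<circ> \<pi> \<circ> the_inv_into {..<n} ?p"
    moreover have "the_inv_into {..<n} ?p (?p i) = i" if "i < n" for i
      using the_inv_into_f_f [OF inj(1)] that by simp
    ultimately have "\<forall>b\<in>B. eqv b (\<rho> b)"
      using P(2) [symmetric] by auto
    moreover have "bij_betw ?p {..<n} B" "bij_betw ?q {..<n} C"
      using P(2) Q(2) inj nk by (auto simp: bij_betw_def)
    from bij_betw_the_inv_into [OF this(1)] this(2) have "bij_betw \<rho> B C"
      unfolding \<rho>_def comp_assoc by (blast intro: bij_betw_trans \<pi>)
    ultimately show "\<exists>\<pi>. bij_betw \<pi> B C \<and> (\<forall>b\<in>B. eqv b (\<pi> b))" by blast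
  qed
  then show ?thesis
    by (simp add: has_unique_finite_SI_decomposition_def has_finite_SI_decomposition_iff [OF r] Let_def)
qed

end

section \<open>Isomorphic Hilbert spaces are unitarily equivalent\<close>

subclass (in complex_hilbert) banach ..

text \<open>The representing vector is the minimiser of \<open>norm y ^ 2 / 2 - \<phi> y\<close>.\<close>

lemma riesz_representation:
  fixes \<phi> :: "'a::{real_inner, complete_space} \<Rightarrow> real"
  assumes "bounded_linear \<phi>"
  obtains z where "\<And>x. \<phi> x = inner z x"
proof -
  interpret bounded_linear \<phi> by (rule assms)
  define J where "J y = (norm y)\<^sup>2 / 2 - \<phi> y" for y
  from pos_bounded obtain K where K: "K > 0" "\<And>x. norm (\<phi> x) \<le> norm x * K" by blast
  \<comment> \<open>Completing the square, with \<open>\<phi> y\<close> bounded by K times the norm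
    of y.\<close>
  have lower: "J y \<ge> - K\<^sup>2 / 2" for y
  proof -
    have "0 \<le> (norm y - K)\<^sup>2" by simp
    then show ?thesis
      using K(2) [of y] by (simp add: J_def power2_diff)
  qed
  define I where "I = (INF y. J y)"
  have bdd: "bdd_below (range J)" using lower by (intro bdd_belowI2) auto
  have I_le: "I \<le> J y" for y unfolding I_def by (rule cINF_lower [OF bdd]) simp
  have "\<exists>y. J y < I + 1 / Suc k" for k
    using cINF_less_iff [OF _ bdd, of "I + 1 / Suc k"] by (simp add: I_def)
  then obtain y where y: "\<And>k. J (y k) < I + 1 / Suc k" by metis
  \<comment> \<open>The parallelogram law, in which the linear terms cancel. It makes a minimising
    sequence a Cauchy sequence.\<close>
  have par: "(norm (u - v))\<^sup>2 / 4 = J u + J v - 2 * J ((u + v) /\<^sub>R 2)" for u v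
    by (simp add: J_def power2_norm_eq_inner algebra_simps add scaleR inner_commute)
       (simp add: field_simps)
  have near: "(norm (y k - y l))\<^sup>2 \<le> 8 / Suc N" if "N \<le> k" "N \<le> l" for N k l
  proof -
    have "1 / real (Suc k) \<le> 1 / Suc N" "1 / real (Suc l) \<le> 1 / Suc N"
      using that by (simp_all add: frac_le)
    with par [of "y k" "y l"] y [of k] y [of l] I_le [of "(y k + y l) /\<^sub>R 2"] show ?thesis
      by simp
  qed
  have "Cauchy y"
  proof (rule metric_CauchyI)
    fix e :: real assume "0 < e"
    then obtain N where N: "8 / e\<^sup>2 < real N" using reals_Archimedean2 by blast
    show "\<exists>M. \<forall>k\<ge>M. \<forall>l\<ge>M. dist (y k) (y l) < e"
    proof (intro exI allI impI)
      fix k l assume "N \<le> k" "N \<le> l"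
      then have "(norm (y k - y l))\<^sup>2 \<le> 8 / Suc N" by (rule near)
      also have "\<dots> < e\<^sup>2"
        using N \<open>0 < e\<close> by (simp add: field_simps) (smt (verit) zero_less_power)
      finally show "dist (y k) (y l) < e"
        using \<open>0 < e\<close> by (simp add: dist_norm power2_less_imp_less)
    qed
  qed
  then obtain z where z: "y \<longlonglongrightarrow> z" using Cauchy_convergent_iff convergent_def by blast
  have "(\<lambda>k. J (y k)) \<longlonglongrightarrow> J z"
    unfolding J_def by (intro tendsto_intros z tendsto) simp
  moreover have "(\<lambda>k. I + 1 / Suc k) \<longlonglongrightarrow> I + 0"
    by (intro tendsto_intros LIMSEQ_Suc [OF lim_1_over_n])
  ultimately have "J z \<le> I + 0"
    by (rule LIMSEQ_le) (use y in \<open>auto intro: less_imp_le\<close>)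
  then have min: "J z \<le> J x" for x using I_le [of x] by simp
  have "\<phi> x = inner z x" for x
  proof -
    define d where "d = inner z x - \<phi> x"
    \<comment> \<open>Along a line J is a quadratic polynomial in t, whose linear coefficient d must
      vanish at a minimiser.\<close>
    have J: "J (z + t *\<^sub>R x) = J z + t * d + t\<^sup>2 * ((norm x)\<^sup>2 / 2)" for t
    proof -
      have "(norm (z + t *\<^sub>R x))\<^sup>2 = (norm z)\<^sup>2 + 2 * t * inner z x + t\<^sup>2 * (norm x)\<^sup>2"
        unfolding power2_norm_eq_inner
        by (simp add: inner_add_left inner_add_right inner_commute power2_eq_square)
      then show ?thesis
        by (simp add: J_def d_def add scaleR field_simps)
    qed
    show ?thesis
    proof (rule ccontr)
      assume "\<phi> x \<noteq> inner z x"
      then have d: "d \<noteq> 0" by (simp add: d_def)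
      \<comment> \<open>If d were nonzero, the step t = - d / s would lower J; the summand 1 keeps s
        positive when x = 0.\<close>
      define s where "s = (norm x)\<^sup>2 + 1"
      have s: "s > 0" by (simp add: s_def add_nonneg_pos)
      have "0 \<le> (- (d / s)) * d + (- (d / s))\<^sup>2 * ((norm x)\<^sup>2 / 2)"
        using min [of "z + (- (d / s)) *\<^sub>R x"] J [of "- (d / s)"] by simp
      also have "\<dots> \<le> (- (d / s)) * d + (d / s)\<^sup>2 * (s / 2)"
        by (simp add: s_def mult_left_mono)
      also have "\<dots> = - d\<^sup>2 / s / 2"
        using s by (simp add: field_simps power2_eq_square)
      finally show False using d s by (simp add: field_simps)
    qed
  qed
  then show thesis by (rule that)
qed

text \<open>Consequently a complex-linear map that preserves the real inner product preserves the
  complex one.\<close>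

lemma cinner_expand: "cinner x y = Complex (inner x y) (inner x (\<i> *\<^sub>C y))"
  by (rule complex_eqI) (simp_all add: inner_eq_Re_cinner cinner_scaleC_right)

text \<open>Let \<open>A\<close> be \<open>X\<^sup>* X\<close>, scaled so that \<open>B = 1 - A\<close> is a strict contraction. The map
  \<open>Z \<mapsto> (B + Z\<^sup>2) / 2\<close> is then a contraction of a small ball, and its fixed point gives the square
  root \<open>Q = 1 - Z\<close> of \<open>A\<close>. The unitary is \<open>X Q\<inverse>\<close>, up to the scaling.\<close>

lemma unitarily_equivalent_of_isomorphism:
  fixes X :: "'a::complex_hilbert \<Rightarrow> 'b::complex_inner"
  assumes D: "csubspace D" and X: "X \<in> bdd_ops UNIV D" and Y: "Y \<in> bdd_ops D UNIV"
    and YX: "\<And>x. Y (X x) = x" and XY: "\<And>y. y \<in> D \<Longrightarrow> X (Y y) = y"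
  shows "unitarily_equivalent (UNIV :: 'a set) D"
proof -
  have Xb: "bdd_linear_on UNIV X" and Yb: "bdd_linear_on D Y" and XD: "\<And>x. X x \<in> D"
    using X Y by (auto simp: bdd_ops_iff)
  have X_add: "X (x + y) = X x + X y" and X_scale: "X (c *\<^sub>C x) = c *\<^sub>C X x" for x y c
    using Xb by (auto simp: bdd_linear_on_def)
  obtain K where K: "K > 0" "\<And>x. norm (X x) \<le> K * norm x"
    using bdd_linear_on_bound [OF Xb] by (metis UNIV_I)
  obtain L where L: "L > 0" "\<And>y. y \<in> D \<Longrightarrow> norm (Y y) \<le> L * norm y"
    using bdd_linear_on_bound [OF Yb] by metis
  have below: "norm x \<le> L * norm (X x)" for x
    using L(2) [OF XD, of x] by (simp add: YX)
  \<comment> \<open>Chosen so that the squared norm of A x is at most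
    \<open>(norm x)\<^sup>2 / (\<tau> * L\<^sup>2)\<close>, while the inner product of A x and x is
    at least that much. In the expansion of the squared norm of x - A x the mixed term then
    outweighs the last one.\<close>
  define \<tau> where "\<tau> = K\<^sup>2 * K\<^sup>2 * L\<^sup>2"
  have Xlin: "bounded_linear X"
    by (rule bounded_linear_intro [of _ K]) (use X_add X_scale K in \<open>auto simp: scaleR_scaleC mult.commute\<close>)
  have \<tau>: "\<tau> > 0" using K(1) L(1) by (simp add: \<tau>_def)
  \<comment> \<open>The operator A is obtained from the real inner product; its complex linearity
    follows in \<open>A_scale\<close>, because inner products determine a vector.\<close>
  have "\<exists>z. \<forall>y. inner (X x) (X y) / \<tau> = inner z y" for x
  proof -
    have "bounded_linear (\<lambda>y. inner (X x) (X y) / \<tau>)"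
      by (intro bounded_linear_compose [OF bounded_linear_divide]
          bounded_linear_compose [OF bounded_linear_inner_right Xlin])
    from riesz_representation [OF this] show ?thesis by metis
  qed
  then obtain A where A: "\<And>x y. inner (A x) y = inner (X x) (X y) / \<tau>" by metis
  have eqI: "u = v" if "\<And>y. inner u y = inner v y" for u v :: 'a
  proof -
    have "inner (u - v) (u - v) = 0"
      unfolding inner_diff_left [of u v] by (simp only: that diff_self)
    then show ?thesis by simp
  qed
  have A_add: "A (x + y) = A x + A y" for x y
    by (rule eqI) (simp add: A inner_add_left X_add add_divide_distrib)
  have inner_C: "inner (c *\<^sub>C u) v = inner u (cnj c *\<^sub>C v)" for c and u v :: "'z::complex_inner"
    by (simp add: inner_eq_Re_cinner cinner_scaleC_left cinner_scaleC_right)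
  have A_scale: "A (c *\<^sub>C x) = c *\<^sub>C A x" for c x
    by (rule eqI) (simp add: A inner_C X_scale)
  have A_sym: "inner (A x) y = inner x (A y)" for x y
    unfolding inner_commute [of x "A y"] A by (simp add: inner_commute)
  have A_norm: "norm (A x) \<le> K\<^sup>2 / \<tau> * norm x" for x
  proof -
    have "(norm (A x))\<^sup>2 = inner (X x) (X (A x)) / \<tau>"
      by (simp add: power2_norm_eq_inner A)
    also have "\<dots> \<le> norm (X x) * norm (X (A x)) / \<tau>"
      using \<tau> by (intro divide_right_mono norm_cauchy_schwarz) auto
    also have "\<dots> \<le> (K * norm x) * (K * norm (A x)) / \<tau>"
      using \<tau> K by (intro divide_right_mono mult_mono) auto
    finally have "norm (A x) * norm (A x) \<le> (K\<^sup>2 / \<tau> * norm x) * norm (A x)"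
      by (simp add: power2_eq_square mult_ac)
    then have "0 < norm (A x) \<Longrightarrow> norm (A x) \<le> K\<^sup>2 / \<tau> * norm x"
      by (rule mult_right_le_imp_le)
    moreover have "0 \<le> K\<^sup>2 / \<tau> * norm x" using \<tau> by simp
    ultimately show ?thesis by (cases "norm (A x) = 0") auto
  qed
  have B_norm2: "(norm (x - A x))\<^sup>2 \<le> (1 - 1 / (\<tau> * L\<^sup>2)) * (norm x)\<^sup>2" for x
  proof -
    have "(norm x)\<^sup>2 \<le> (L * norm (X x))\<^sup>2"
      using below by (intro power_mono) auto
    then have "(norm x)\<^sup>2 / (\<tau> * L\<^sup>2) \<le> (norm (X x))\<^sup>2 / \<tau>"
      using \<tau> L(1) by (simp add: field_simps)
    moreover have "(norm (A x))\<^sup>2 \<le> (norm x)\<^sup>2 / (\<tau> * L\<^sup>2)"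
    proof -
      have "(norm (A x))\<^sup>2 \<le> (K\<^sup>2 / \<tau> * norm x)\<^sup>2"
        using A_norm by (intro power_mono) auto
      also have "\<dots> = (norm x)\<^sup>2 / (\<tau> * L\<^sup>2)"
        using K(1) L(1) by (simp add: \<tau>_def field_simps power2_eq_square)
      finally show ?thesis .
    qed
    moreover have "(norm (x - A x))\<^sup>2 = (norm x)\<^sup>2 - 2 * ((norm (X x))\<^sup>2 / \<tau>) + (norm (A x))\<^sup>2"
      using A [of x x] by (simp add: power2_norm_eq_inner inner_diff_left inner_diff_right inner_commute)
    ultimately show ?thesis by (simp add: left_diff_distrib)
  qed
  \<comment> \<open>The maximum with 0 covers the zero space, where K and L are unrelated; otherwise
    K L is at least 1.\<close>
  define \<beta> where "\<beta> = sqrt (max 0 (1 - 1 / (\<tau> * L\<^sup>2)))"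
  have \<beta>: "0 \<le> \<beta>" "\<beta> < 1"
    using \<tau> L(1) by (auto simp: \<beta>_def max_def)
  have B_norm: "norm (x - A x) \<le> \<beta> * norm x" for x
  proof (rule power2_le_imp_le)
    have "(1 - 1 / (\<tau> * L\<^sup>2)) * (norm x)\<^sup>2 \<le> max 0 (1 - 1 / (\<tau> * L\<^sup>2)) * (norm x)\<^sup>2"
      by (rule mult_right_mono) auto
    also have "\<dots> = (\<beta> * norm x)\<^sup>2"
      by (simp add: \<beta>_def power_mult_distrib)
    finally show "(norm (x - A x))\<^sup>2 \<le> (\<beta> * norm x)\<^sup>2"
      using B_norm2 [of x] by linarith
  qed (use \<beta> in simp)
  have A_scaleR: "A (t *\<^sub>R x) = t *\<^sub>R A x" for t x
    by (simp add: scaleR_scaleC A_scale)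
  have Blin: "bounded_linear (\<lambda>x. x - A x)"
    by (rule bounded_linear_intro [of _ \<beta>])
       (use B_norm in \<open>auto simp: A_add A_scaleR algebra_simps\<close>)
  define B where "B = Blinfun (\<lambda>x. x - A x)"
  have B: "blinfun_apply B x = x - A x" for x
    unfolding B_def by (simp add: bounded_linear_Blinfun_apply [OF Blin])
  have nB: "norm B \<le> \<beta>"
    using \<beta> B_norm by (intro norm_blinfun_bound) (auto simp: B)
  \<comment> \<open>The smaller root of \<open>r\<^sup>2 - 2 * r + \<beta> = 0\<close>: the map F
    then sends the ball of radius r into itself, and r < 1 serves as its contraction
    constant.\<close>
  define r where "r = 1 - sqrt (1 - \<beta>)"
  have r: "0 \<le> r" "r < 1" "(\<beta> + r\<^sup>2) / 2 = r"
    using \<beta> by (auto simp: r_def power2_diff)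
  \<comment> \<open>Symmetry and complex linearity are closed conditions preserved by F, so the
    fixed point inherits them.\<close>
  define S where "S = {Z :: 'a \<Rightarrow>\<^sub>L 'a. norm Z \<le> r \<and>
    (\<forall>x y. inner (blinfun_apply Z x) y = inner x (blinfun_apply Z y)) \<and>
    (\<forall>c x. blinfun_apply Z (c *\<^sub>C x) = c *\<^sub>C blinfun_apply Z x)}"
  define F where "F Z = (1/2) *\<^sub>R (B + (Z o\<^sub>L Z))" for Z :: "'a \<Rightarrow>\<^sub>L 'a"
  have F: "F Z x = (x - A x + Z (Z x)) /\<^sub>R 2" for Z :: "'a \<Rightarrow>\<^sub>L 'a" and x
    by (simp add: F_def blinfun.scaleR_left blinfun.add_left B)
  have scaleC_bl: "bounded_linear (\<lambda>x::'a. c *\<^sub>C x)" for c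
    by (rule bounded_linear_intro [of _ "cmod c"])
       (auto simp: scaleC_add_right scaleR_scaleC scaleC_scaleC mult.commute norm_scaleC)
  have "closed S"
    unfolding S_def
    by (intro closed_Collect_conj closed_Collect_all closed_Collect_le closed_Collect_eq continuous_intros
        linear_continuous_on_compose bounded_linear.continuous_on [OF scaleC_bl])
  then have "complete S" by (simp add: complete_eq_closed)
  moreover have "0 \<in> S" using r by (simp add: S_def scaleC_zero_right)
  then have "S \<noteq> {}" by blast
  moreover have "F ` S \<subseteq> S"
  proof clarify
    fix Z assume Z: "Z \<in> S"
    have "norm (Z o\<^sub>L Z) \<le> r * r"
      by (rule order_trans [OF norm_blinfun_compose]) (use Z r in \<open>auto simp: S_def intro: mult_mono\<close>)
    then have "norm (B + (Z o\<^sub>L Z)) \<le> \<beta> + r * r"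
      using norm_triangle_ineq [of B "Z o\<^sub>L Z"] nB by linarith
    then have "norm (F Z) \<le> r"
      using r(3) by (simp add: F_def power2_eq_square)
    moreover have "inner (F Z x) y = inner x (F Z y)" for x y
      using Z A_sym by (simp add: F S_def inner_add_left inner_add_right inner_diff_left inner_diff_right)
    moreover have "F Z (c *\<^sub>C x) = c *\<^sub>C F Z x" for c x
      using Z by (simp add: F S_def A_scale scaleR_scaleC scaleC_add_right scaleC_scaleC mult.commute diff_conv_add_uminus
          scaleC_minus_one [symmetric] del: add_uminus_conv_diff)
    ultimately show "F Z \<in> S" by (simp add: S_def)
  qed
  moreover have "dist (F Z) (F W) \<le> r * dist Z W" if "Z \<in> S" "W \<in> S" for Z W
  proof -
    \<comment> \<open>Z and W need not commute, so the difference of the squares is arranged as Z (Z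
      - W) + (Z - W) W.\<close>
    have "F Z - F W = (1/2) *\<^sub>R ((Z o\<^sub>L (Z - W)) + ((Z - W) o\<^sub>L W))"
      by (rule blinfun_eqI) (simp add: F_def blinfun.bilinear_simps algebra_simps)
    also have "norm \<dots> \<le> (1/2) * (norm (Z o\<^sub>L (Z - W)) + norm ((Z - W) o\<^sub>L W))"
      by (simp add: norm_triangle_ineq)
    also have "\<dots> \<le> (1/2) * (r * norm (Z - W) + norm (Z - W) * r)"
      using that by (intro mult_left_mono add_mono order_trans [OF norm_blinfun_compose] mult_mono r(1)) (auto simp: S_def)
    finally show ?thesis by (simp add: dist_norm mult.commute)
  qed
  ultimately have "\<exists>!Z. Z \<in> S \<and> F Z = Z"
    using r(1,2) by (intro Banach_fix) auto
  then obtain Z where Z: "Z \<in> S" "F Z = Z" by blast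
  have Z_norm: "norm (Z x) \<le> r * norm x" for x
    using norm_blinfun [of Z x] Z(1) mult_right_mono [of "norm Z" r "norm x"] by (auto simp: S_def)
  define Q where "Q x = x - Z x" for x
  \<comment> \<open>With B = 1 - A, the fixed point equation 2 Z = B + Z Z says that (1 - Z) (1 - Z)
    = A.\<close>
  have QQ: "Q (Q x) = A x" for x
  proof -
    have "x - A x + Z (Z x) = 2 *\<^sub>R Z x"
      using F [of Z x] Z(2) by (metis scaleR_half_double scaleR_scaleR scaleR_2 real_vector.scale_right_distrib mult.commute scaleR_one nonzero_divide_eq_eq inverse_eq_divide zero_neq_numeral)
    then show ?thesis
      by (simp add: Q_def blinfun.diff_right scaleR_2 algebra_simps)
  qed
  have Q_sym: "inner (Q x) y = inner x (Q y)" for x y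
    using Z(1) by (simp add: Q_def S_def inner_diff_left inner_diff_right)
  have Q_add: "Q (x + y) = Q x + Q y" for x y
    by (simp add: Q_def blinfun.add_right)
  have Q_scale: "Q (c *\<^sub>C x) = c *\<^sub>C Q x" for c x
  proof -
    have "c *\<^sub>C (x - Z x) = c *\<^sub>C x + c *\<^sub>C ((- 1) *\<^sub>C Z x)"
      by (simp add: scaleC_add_right [symmetric] scaleC_minus_one)
    also have "\<dots> = c *\<^sub>C x - c *\<^sub>C Z x"
      by (metis mult.commute scaleC_minus_one scaleC_scaleC uminus_add_conv_diff add.commute)
    finally show ?thesis
      using Z(1) by (simp add: Q_def S_def)
  qed
  \<comment> \<open>Solving Q x = z amounts to finding a fixed point of x \<mapsto> z + Z x, which
    is again a contraction. Hence Q is bijective.\<close>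
  have "\<exists>!x. z + Z x = x" for z
  proof (rule banach_fix_type [OF r(1,2)], intro allI)
    show "dist (z + Z x) (z + Z y) \<le> r * dist x y" for x y
      using Z_norm [of "x - y"] by (simp add: dist_norm blinfun.diff_right)
  qed
  then have Q_bij: "\<exists>!x. Q x = z" for z
    by (simp add: Q_def algebra_simps eq_diff_eq) (metis add.commute)
  define Q' where "Q' z = (THE x. Q x = z)" for z
  have QQ': "Q (Q' z) = z" for z
    unfolding Q'_def using theI' [OF Q_bij] .
  have Q'Q: "Q' (Q z) = z" for z
    unfolding Q'_def using Q_bij [of "Q z"] by (rule the1_equality) simp
  have Q'_add: "Q' (x + y) = Q' x + Q' y" for x y
    by (metis Q_add QQ' Q'Q)
  have Q'_scale: "Q' (c *\<^sub>C x) = c *\<^sub>C Q' x" for c x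
    by (metis Q_scale QQ' Q'Q)
  \<comment> \<open>This factor undoes the division by \<tau> in A.\<close>
  define s where "s = 1 / sqrt \<tau>"
  have s: "s * s = 1 / \<tau>" "s * sqrt \<tau> = 1" using \<tau> by (simp_all add: s_def)
  define U where "U x = complex_of_real s *\<^sub>C X (Q' x)" for x
  have U_inner: "inner (U x) (U y) = inner x y" for x y
  proof -
    have "inner (U x) (U y) = inner (X (Q' x)) (X (Q' y)) / \<tau>"
      using s(1) by (simp add: U_def scaleR_scaleC [symmetric] mult.assoc [symmetric])
    also have "\<dots> = inner (Q (Q (Q' x))) (Q' y)" by (simp add: A QQ)
    also have "\<dots> = inner (Q (Q' x)) (Q (Q' y))" by (rule Q_sym)
    finally show ?thesis by (simp add: QQ')
  qed
  have U_scale: "U (c *\<^sub>C x) = c *\<^sub>C U x" for c x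
    by (simp add: U_def Q'_scale X_scale scaleC_scaleC mult.commute)
  have "cinner (U x) (U y) = cinner x y" for x y
    unfolding cinner_expand [of "U x"] cinner_expand [of x] by (simp add: U_scale [symmetric] U_inner)
  moreover have "U \<in> bdd_ops UNIV D"
    unfolding bdd_ops_iff
  proof
    show "U \<in> UNIV \<rightarrow>\<^sub>E D"
      using D XD by (auto simp: U_def csubspace_def)
    \<comment> \<open>The bound 1 is read off from the preserved inner product.\<close>
    show "bdd_linear_on UNIV U"
      by (rule bdd_linear_onI [of _ _ 1])
         (auto simp: U_scale norm_eq_sqrt_inner U_inner, simp add: U_def Q'_add X_add scaleC_add_right)
  qed
  moreover have "U ` UNIV = D"
  proof
    show "U ` UNIV \<subseteq> D" using D XD by (auto simp: U_def csubspace_def)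
    show "D \<subseteq> U ` UNIV"
    proof
      fix y assume y: "y \<in> D"
      have "U (Q (complex_of_real (sqrt \<tau>) *\<^sub>C Y y)) = y"
        using y by (simp add: U_def Q'Q X_scale XY scaleC_scaleC scaleC_one s(2) flip: of_real_mult)
      then show "y \<in> U ` UNIV" by (metis rangeI)
    qed
  qed
  ultimately show ?thesis
    unfolding unitarily_equivalent_def by blast
qed

section \<open>Matrices over the commutant\<close>

lemma sum_lessThan_add: "(\<Sum>j<n + K. f j) = (\<Sum>j<n. f j) + (\<Sum>j<K. f (n + j :: nat) :: 'c::comm_monoid_add)"
  by (induction K) (simp_all add: add.assoc)

context operator_tuple
begin

abbreviation "A' \<equiv> commutant m UNIV T"
abbreviation "midem \<equiv> matrix_idempotents A'"
abbreviation "unit_matrix \<equiv> scalar_matrix A' \<one>\<^bsub>A'\<^esub>"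
abbreviation "iclass \<equiv> idempotent_class A'"

lemma carrier_A': "X \<in> carrier A' \<longleftrightarrow> intertwiner m UNIV T UNIV T X"
  by (simp add: carrier_commutant [OF obj_T])

lemma A'_simps:
  "(X \<otimes>\<^bsub>A'\<^esub> Y) v = X (Y v)" "(X \<oplus>\<^bsub>A'\<^esub> Y) v = X v + Y v" "\<one>\<^bsub>A'\<^esub> v = v" "\<zero>\<^bsub>A'\<^esub> v = 0"
  by (simp_all add: commutant_simps)

lemma A'_apply_0: "X \<in> carrier A' \<Longrightarrow> X 0 = 0"
  unfolding carrier_A' by (rule intertwiner_0 [OF _ csubspace_UNIV])

lemma A'_apply_sum: "X \<in> carrier A' \<Longrightarrow> X (sum h I) = (\<Sum>i\<in>I. X (h i))"
  unfolding carrier_A' by (rule intertwiner_apply_sum [OF _ csubspace_UNIV]) auto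

definition op_of_matrix :: "nat \<Rightarrow> (nat \<Rightarrow> nat \<Rightarrow> 'a \<Rightarrow> 'a) \<Rightarrow> 'a fin_seq endo" where
  "op_of_matrix N a = Endo (\<lambda>x. \<Sum>i<N. single i (\<Sum>j<N. a i j (component x j)))"

text \<open>A member of \<open>M_inf\<close> carries no size. The least admissible one is a mere
  choice, and \<open>\<Phi>_eq\<close> shows that any other gives the same operator.\<close>

definition \<Phi> :: "(nat \<Rightarrow> nat \<Rightarrow> 'a \<Rightarrow> 'a) \<Rightarrow> 'a fin_seq endo" where
  "\<Phi> a = op_of_matrix (LEAST N. a \<in> matrices A' N) a"

text \<open>The matrix entries of an operator, inverse to \<open>\<Phi>\<close> between
  \<open>M_inf A'\<close> and \<open>M\<close>.\<close>

definition \<Psi> :: "'a fin_seq endo \<Rightarrow> nat \<Rightarrow> nat \<Rightarrow> 'a \<Rightarrow> 'a" where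
  "\<Psi> X = (\<lambda>i j v. component (app X (single j v)) i)"

lemma matricesD:
  assumes "a \<in> matrices A' N"
  shows "a i j \<in> carrier A'" "N \<le> i \<Longrightarrow> a i j v = 0" "N \<le> j \<Longrightarrow> a i j v = 0"
  using assms by (auto simp: matrices_def A'_simps)

lemma matrices_mono: "a \<in> matrices A' N \<Longrightarrow> N \<le> K \<Longrightarrow> a \<in> matrices A' K"
  by (auto simp: matrices_def)

lemma intertwiner_op_of_matrix:
  assumes "a \<in> matrices A' N"
  shows "intertwiner m UNIV T_inf UNIV T_inf (\<lambda>x. \<Sum>i<N. single i (\<Sum>j<N. a i j (component x j)))"
  using matricesD(1) [OF assms]
  by (intro intertwiner_sum obj_T_inf obj_T intertwiner_compose [OF _ intertwiner_single]
      intertwiner_compose [OF intertwiner_component]) (simp add: carrier_A')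

lemma app_op_of_matrix:
  assumes "a \<in> matrices A' N"
  shows "app (op_of_matrix N a) x = (\<Sum>i<N. single i (\<Sum>j<N. a i j (component x j)))"
  unfolding op_of_matrix_def
  by (subst app_Endo) (auto simp: intertwiner_add [OF intertwiner_op_of_matrix [OF assms]])

lemma component_op_of_matrix:
  assumes "a \<in> matrices A' N"
  shows "component (app (op_of_matrix N a) x) i = (\<Sum>j<N. a i j (component x j))"
  using component_lincomb_single [of "\<lambda>i. i" "{..<N}" i "\<lambda>i. \<Sum>j<N. a i j (component x j)"] matricesD(2) [OF assms]
  by (cases "i < N") (auto simp: app_op_of_matrix [OF assms])

lemma \<Phi>_eq:
  assumes "a \<in> matrices A' N"
  shows "\<Phi> a = op_of_matrix N a"
proof -
  define K where "K = (LEAST N. a \<in> matrices A' N)"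
  have K: "a \<in> matrices A' K" "K \<le> N"
    unfolding K_def using assms by (auto intro: LeastI Least_le)
  have "(\<Sum>j<K. a i j (component x j)) = (\<Sum>j<N. a i j (component x j))" for i x
    by (rule sum.mono_neutral_left) (use K matricesD(3) [OF K(1)] in auto)
  then show ?thesis
    unfolding \<Phi>_def K_def [symmetric]
    by (intro endo_eqI fin_seq_eqI) (simp add: component_op_of_matrix K(1) assms)
qed

lemma component_\<Phi>: "a \<in> matrices A' N \<Longrightarrow> component (app (\<Phi> a) x) i = (\<Sum>j<N. a i j (component x j))"
  by (simp add: \<Phi>_eq component_op_of_matrix)

lemma \<Phi>_in_M:
  assumes "a \<in> M_inf A'"
  shows "\<Phi> a \<in> M"
proof -
  from assms obtain N where N: "a \<in> matrices A' N" by (auto simp: M_inf_def)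
  show ?thesis
  proof (rule M_I)
    show "intertwiner m UNIV T_inf UNIV T_inf (app (\<Phi> a))"
      unfolding \<Phi>_eq [OF N] using intertwiner_op_of_matrix [OF N] by (simp add: app_op_of_matrix [OF N, abs_def])
    show "cut N * \<Phi> a = \<Phi> a" "\<Phi> a * cut N = \<Phi> a"
      by (intro endo_eqI fin_seq_eqI; simp add: shift_simps component_\<Phi> [OF N] matricesD(2) [OF N])+
  qed
qed

lemma \<Psi>_\<Phi>:
  assumes "a \<in> M_inf A'"
  shows "\<Psi> (\<Phi> a) = a"
proof (intro ext)
  fix i j v
  from assms obtain N where N: "a \<in> matrices A' N" by (auto simp: M_inf_def)
  note a = matricesD [OF N]
  have "(\<Sum>l<N. a i l (if l = j then v else 0)) = (\<Sum>l<N. if l = j then a i j v else 0)"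
    by (rule sum.cong) (auto simp: A'_apply_0 a(1))
  also have "\<dots> = a i j v" using a(3) [of j i v] by (simp add: not_less)
  finally show "\<Psi> (\<Phi> a) i j v = a i j v"
    by (simp add: \<Psi>_def component_\<Phi> [OF N] component_single)
qed

text \<open>As X absorbs \<open>cut N\<close> on the right, it is determined by its values on
  \<open>single j v\<close> with j < N. Absorption on either side makes the entries vanish outside
  of the N by N square.\<close>

lemma \<Psi>_in_M_inf:
  assumes "X \<in> M"
  shows "\<Psi> X \<in> M_inf A'" "\<Phi> (\<Psi> X) = X"
proof -
  from assms obtain N where N: "cut N * X = X" "X * cut N = X" by (auto simp: M_def)
  have carrier: "\<Psi> X i j \<in> carrier A'" for i j
    unfolding carrier_A' \<Psi>_def
    by (intro intertwiner_compose [OF _ intertwiner_component]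
        intertwiner_compose [OF intertwiner_single M_intertwiner [OF assms]])
  have cutX: "app (cut N) (app X x) = app X x" and Xcut: "app X (app (cut N) x) = app X x" for x
    using N times_endo.rep_eq by metis+
  have "\<Psi> X i j v = 0" if "N \<le> i" for i j v
    unfolding \<Psi>_def using that component_cut [of N "app X (single j v)" i] by (simp only: cutX) simp
  moreover have "\<Psi> X i j v = 0" if "N \<le> j" for i j v
  proof -
    have "app (cut N) (single j v) = 0"
      by (rule fin_seq_eqI) (use that in \<open>auto simp: shift_simps\<close>)
    then have "app X (single j v) = app X 0"
      using Xcut [of "single j v"] by simp
    then show ?thesis
      unfolding \<Psi>_def
      using intertwiner_0 [OF M_intertwiner [OF assms] csubspace_UNIV] by (simp add: component_simps)
  qed
  ultimately have mat: "\<Psi> X \<in> matrices A' N"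
    using carrier by (auto simp: matrices_def A'_simps fun_eq_iff)
  then show "\<Psi> X \<in> M_inf A'" by (auto simp: M_inf_def)
  show "\<Phi> (\<Psi> X) = X"
  proof (intro endo_eqI fin_seq_eqI)
    fix x i
    have "component (app (\<Phi> (\<Psi> X)) x) i = component (\<Sum>j<N. app X (single j (component x j))) i"
      unfolding component_\<Phi> [OF mat] component_sum by (simp add: \<Psi>_def)
    also have "(\<Sum>j<N. app X (single j (component x j))) = app X (\<Sum>j<N. single j (component x j))"
      by (rule intertwiner_apply_sum [OF M_intertwiner [OF assms] csubspace_UNIV, symmetric]) simp
    also have "(\<Sum>j<N. single j (component x j)) = app (cut N) x"
      by (simp add: cut_def app_shift_up)
    also have "app X (app (cut N) x) = app X x" by (rule Xcut)
    finally show "component (app (\<Phi> (\<Psi> X)) x) i = component (app X x) i" .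
  qed
qed

lemma \<Phi>_inj: "a \<in> M_inf A' \<Longrightarrow> b \<in> M_inf A' \<Longrightarrow> \<Phi> a = \<Phi> b \<Longrightarrow> a = b"
  by (metis \<Psi>_\<Phi>)

lemma M_inf_common:
  assumes "a \<in> M_inf A'" "b \<in> M_inf A'"
  obtains N where "a \<in> matrices A' N" "b \<in> matrices A' N"
proof -
  from assms obtain N K where "a \<in> matrices A' N" "b \<in> matrices A' K" by (auto simp: M_inf_def)
  then show thesis
    by (intro that [of "max N K"]) (auto intro: matrices_mono)
qed

text \<open>The defining sum runs over the nonzero entries of a row, a set that varies with the row;
  these indices all lie below N, so it becomes an ordinary sum over l < N.\<close>

lemma matrix_mult_A':
  assumes "a \<in> matrices A' N" "b \<in> matrices A' N"
  shows "matrix_mult A' a b \<in> matrices A' N" "matrix_mult A' a b i j v = (\<Sum>l<N. a i l (b l j v))"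
proof -
  note a = matricesD [OF assms(1)] and b = matricesD [OF assms(2)]
  have sub: "{l. a i l \<noteq> \<zero>\<^bsub>A'\<^esub>} \<subseteq> {..<N}" for i
    using assms(1) by (auto simp: matrices_def not_le [symmetric])
  then have fin: "finite {l. a i l \<noteq> \<zero>\<^bsub>A'\<^esub>}" for i by (rule finite_subset) simp
  have mem: "a i l \<otimes>\<^bsub>A'\<^esub> b l j \<in> carrier A'" for i l j
    by (intro commutant_closed(3) obj_T a b)
  have carrier: "matrix_mult A' a b i j \<in> carrier A'" for i j
    unfolding matrix_mult_def
    by (rule abelian_monoid.finsum_closed [OF abelian_group.axioms(1) [OF ring.is_abelian_group [OF ring_commutant [OF obj_T]]]])
       (use mem in auto)
  show eq: "matrix_mult A' a b i j v = (\<Sum>l<N. a i l (b l j v))" for i j v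
  proof -
    have "matrix_mult A' a b i j v = (\<Sum>l\<in>{l. a i l \<noteq> \<zero>\<^bsub>A'\<^esub>}. a i l (b l j v))"
      unfolding matrix_mult_def by (subst finsum_commutant [OF obj_T fin mem]) (simp add: A'_simps)
    also have "\<dots> = (\<Sum>l<N. a i l (b l j v))"
      by (rule sum.mono_neutral_left) (use sub in \<open>auto simp: A'_simps\<close>)
    finally show ?thesis .
  qed
  have "matrix_mult A' a b i j = \<zero>\<^bsub>A'\<^esub>" if "N \<le> i \<or> N \<le> j" for i j
    using that a b by (auto simp: fun_eq_iff eq A'_simps A'_apply_0)
  with carrier show "matrix_mult A' a b \<in> matrices A' N"
    by (auto simp: matrices_def)
qed

lemma matrix_mult_in_M_inf:
  assumes "a \<in> M_inf A'" "b \<in> M_inf A'"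
  shows "matrix_mult A' a b \<in> M_inf A'"
proof -
  from M_inf_common [OF assms] obtain N where "a \<in> matrices A' N" "b \<in> matrices A' N" .
  from matrix_mult_A'(1) [OF this] show ?thesis by (auto simp: M_inf_def)
qed

lemma \<Phi>_mult:
  assumes "a \<in> M_inf A'" "b \<in> M_inf A'"
  shows "\<Phi> (matrix_mult A' a b) = \<Phi> a * \<Phi> b"
proof -
  from M_inf_common [OF assms] obtain N where N: "a \<in> matrices A' N" "b \<in> matrices A' N" .
  show ?thesis
  proof (intro endo_eqI fin_seq_eqI)
    fix x i
    have "component (app (\<Phi> (matrix_mult A' a b)) x) i = (\<Sum>j<N. \<Sum>l<N. a i l (b l j (component x j)))"
      by (simp add: component_\<Phi> [OF matrix_mult_A'(1) [OF N]] matrix_mult_A'(2) [OF N])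
    also have "\<dots> = (\<Sum>l<N. a i l (\<Sum>j<N. b l j (component x j)))"
      by (subst sum.swap) (simp add: A'_apply_sum matricesD(1) [OF N(1)])
    finally show "component (app (\<Phi> (matrix_mult A' a b)) x) i = component (app (\<Phi> a * \<Phi> b) x) i"
      by (simp add: times_endo.rep_eq component_\<Phi> [OF N(1)] component_\<Phi> [OF N(2)])
  qed
qed

lemma matrix_idempotents_iff: "p \<in> midem \<longleftrightarrow> p \<in> M_inf A' \<and> idem (\<Phi> p)"
proof -
  have "matrix_mult A' p p = p \<longleftrightarrow> \<Phi> p * \<Phi> p = \<Phi> p" if "p \<in> M_inf A'"
    using \<Phi>_mult [OF that that] \<Phi>_inj [OF matrix_mult_in_M_inf [OF that that] that] by auto
  then show ?thesis by (auto simp: matrix_idempotents_def idem_def \<Phi>_in_M)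
qed

text \<open>Since \<open>\<Phi>\<close> is a multiplicative bijection of \<open>M_inf A'\<close>
  onto \<open>M\<close>, the witnesses of equivalence carry over in both directions.\<close>

lemma alg_equiv_iff:
  "(p, q) \<in> alg_equiv A' \<longleftrightarrow> p \<in> midem \<and> q \<in> midem \<and> eqv (\<Phi> p) (\<Phi> q)"
proof
  assume "(p, q) \<in> alg_equiv A'"
  then obtain x y where *: "p \<in> midem" "q \<in> midem" "x \<in> M_inf A'" "y \<in> M_inf A'"
    "p = matrix_mult A' x y" "q = matrix_mult A' y x"
    unfolding alg_equiv_def mem_Collect_eq prod.case by blast
  have "\<Phi> x * \<Phi> y = \<Phi> p" "\<Phi> y * \<Phi> x = \<Phi> q"
    unfolding *(5,6) by (simp_all only: \<Phi>_mult *(3,4))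
  moreover have "idem (\<Phi> p)" "idem (\<Phi> q)"
    using *(1,2) by (simp_all only: matrix_idempotents_iff)
  ultimately have "eqv (\<Phi> p) (\<Phi> q)"
    using eqvI \<Phi>_in_M *(3,4) by blast
  with * show "p \<in> midem \<and> q \<in> midem \<and> eqv (\<Phi> p) (\<Phi> q)" by blast
next
  assume *: "p \<in> midem \<and> q \<in> midem \<and> eqv (\<Phi> p) (\<Phi> q)"
  then obtain x y where xy: "x \<in> M" "y \<in> M" "x * y = \<Phi> p" "y * x = \<Phi> q"
    unfolding eqv_def by blast
  note \<Psi> = \<Psi>_in_M_inf [OF xy(1)] \<Psi>_in_M_inf [OF xy(2)]
  have pq: "p \<in> M_inf A'" "q \<in> M_inf A'"
    using * by (simp_all only: matrix_idempotents_iff)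
  have "p = matrix_mult A' (\<Psi> x) (\<Psi> y)"
    by (rule \<Phi>_inj [OF pq(1) matrix_mult_in_M_inf [OF \<Psi>(1,3)]]) (simp only: \<Phi>_mult [OF \<Psi>(1,3)] \<Psi>(2,4) xy)
  moreover have "q = matrix_mult A' (\<Psi> y) (\<Psi> x)"
    by (rule \<Phi>_inj [OF pq(2) matrix_mult_in_M_inf [OF \<Psi>(3,1)]]) (simp only: \<Phi>_mult [OF \<Psi>(3,1)] \<Psi>(2,4) xy)
  ultimately show "(p, q) \<in> alg_equiv A'"
    unfolding alg_equiv_def mem_Collect_eq prod.case using * \<Psi>(1,3) by blast
qed

lemma equiv_alg_equiv: "equiv (midem) (alg_equiv A')"
proof (rule equivI)
  show "alg_equiv A' \<subseteq> midem \<times> midem"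
    by (rule subrelI) (simp add: alg_equiv_iff)
  show "refl_on (midem) (alg_equiv A')"
    unfolding refl_on_def by (simp add: alg_equiv_iff eqv_refl matrix_idempotents_iff)
  show "sym (alg_equiv A')"
    unfolding sym_def alg_equiv_iff using eqv_sym by blast
  show "trans (alg_equiv A')"
    unfolding trans_def alg_equiv_iff using eqv_trans by blast
qed

lemma idempotent_class_eq_iff:
  assumes "p \<in> midem" "q \<in> midem"
  shows "iclass p = iclass q \<longleftrightarrow> eqv (\<Phi> p) (\<Phi> q)"
  unfolding idempotent_class_def eq_equiv_class_iff [OF equiv_alg_equiv assms] alg_equiv_iff
  using assms by blast

section \<open>Addition of classes\<close>

lemma block_diag_A':
  assumes p: "p \<in> matrices A' n" and q: "q \<in> matrices A' K"
  shows "block_diag A' n p q \<in> matrices A' (n + K)"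
    and "\<Phi> (block_diag A' n p q) = \<Phi> p + shift_up n K * \<Phi> q * shift_down n K"
proof -
  show mat: "block_diag A' n p q \<in> matrices A' (n + K)"
    using p q commutant_closed(2) [OF obj_T] by (auto simp: matrices_def block_diag_def)
  show "\<Phi> (block_diag A' n p q) = \<Phi> p + shift_up n K * \<Phi> q * shift_down n K"
  proof (intro endo_eqI fin_seq_eqI)
    fix x i
    have "component (app (\<Phi> (block_diag A' n p q)) x) i =
      (\<Sum>j<n. block_diag A' n p q i j (component x j)) + (\<Sum>j<K. block_diag A' n p q i (n + j) (component x (n + j)))"
      by (simp add: component_\<Phi> [OF mat] sum_lessThan_add)
    also have "\<dots> = component (app (\<Phi> p + shift_up n K * \<Phi> q * shift_down n K) x) i"
      by (auto simp: shift_simps component_\<Phi> [OF p] component_\<Phi> [OF q] block_diag_def A'_simps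
          matricesD(2) [OF p] matricesD(2) [OF q] not_less add.commute intro!: sum.cong)
    finally show "component (app (\<Phi> (block_diag A' n p q)) x) i =
      component (app (\<Phi> p + shift_up n K * \<Phi> q * shift_down n K) x) i" .
  qed
qed

text \<open>The second block is an equivalent copy of \<open>\<Phi> q\<close> moved out of the way
  of \<open>\<Phi> p\<close>, whatever admissible size n is taken for p. Block sums thereby become
  orthogonal sums.\<close>

lemma \<Phi>_block_diag:
  assumes p: "p \<in> midem" "p \<in> matrices A' n" and q: "q \<in> midem"
  obtains q' where "\<Phi> (block_diag A' n p q) = \<Phi> p + q'" "eqv (\<Phi> q) q'" "orth (\<Phi> p) q'"
    "block_diag A' n p q \<in> midem"
proof -
  from q obtain K where K: "q \<in> matrices A' K" by (auto simp: matrix_idempotents_def M_inf_def)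
  define q' where "q' = shift_up n K * \<Phi> q * shift_down n K"
  have "cut n * \<Phi> p = \<Phi> p" "\<Phi> p * cut n = \<Phi> p"
    by (intro endo_eqI fin_seq_eqI; simp add: shift_simps component_\<Phi> [OF p(2)] matricesD(2) [OF p(2)])+
  then have orth: "orth (\<Phi> p) q'" unfolding q'_def by (rule orth_shift)
  have "cut K * \<Phi> q = \<Phi> q" "\<Phi> q * cut K = \<Phi> q"
    by (intro endo_eqI fin_seq_eqI; simp add: shift_simps component_\<Phi> [OF K] matricesD(2) [OF K])+
  with q have eqv: "eqv (\<Phi> q) q'"
    unfolding q'_def by (intro eqv_shift) (auto simp: matrix_idempotents_iff)
  have sum: "\<Phi> (block_diag A' n p q) = \<Phi> p + q'"
    unfolding q'_def by (rule block_diag_A'(2) [OF p(2) K])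
  have "idem (\<Phi> p + q')"
    using p eqv orth by (intro idem_add) (auto simp: matrix_idempotents_iff eqv_def)
  then have "block_diag A' n p q \<in> midem"
    using block_diag_A'(1) [OF p(2) K] by (auto simp: matrix_idempotents_iff sum M_inf_def)
  with sum eqv orth show thesis by (rule that)
qed

text \<open>By \<open>eqv_add\<close>, all classes in the union that defines the product coincide,
  so the union equals any one of them.\<close>

lemma mult_idempotent_semigroup:
  assumes p: "p \<in> midem" "p \<in> matrices A' n" and q: "q \<in> midem"
  shows "iclass p \<otimes>\<^bsub>idempotent_semigroup A'\<^esub> iclass q =
    iclass (block_diag A' n p q)"
proof -
  have eq: "iclass (block_diag A' n' p' q') = iclass (block_diag A' n p q)"
    if p': "p' \<in> iclass p" and q': "q' \<in> iclass q" and n': "p' \<in> matrices A' n'" for p' q' n'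
  proof -
    have 1: "p' \<in> midem" "q' \<in> midem" "eqv (\<Phi> p) (\<Phi> p')" "eqv (\<Phi> q) (\<Phi> q')"
      using p' q' by (auto simp: idempotent_class_def alg_equiv_iff)
    obtain r where r: "\<Phi> (block_diag A' n p q) = \<Phi> p + r" "eqv (\<Phi> q) r" "orth (\<Phi> p) r"
      "block_diag A' n p q \<in> midem" by (rule \<Phi>_block_diag [OF p q])
    obtain r' where r': "\<Phi> (block_diag A' n' p' q') = \<Phi> p' + r'" "eqv (\<Phi> q') r'" "orth (\<Phi> p') r'"
      "block_diag A' n' p' q' \<in> midem" by (rule \<Phi>_block_diag [OF 1(1) n' 1(2)])
    have "eqv (\<Phi> p + r) (\<Phi> p' + r')"
      by (rule eqv_add [OF 1(3) eqv_trans [OF eqv_sym [OF r(2)] eqv_trans [OF 1(4) r'(2)]] r(3) r'(3)])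
    from eqv_sym [OF this] show ?thesis
      by (simp add: idempotent_class_eq_iff r r')
  qed
  have pm: "p \<in> iclass p" and qm: "q \<in> iclass q"
    using p q equiv_class_self [OF equiv_alg_equiv] by (auto simp: idempotent_class_def)
  have "iclass p \<otimes>\<^bsub>idempotent_semigroup A'\<^esub> iclass q =
    (\<Union>p'\<in>iclass p. \<Union>q'\<in>iclass q. \<Union>n'\<in>{n'. p' \<in> matrices A' n'}.
        iclass (block_diag A' n' p' q'))"
    by (simp add: idempotent_semigroup_def)
  also have "\<dots> = iclass (block_diag A' n p q)"
    using eq pm qm p(2) by blast
  finally show ?thesis .
qed

text \<open>The class [I] of the theorem thus belongs to \<open>cut 1\<close>, the idempotent that
  stands for T itself.\<close>

lemma \<Phi>_scalar_one: "\<Phi> (unit_matrix) = cut 1"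
  and scalar_one: "unit_matrix \<in> midem"
proof -
  have mat: "unit_matrix \<in> matrices A' 1"
    using commutant_closed(1,2) [OF obj_T] by (auto simp: matrices_def scalar_matrix_def)
  have "component (app (\<Phi> (unit_matrix)) x) i = unit_matrix i 0 (component x 0)" for x i
    unfolding component_\<Phi> [OF mat] by simp
  then show 1: "\<Phi> (unit_matrix) = cut 1"
    by (intro endo_eqI fin_seq_eqI) (simp add: component_cut, simp add: scalar_matrix_def A'_simps)
  show "unit_matrix \<in> midem"
    unfolding matrix_idempotents_iff 1 M_inf_def using mat E_idem [of 1] by blast
qed

lemma carrier_idempotent_semigroup:
  "carrier (idempotent_semigroup A') = iclass ` midem"
  unfolding idempotent_semigroup_def quotient_def idempotent_class_def partial_object.simps by blast

text \<open>An isomorphism h gives H by evaluating h on the class of \<open>\<Psi> P\<close>;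
  conversely, H evaluated at \<open>\<Phi>\<close> of a representative gives h.\<close>

lemma iso_iff_dimension_map:
  "(\<exists>h \<in> iso (idempotent_semigroup A') (product_group {..<k} (\<lambda>_. nat_add_monoid)).
      h (iclass (unit_matrix)) = (\<lambda>i\<in>{..<k}. n i)) \<longleftrightarrow>
   (\<exists>H. dimension_map k H \<and> H (cut 1) = (\<lambda>i\<in>{..<k}. n i))"
proof
  let ?S = "idempotent_semigroup A'" and ?N = "product_group {..<k} (\<lambda>_. nat_add_monoid)"
  note cl_eq = idempotent_class_eq_iff
  have carrier_N: "carrier ?N = {..<k} \<rightarrow>\<^sub>E UNIV" by (simp add: nat_add_monoid_def)
  have mult_N: "x \<otimes>\<^bsub>?N\<^esub> y = (\<lambda>i\<in>{..<k}. x i + y i)" for x y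
    by (simp add: product_group_def nat_add_monoid_def)
  {
    assume "\<exists>h \<in> iso ?S ?N. h (iclass (unit_matrix)) = (\<lambda>i\<in>{..<k}. n i)"
    then obtain h where iso: "h \<in> iso ?S ?N"
      and h1: "h (iclass (unit_matrix)) = (\<lambda>i\<in>{..<k}. n i)" by blast
    then have "h \<in> hom ?S ?N" "bij_betw h (carrier ?S) (carrier ?N)" by (simp_all add: iso_def)
    note h = hom_in_carrier [OF this(1)] hom_mult [OF this(1)]
      bij_betw_imp_inj_on [OF this(2)] bij_betw_imp_surj_on [OF this(2)]
    define H where "H P = h (iclass (\<Psi> P))" for P
    have \<Psi>: "\<Psi> P \<in> midem" "\<Phi> (\<Psi> P) = P" if "idem P" for P
    proof -
      note * = \<Psi>_in_M_inf [OF idemD(1) [OF that]]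
      show "\<Psi> P \<in> midem" unfolding matrix_idempotents_iff *(2) using *(1) that by blast
      show "\<Phi> (\<Psi> P) = P" by (rule *(2))
    qed
    have cl: "iclass (\<Psi> P) \<in> carrier ?S" if "idem P" for P
      unfolding carrier_idempotent_semigroup using \<Psi>(1) [OF that] by (rule imageI)
    have "dimension_map k H"
      unfolding dimension_map_def
    proof (intro conjI allI impI ballI)
      show "H P \<in> {..<k} \<rightarrow>\<^sub>E UNIV" if "idem P" for P
        using h(1) [OF cl [OF that]] by (simp only: H_def carrier_N)
      show "H P = H Q \<longleftrightarrow> eqv P Q" if "idem P" "idem Q" for P Q
        using inj_on_eq_iff [OF h(3) cl [OF that(1)] cl [OF that(2)]]
        by (simp add: H_def cl_eq \<Psi> that)
      show "H (P + Q) = (\<lambda>i\<in>{..<k}. H P i + H Q i)" if ids: "idem P" "idem Q" "orth P Q" for P Q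
      proof -
        from \<Psi>(1) [OF ids(1)] obtain N where N: "\<Psi> P \<in> matrices A' N"
          by (auto simp: matrix_idempotents_def M_inf_def)
        obtain q where q: "\<Phi> (block_diag A' N (\<Psi> P) (\<Psi> Q)) = \<Phi> (\<Psi> P) + q" "eqv (\<Phi> (\<Psi> Q)) q" "orth (\<Phi> (\<Psi> P)) q"
          "block_diag A' N (\<Psi> P) (\<Psi> Q) \<in> midem"
          by (rule \<Phi>_block_diag [OF \<Psi>(1) [OF ids(1)] N \<Psi>(1) [OF ids(2)]])
        have PQ: "idem (P + Q)" by (rule idem_add [OF ids])
        \<comment> \<open>Q and its shifted copy q are equivalent and both orthogonal to P, so the
          orthogonal sum has the class of the block sum.\<close>
        have "eqv (P + Q) (P + q)"
          using q ids by (intro eqv_add eqv_refl) (simp_all add: \<Psi>)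
        then have "iclass (\<Psi> (P + Q)) = iclass (block_diag A' N (\<Psi> P) (\<Psi> Q))"
          by (simp add: cl_eq \<Psi> PQ q ids)
        also have "\<dots> = iclass (\<Psi> P) \<otimes>\<^bsub>?S\<^esub> iclass (\<Psi> Q)"
          by (rule mult_idempotent_semigroup [OF \<Psi>(1) [OF ids(1)] N \<Psi>(1) [OF ids(2)], symmetric])
        finally show ?thesis
          using h(2) [OF cl [OF ids(1)] cl [OF ids(2)]] by (simp only: H_def mult_N)
      qed
      show "\<exists>P. idem P \<and> H P = d" if "d \<in> {..<k} \<rightarrow>\<^sub>E UNIV" for d
      proof -
        from that h(4) obtain p where p: "p \<in> midem" "d = h (iclass p)"
          unfolding carrier_N carrier_idempotent_semigroup by blast
        then have "idem (\<Phi> p)" "\<Psi> (\<Phi> p) = p"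
          by (simp_all add: matrix_idempotents_iff \<Psi>_\<Phi>)
        with p show ?thesis unfolding H_def by metis
      qed
    qed
    moreover have "H (cut 1) = (\<lambda>i\<in>{..<k}. n i)"
    proof -
      have "\<Psi> (\<Phi> (unit_matrix)) = unit_matrix"
        using scalar_one by (intro \<Psi>_\<Phi>) (simp only: matrix_idempotents_iff)
      then show ?thesis
        unfolding H_def \<Phi>_scalar_one [symmetric] by (simp only: h1)
    qed
    ultimately show "\<exists>H. dimension_map k H \<and> H (cut 1) = (\<lambda>i\<in>{..<k}. n i)" by blast
  next
    assume "\<exists>H. dimension_map k H \<and> H (cut 1) = (\<lambda>i\<in>{..<k}. n i)"
    then obtain H where H: "dimension_map k H" and H1: "H (cut 1) = (\<lambda>i\<in>{..<k}. n i)" by blast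
    have H_range: "\<And>p. idem p \<Longrightarrow> H p \<in> {..<k} \<rightarrow>\<^sub>E UNIV"
      and H_eq: "\<And>p q. idem p \<Longrightarrow> idem q \<Longrightarrow> H p = H q \<longleftrightarrow> eqv p q"
      and H_add: "\<And>p q. idem p \<Longrightarrow> idem q \<Longrightarrow> orth p q \<Longrightarrow> H (p + q) = (\<lambda>i\<in>{..<k}. H p i + H q i)"
      and H_surj: "\<And>d. d \<in> {..<k} \<rightarrow>\<^sub>E UNIV \<Longrightarrow> \<exists>p. idem p \<and> H p = d"
      using H by (auto simp: dimension_map_def)
    \<comment> \<open>Any representative will do, because H is constant on equivalence
      classes.\<close>
    define h where "h C = H (\<Phi> (SOME p. p \<in> C))" for C
    have h: "h (iclass p) = H (\<Phi> p)" if p: "p \<in> midem" for p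
    proof -
      have "p \<in> iclass p"
        using p equiv_class_self [OF equiv_alg_equiv] by (simp add: idempotent_class_def)
      then have "(SOME q. q \<in> iclass p) \<in> iclass p"
        by (rule someI [of "\<lambda>q. q \<in> iclass p"])
      moreover have "eqv (\<Phi> p) (\<Phi> q)" if "q \<in> iclass p" for q
        using that by (simp add: idempotent_class_def alg_equiv_iff)
      ultimately have "eqv (\<Phi> p) (\<Phi> (SOME q. q \<in> iclass p))" by blast
      then show ?thesis
        unfolding h_def using H_eq by (metis eqv_def)
    qed
    have h_range: "h C \<in> carrier ?N" if "C \<in> carrier ?S" for C
    proof -
      from that obtain p where p: "p \<in> midem" "C = iclass p"
        unfolding carrier_idempotent_semigroup by blast
      then have "idem (\<Phi> p)" by (simp add: matrix_idempotents_iff)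
      from H_range [OF this] show ?thesis
        unfolding p(2) h [OF p(1)] carrier_N .
    qed
    have "h \<in> iso ?S ?N"
      unfolding iso_def hom_def bij_betw_def
    proof (intro CollectI conjI ballI Pi_I)
      show "h C \<in> carrier ?N" if "C \<in> carrier ?S" for C
        using that by (rule h_range)
      show "inj_on h (carrier ?S)"
      proof (rule inj_onI)
        fix C D assume "C \<in> carrier ?S" "D \<in> carrier ?S" and eq: "h C = h D"
        then obtain p q where pq: "p \<in> midem" "q \<in> midem"
          "C = iclass p" "D = iclass q" by (auto simp: carrier_idempotent_semigroup)
        with eq H_eq [of "\<Phi> p" "\<Phi> q"] show "C = D"
          by (simp add: h cl_eq matrix_idempotents_iff)
      qed
      show "h (C \<otimes>\<^bsub>?S\<^esub> D) = h C \<otimes>\<^bsub>?N\<^esub> h D" if CD: "C \<in> carrier ?S" "D \<in> carrier ?S" for C D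
      proof -
        from CD obtain p q where pq: "p \<in> midem" "q \<in> midem"
          "C = iclass p" "D = iclass q" by (auto simp: carrier_idempotent_semigroup)
        from pq(1) obtain N where N: "p \<in> matrices A' N" by (auto simp: matrix_idempotents_def M_inf_def)
        obtain r where r: "\<Phi> (block_diag A' N p q) = \<Phi> p + r" "eqv (\<Phi> q) r" "orth (\<Phi> p) r"
          "block_diag A' N p q \<in> midem" by (rule \<Phi>_block_diag [OF pq(1) N pq(2)])
        have i: "idem (\<Phi> p)" "idem (\<Phi> q)" "idem r"
          using pq r by (auto simp: matrix_idempotents_iff eqv_def)
        have "H r = H (\<Phi> q)" using H_eq [OF i(2,3)] r(2) by simp
        then show ?thesis
          unfolding pq(3,4) mult_idempotent_semigroup [OF pq(1) N pq(2)] mult_N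
          by (simp add: h pq r H_add [OF i(1,3) r(3)])
      qed
      show "h ` carrier ?S = carrier ?N"
      proof
        show "h ` carrier ?S \<subseteq> carrier ?N"
          using h_range by blast
        show "carrier ?N \<subseteq> h ` carrier ?S"
        proof
          fix d assume "d \<in> carrier ?N"
          then obtain P where P: "idem P" "H P = d" using H_surj unfolding carrier_N by blast
          note * = \<Psi>_in_M_inf [OF idemD(1) [OF P(1)]]
          have "\<Psi> P \<in> midem" unfolding matrix_idempotents_iff *(2) using *(1) P(1) by blast
          with *(2) P(2) show "d \<in> h ` carrier ?S"
            unfolding carrier_idempotent_semigroup by (metis h image_eqI)
        qed
      qed
    qed
    moreover have "h (iclass (unit_matrix)) = (\<lambda>i\<in>{..<k}. n i)"
      unfolding h [OF scalar_one] \<Phi>_scalar_one by (rule H1)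
    ultimately show "\<exists>h \<in> iso ?S ?N. h (iclass (unit_matrix)) = (\<lambda>i\<in>{..<k}. n i)" by blast
  }
qed

end

section \<open>Direct sum decompositions\<close>

lemma single_sum: "single i (sum f I) = (\<Sum>j\<in>I. single i (f j))"
  by (rule bdd_linear_on_apply_sum [OF bdd_linear_on_single csubspace_UNIV]) simp

abbreviation multi_sum :: "nat \<Rightarrow> (nat \<Rightarrow> nat) \<Rightarrow> (nat \<Rightarrow> 'b::complex_inner set) \<Rightarrow> 'b fin_seq fin_seq set" where
  "multi_sum k n H \<equiv> direct_sum k (\<lambda>i. copies (n i) (H i))"

abbreviation multi_tuple :: "nat \<Rightarrow> (nat \<Rightarrow> nat) \<Rightarrow> (nat \<Rightarrow> 'b::complex_inner set) \<Rightarrow> (nat \<Rightarrow> nat \<Rightarrow> 'b \<Rightarrow> 'b)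
    \<Rightarrow> nat \<Rightarrow> 'b fin_seq fin_seq \<Rightarrow> 'b fin_seq fin_seq" where
  "multi_tuple k n H A \<equiv> direct_sum_tuple k (\<lambda>i. copies (n i) (H i)) (\<lambda>i. copies_tuple (n i) (H i) (A i))"

lemma component_direct_sum_tuple:
  assumes "x \<in> direct_sum k V"
  shows "component (direct_sum_tuple k V A j x) i = (if i < k then A i j (component x i) else 0)"
  using assms component_Abs [of k "\<lambda>i. if i < k then A i j (component x i) else 0"]
  by (simp add: direct_sum_tuple_def direct_sum_op_def)

lemma direct_sum_iff: "x \<in> direct_sum k V \<longleftrightarrow> (\<forall>i<k. component x i \<in> V i) \<and> (\<forall>i\<ge>k. component x i = 0)"
  by (simp add: direct_sum_def)

lemma csubspace_direct_sum: "(\<And>i. i < k \<Longrightarrow> csubspace (V i)) \<Longrightarrow> csubspace (direct_sum k V)"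
  by (auto simp: csubspace_def direct_sum_iff component_simps scaleC_zero_right)

lemma obj_direct_sum:
  assumes "\<And>i. i < k \<Longrightarrow> obj m (V i) (A i)"
  shows "obj m (direct_sum k V) (direct_sum_tuple k V A)"
proof -
  have cs: "csubspace (direct_sum k V)"
    by (rule csubspace_direct_sum) (rule obj_csubspace [OF assms])
  moreover have "direct_sum_tuple k V A j x \<in> direct_sum k V" if "j < m" "x \<in> direct_sum k V" for j x
    unfolding direct_sum_iff component_direct_sum_tuple [OF that(2)]
    using that obj_apply [OF assms that(1)] by (auto simp: direct_sum_iff)
  moreover have "direct_sum_tuple k V A j (x + y) = direct_sum_tuple k V A j x + direct_sum_tuple k V A j y"
    if "j < m" and x: "x \<in> direct_sum k V" and y: "y \<in> direct_sum k V" for j x y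
  proof (rule fin_seq_eqI)
    have "x + y \<in> direct_sum k V" using cs x y by (simp add: csubspace_def)
    then show "component (direct_sum_tuple k V A j (x + y)) i =
      component (direct_sum_tuple k V A j x + direct_sum_tuple k V A j y) i" for i
      using x y obj_apply_add [OF assms that(1)]
      by (simp add: component_direct_sum_tuple component_simps direct_sum_iff)
  qed
  ultimately show ?thesis by (simp add: obj_def)
qed

context operator_tuple
begin

lemma rep_T: "rep (\<lambda>x. component x 0) (single 0) UNIV T (cut 1)"
  unfolding rep_def
  by (auto simp: obj_T intertwiner_component intertwiner_single cut_in_M component_simps component_cut intro!: fin_seq_eqI)

text \<open>Finitely supported sequences contain \<open>copies N UNIV\<close> as a subspace, so
  truncation and inclusion present it.\<close>

lemma rep_copies: "rep (app (cut N)) (\<lambda>x. x) (copies N UNIV) (copies_tuple N UNIV T) (cut N)"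
proof -
  have eq: "copies_tuple N UNIV T j x = T_inf j x" if "j < m" "x \<in> copies N UNIV" for j x
    by (rule fin_seq_eqI) (use that in \<open>auto simp: component_direct_sum_tuple component_T_inf direct_sum_iff T_0\<close>)
  have mem: "app (cut N) x \<in> copies N UNIV" for x
    by (simp add: direct_sum_iff component_cut)
  have "intertwiner m UNIV T_inf UNIV T_inf (app (cut N))"
    by (rule M_intertwiner [OF cut_in_M])
  with eq mem have "intertwiner m UNIV T_inf (copies N UNIV) (copies_tuple N UNIV T) (app (cut N))"
    by (simp add: intertwiner_def)
  moreover have "intertwiner m (copies N UNIV) (copies_tuple N UNIV T) UNIV T_inf (\<lambda>x. x)"
    using eq by (simp add: intertwiner_def bdd_linear_on_id)
  moreover have "app (cut N) x = x" if "x \<in> copies N UNIV" for x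
    by (rule fin_seq_eqI) (use that in \<open>auto simp: component_cut direct_sum_iff\<close>)
  ultimately show ?thesis
    unfolding rep_def by (auto intro: obj_direct_sum obj_T cut_in_M)
qed

text \<open>By \<open>E_cover\<close> every idempotent lies below some \<open>cut N\<close> with N
  \<ge> 1, so the existence clauses for all N together cover every idempotent of
  \<open>M\<close>.\<close>

lemma unique_pdec_iff:
  "(\<forall>N\<ge>1. has_unique_finite_SI_decomposition m (copies N UNIV) (copies_tuple N UNIV T)) \<longleftrightarrow> unique_pdec"
  unfolding has_unique_finite_SI_decomposition_iff [OF rep_copies] unique_pdec_def
  using E_cover by (meson order_refl)

lemma rep_Endo:
  assumes "obj m V S" and f: "intertwiner m UNIV T_inf V S f" and g: "intertwiner m V S UNIV T_inf g"
    and "\<And>v. v \<in> V \<Longrightarrow> f (g v) = v" and fc: "\<And>x. f (app (cut N) x) = f x" and cg: "\<And>v. v \<in> V \<Longrightarrow> app (cut N) (g v) = g v"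
  shows "rep f g V S (Endo (\<lambda>x. g (f x)))" "app (Endo (\<lambda>x. g (f x))) x = g (f x)"
proof -
  note gf = intertwiner_compose [OF f g]
  show app: "app (Endo (\<lambda>x. g (f x))) x = g (f x)" for x
    by (subst app_Endo) (auto simp: intertwiner_add [OF gf])
  have "Endo (\<lambda>x. g (f x)) \<in> M"
  proof (rule M_I)
    show "intertwiner m UNIV T_inf UNIV T_inf (app (Endo (\<lambda>x. g (f x))))"
      using gf by (simp add: app [abs_def])
    show "cut N * Endo (\<lambda>x. g (f x)) = Endo (\<lambda>x. g (f x))" "Endo (\<lambda>x. g (f x)) * cut N = Endo (\<lambda>x. g (f x))"
      by (intro endo_eqI; simp add: times_endo.rep_eq app fc cg intertwiner_mem [OF f])+
  qed
  with assms show "rep f g V S (Endo (\<lambda>x. g (f x)))"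
    by (simp add: rep_def app)
qed

text \<open>Inserting g f = p and g' f' = q brings the product p q into the middle.\<close>

lemma rep_orth:
  assumes p: "rep f g V S p" and q: "rep f' g' W Q q" and "orth p q" "w \<in> W"
  shows "f (g' w) = 0"
proof -
  have "f (g' w) = f (g (f (g' (f' (g' w)))))"
    using assms(4) by (simp add: rep_fg [OF q] rep_fg [OF p] rep_f_mem [OF p])
  also have "\<dots> = f (app (p * q) (g' w))"
    by (simp add: rep_gf [OF p] rep_gf [OF q] times_endo.rep_eq)
  also have "\<dots> = 0"
    using assms(3) intertwiner_0 [OF rep_f [OF p] csubspace_UNIV] by (simp add: orth_def zero_endo.rep_eq)
  finally show ?thesis .
qed

text \<open>For each copy (i, l) of \<open>H i\<close>, its coordinate map and its inclusion,
  carried to T by X and Y, present \<open>A i\<close> at an idempotent. These idempotents form the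
  decomposition, with type i.\<close>

lemma unit_pdec_of_similarity:
  fixes H :: "nat \<Rightarrow> 'a set" and A :: "nat \<Rightarrow> nat \<Rightarrow> 'a \<Rightarrow> 'a" and k :: nat and n :: "nat \<Rightarrow> nat" and D S
  defines "D \<equiv> multi_sum k n H"
    and "S \<equiv> multi_tuple k n H A"
  assumes H: "\<And>i. i < k \<Longrightarrow> csubspace (H i)"
    and A: "\<And>i j. i < k \<Longrightarrow> j < m \<Longrightarrow> A i j \<in> bdd_ops (H i) (H i)"
    and SI: "\<And>i. i < k \<Longrightarrow> strongly_irreducible m (H i) (A i)"
    and not_similar: "\<And>i j. i < k \<Longrightarrow> j < k \<Longrightarrow> i \<noteq> j \<Longrightarrow> \<not> similar m (H i) (A i) (H j) (A j)"
    and similar: "similar m UNIV T D S"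
  shows "\<exists>B t. unit_pdec k n B t"
proof -
  have obj_H: "obj m (H i) (A i)" if "i < k" for i
    using H [OF that] A [OF that] unfolding obj_def bdd_ops_iff bdd_linear_on_def by blast
  have obj_D: "obj m D S"
    unfolding D_def S_def by (intro obj_direct_sum obj_H)
  from similar obtain X Y where X: "X \<in> bdd_ops UNIV D" and Y: "Y \<in> bdd_ops D UNIV"
    and YX: "\<And>x. Y (X x) = x" and XY: "\<And>y. y \<in> D \<Longrightarrow> X (Y y) = y"
    and XT: "\<And>j x. j < m \<Longrightarrow> X (T j x) = S j (X x)"
    unfolding similar_def by blast
  have iX: "intertwiner m UNIV T D S X"
    using X XT by (auto simp: intertwiner_def bdd_ops_iff)
  have iY: "intertwiner m D S UNIV T Y"
  proof (rule intertwinerI)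
    show "bdd_linear_on D Y" using Y by (simp add: bdd_ops_iff)
    fix j y assume "j < m" "y \<in> D"
    then have "X (T j (Y y)) = S j y" by (simp add: XT XY)
    then show "Y (S j y) = T j (Y y)" using YX [of "T j (Y y)"] by simp
  qed simp
  define I where "I = Sigma {..<k} (\<lambda>i. {..<n i})"
  have comp_S: "component (component (S j w) i) l = A i j (component (component w i) l)"
    if "w \<in> D" "i < k" "l < n i" for j w i l
  proof -
    have "component w i \<in> copies (n i) (H i)" using that by (simp add: D_def direct_sum_iff)
    with that show ?thesis
      by (simp add: S_def component_direct_sum_tuple that(1) [unfolded D_def])
  qed
  have D_mem: "component (component w i) l \<in> H i" if "w \<in> D" "i < k" "l < n i" for w i l
    using that by (simp add: D_def direct_sum_iff)
  have H0: "0 \<in> H i" if "i < k" for i using H [OF that] by (simp add: csubspace_def)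
  have A0: "A i j 0 = 0" if "i < k" "j < m" for i j
    by (rule obj_apply_0 [OF obj_H [OF that(1)] that(2)])
  define f where "f il x = component (component (X (component x 0)) (fst il)) (snd il)" for il x
  define g where "g il v = single 0 (Y (single (fst il) (single (snd il) v)))" for il v
  have si: "intertwiner m D S (H i) (A i) (\<lambda>w. component (component w i) l)" if "i < k" "l < n i" for i l
    by (rule intertwinerI)
       (auto simp: D_mem comp_S that intro: bdd_linear_on_compose [OF bdd_linear_on_component bdd_linear_on_component [of UNIV]])
  have single_D: "single i (single l v) \<in> D" if "i < k" "l < n i" "v \<in> H i" for i l v
    using that H0 by (auto simp: D_def direct_sum_iff component_simps)
  have inj_D: "intertwiner m (H i) (A i) D S (\<lambda>v. single i (single l v))" if il: "i < k" "l < n i" for i l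
  proof (rule intertwinerI)
    show "bdd_linear_on (H i) (\<lambda>v. single i (single l v))"
      by (rule bdd_linear_on_compose [OF bdd_linear_on_single bdd_linear_on_single [of UNIV]]) simp
    show "single i (single l v) \<in> D" if "v \<in> H i" for v by (rule single_D [OF il that])
    fix j v assume j: "j < m" and v: "v \<in> H i"
    show "single i (single l (A i j v)) = S j (single i (single l v))"
    proof (intro fin_seq_eqI)
      fix i' l'
      have D: "S j (single i (single l v)) \<in> D"
        by (intro obj_apply [OF obj_D j] single_D il v)
      show "component (component (single i (single l (A i j v))) i') l' = component (component (S j (single i (single l v))) i') l'"
      proof (cases "i' < k \<and> l' < n i'")
        case True
        then show ?thesis
          using comp_S [OF single_D [OF il v], of i' l' j] A0 j by (auto simp: component_simps)
      next
        case False
        then have "component (component (S j (single i (single l v))) i') l' = 0"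
          using D unfolding D_def direct_sum_iff by (metis not_less zero_fin_seq.rep_eq)
        with False il show ?thesis by (auto simp: component_simps)
      qed
    qed
  qed
  have f: "intertwiner m UNIV T_inf (H i) (A i) (f (i, l))" if "i < k" "l < n i" for i l
    using intertwiner_compose [OF intertwiner_compose [OF intertwiner_component [of 0] iX] si [OF that]]
    by (simp add: f_def [abs_def])
  have g: "intertwiner m (H i) (A i) UNIV T_inf (g (i, l))" if "i < k" "l < n i" for i l
    using intertwiner_compose [OF intertwiner_compose [OF inj_D [OF that] iY] intertwiner_single [of 0]]
    by (simp add: g_def [abs_def])
  \<comment> \<open>Coordinates against inclusions give a Kronecker delta; idempotence and
    orthogonality of the \<open>p il\<close> follow from it.\<close>
  have fg: "f il (g jl v) = (if il = jl then v else 0)" if "jl \<in> I" "v \<in> H (fst jl)" for il jl v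
    using that single_D [of "fst jl" "snd jl" v]
    by (cases il, cases jl) (auto simp: f_def g_def I_def component_simps XY)
  define p where "p il = Endo (\<lambda>x. g il (f il x))" for il
  have rep: "rep (f (i, l)) (g (i, l)) (H i) (A i) (p (i, l))"
    and app_p: "app (p (i, l)) x = g (i, l) (f (i, l) x)" if il: "(i, l) \<in> I" for i l x
  proof -
    have il': "i < k" "l < n i" using il by (auto simp: I_def)
    have *: "f (i, l) (g (i, l) v) = v" if "v \<in> H i" for v
      using fg [OF il, of v "(i, l)"] that by simp
    have fc: "f (i, l) (app (cut 1) x) = f (i, l) x" for x
      by (simp add: f_def component_cut)
    have cg: "app (cut 1) (g (i, l) v) = g (i, l) v" for v
      by (rule fin_seq_eqI) (simp add: component_cut g_def component_simps)
    show "rep (f (i, l)) (g (i, l)) (H i) (A i) (p (i, l))" "app (p (i, l)) x = g (i, l) (f (i, l) x)" for x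
      unfolding p_def using rep_Endo [OF obj_H [OF il'(1)] f [OF il'] g [OF il'] * fc cg] by blast+
  qed
  have prim: "prim (p il)" if "il \<in> I" for il
  proof -
    obtain i l where il: "il = (i, l)" by fastforce
    with that SI [of i] show ?thesis
      using strongly_irreducible_iff_prim [OF rep [of i l]] by (simp add: I_def)
  qed
  have orth: "orth (p il) (p jl)" if ij: "il \<in> I" "jl \<in> I" "il \<noteq> jl" for il jl
  proof -
    have *: "p il * p jl = 0" if ij: "il \<in> I" "jl \<in> I" "il \<noteq> jl" for il jl
    proof (rule endo_eqI)
      fix x
      obtain i l i' l' where il: "il = (i, l)" "jl = (i', l')" by fastforce
      have I: "(i, l) \<in> I" "(i', l') \<in> I" using ij il by auto
      have "f (i, l) (g (i', l') (f (i', l') x)) = 0"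
        using fg [OF I(2), of "f (i', l') x" "(i, l)"] rep_f_mem [OF rep [OF I(2)], of x] ij(3) il by auto
      then show "app (p il * p jl) x = app 0 x"
        unfolding il times_endo.rep_eq app_p [OF I(1)] app_p [OF I(2)] zero_endo.rep_eq
        by (simp add: g_0 [OF rep [OF I(1)]])
    qed
    with ij show ?thesis by (auto simp: orth_def)
  qed
  have inj: "inj_on p I"
  proof (rule inj_onI, rule ccontr)
    fix il jl assume "il \<in> I" "jl \<in> I" "p il = p jl" "il \<noteq> jl"
    with orth [of il jl] prim [of il] show False by (auto simp: orth_def prim_def idem_def)
  qed
  have fin: "finite I" by (simp add: I_def)
  \<comment> \<open>A vector of D is the sum of its coordinates, and Y undoes X.\<close>
  have "(\<Sum>il\<in>I. p il) = cut 1"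
  proof (rule endo_eqI)
    fix x
    let ?w = "X (component x 0)"
    have w: "?w \<in> D" using intertwiner_mem [OF iX] by simp
    have "app (\<Sum>il\<in>I. p il) x = (\<Sum>(i, l)\<in>I. single 0 (Y (single i (single l (component (component ?w i) l)))))"
      unfolding app_sum_endo by (rule sum.cong) (auto simp: app_p g_def f_def)
    also have "\<dots> = single 0 (Y (\<Sum>(i, l)\<in>I. single i (single l (component (component ?w i) l))))"
    proof -
      have "intertwiner m D S UNIV T_inf (\<lambda>w. single 0 (Y w))"
        by (rule intertwiner_compose [OF iY intertwiner_single])
      from intertwiner_apply_sum [OF this obj_csubspace [OF obj_D], of I "\<lambda>(i, l). single i (single l (component (component ?w i) l))"]
      show ?thesis using single_D D_mem [OF w] by (auto simp: I_def split_def)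
    qed
    also have "(\<Sum>(i, l)\<in>I. single i (single l (component (component ?w i) l))) =
      (\<Sum>i<k. single i (\<Sum>l<n i. single l (component (component ?w i) l)))"
      unfolding I_def by (simp add: single_sum sum.Sigma [symmetric])
    also have "\<dots> = (\<Sum>i<k. single i (component ?w i))"
      using w by (intro sum.cong arg_cong [of _ _ "single _"] sum_single_component refl) (simp add: D_def direct_sum_iff)
    also have "\<dots> = ?w"
      using w by (intro sum_single_component) (simp add: D_def direct_sum_iff)
    also have "single 0 (Y ?w) = app (cut 1) x"
      by (rule fin_seq_eqI) (simp add: YX component_cut component_simps)
    finally show "app (\<Sum>il\<in>I. p il) x = app (cut 1) x" .
  qed
  moreover define t where "t b = fst (the_inv_into I p b)" for b
  have t: "t (p (i, l)) = i" if "(i, l) \<in> I" for i l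
    using the_inv_into_f_f [OF inj that] by (simp add: t_def)
  \<comment> \<open>Two copies of one \<open>H i\<close> present the same tuple, so
    \<open>similar_iff_eqv\<close> compares that tuple with itself.\<close>
  have eqv_iff: "eqv (p (i, l)) (p (i', l')) \<longleftrightarrow> i = i'" if "(i, l) \<in> I" "(i', l') \<in> I" for i l i' l'
  proof (cases "i = i'")
    case True
    have "similar m (H i) (A i) (H i) (A i)"
      using similar_iff_eqv [OF rep [OF that(1)] rep [OF that(1)]] eqv_refl [OF rep_idem [OF rep [OF that(1)]]] by simp
    with True show ?thesis
      using similar_iff_eqv [OF rep [OF that(1)] rep [OF that(2)]] by simp
  next
    case False
    with not_similar [of i i'] that show ?thesis
      using similar_iff_eqv [OF rep [OF that(1)] rep [OF that(2)]] by (simp add: I_def)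
  qed
  ultimately have "unit_pdec k n (p ` I) t"
    unfolding unit_pdec_def pdec_def
  proof (intro conjI ballI allI impI)
    show "finite (p ` I)" using fin by (rule finite_imageI)
    show "prim b" if "b \<in> p ` I" for b using that prim by blast
    show "pairwise orth (p ` I)"
      unfolding pairwise_def using orth by (metis imageE)
    show "\<Sum>(p ` I) = cut 1" if "sum p I = cut 1"
      using that inj by (simp add: sum.reindex)
    show "t ` (p ` I) \<subseteq> {..<k}"
      using t by (auto simp: I_def)
    show "eqv b c \<longleftrightarrow> t b = t c" if "b \<in> p ` I" "c \<in> p ` I" for b c
      using that eqv_iff t by auto
    show "card {b \<in> p ` I. t b = i} = n i" if "i < k" for i
    proof -
      have "{b \<in> p ` I. t b = i} = p ` ({i} \<times> {..<n i})"
        using t that by (auto simp: I_def)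
      moreover have "inj_on p ({i} \<times> {..<n i})"
        using inj that by (auto intro: inj_on_subset simp: I_def)
      ultimately show ?thesis by (simp add: card_image)
    qed
  qed
  then show ?thesis by blast
qed

text \<open>For each type a member \<open>c i\<close> of B is chosen, and \<open>H i\<close> is its
  range in the original space. The other members of type i are equivalent to \<open>c i\<close>, so
  by \<open>rep_eqv\<close> they are presented by the same \<open>H i\<close> and
  \<open>A i\<close>, as its further copies.\<close>

lemma similarity_of_unit_pdec:
  assumes B: "unit_pdec k n B t" and n: "\<forall>i<k. 1 \<le> n i"
  obtains H :: "nat \<Rightarrow> 'a set" and A :: "nat \<Rightarrow> nat \<Rightarrow> 'a \<Rightarrow> 'a" and X Y
  where "\<And>i. i < k \<Longrightarrow> csubspace (H i) \<and> closed (H i)"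
    and "\<And>i j. i < k \<Longrightarrow> j < m \<Longrightarrow> A i j \<in> bdd_ops (H i) (H i)"
    and "\<And>i. i < k \<Longrightarrow> strongly_irreducible m (H i) (A i)"
    and "\<And>i j. i < k \<Longrightarrow> j < k \<Longrightarrow> i \<noteq> j \<Longrightarrow> \<not> similar m (H i) (A i) (H j) (A j)"
    and "X \<in> bdd_ops UNIV (multi_sum k n H)"
    and "Y \<in> bdd_ops (multi_sum k n H) UNIV"
    and "\<And>x. Y (X x) = x" and "\<And>y. y \<in> multi_sum k n H \<Longrightarrow> X (Y y) = y"
    and "\<And>j x. j < m \<Longrightarrow> X (T j x) =
      multi_tuple k n H A j (X x)"
proof -
  have B1: "pdec (cut 1) B" and t: "\<And>b. b \<in> B \<Longrightarrow> t b < k"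
    and eqv_t: "\<And>b c. b \<in> B \<Longrightarrow> c \<in> B \<Longrightarrow> eqv b c \<longleftrightarrow> t b = t c"
    and card_t: "\<And>i. i < k \<Longrightarrow> card {b \<in> B. t b = i} = n i"
    using B by (auto simp: unit_pdec_def)
  have fin: "finite B" and prim_B: "\<And>b. b \<in> B \<Longrightarrow> prim b" and idem_B: "\<And>b. b \<in> B \<Longrightarrow> idem b"
    and orth_B: "pairwise orth B" and sum_B: "\<Sum>B = cut 1"
    using B1 by (auto simp: pdec_def prim_def)
  have cut_B: "cut 1 * b = b" "b * cut 1 = b" if "b \<in> B" for b
    using orth_member_sum [OF fin idem_B orth_B that] by (simp_all add: sum_B)
  define I where "I = Sigma {..<k} (\<lambda>i. {..<n i})"
  have fin_I: "finite I" by (simp add: I_def)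
  have "card {x \<in> I. fst x = i} = card {b \<in> B. t b = i}" for i
  proof (cases "i < k")
    case True
    then have "{x \<in> I. fst x = i} = {i} \<times> {..<n i}" by (auto simp: I_def)
    then have "card {x \<in> I. fst x = i} = n i" by (simp add: card_cartesian_product)
    with card_t [OF True] show ?thesis by (simp only:)
  next
    case False
    then have "{x \<in> I. fst x = i} = {}" "{b \<in> B. t b = i} = {}" using t by (auto simp: I_def)
    then show ?thesis by (simp only: card.empty)
  qed
  from fibrewise_bij [OF fin_I fin this] obtain e
    where e: "bij_betw e I B" and te: "\<And>x. x \<in> I \<Longrightarrow> t (e x) = fst x" by blast
  have e_mem: "e x \<in> B" if "x \<in> I" for x using e that by (auto simp: bij_betw_def)
  \<comment> \<open>The copy with index 0 exists because \<open>n i\<close> is positive; it is the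
    model of type i.\<close>
  define c where "c i = e (i, 0)" for i
  have I0: "(i, 0) \<in> I" if "i < k" for i using n that by (auto simp: I_def)
  have c: "c i \<in> B" "t (c i) = i" if "i < k" for i
    using e_mem [OF I0 [OF that]] te [OF I0 [OF that]] by (simp_all add: c_def)
  define P where "P i = dec (\<lambda>x. component x 0) (single 0) UNIV (c i)" for i
  define H where "H i = P i ` UNIV" for i
  define A where "A i = restrict_tuple (H i) T" for i
  have P: "P i \<in> idempotents (commutant m UNIV T)" if "i < k" for i
    unfolding P_def by (rule idempotents_dec [OF rep_T idem_B cut_B]) (rule c(1) [OF that])+
  have rep_c: "rep (\<lambda>x. P i (component x 0)) (single 0) (H i) (A i) (c i)" if "i < k" for i
  proof -
    have "enc (\<lambda>x. component x 0) (single 0) (P i) = c i"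
      unfolding P_def by (rule enc_dec [OF rep_T idemD(1) [OF idem_B] cut_B]) (rule c(1) [OF that])+
    with rep_idempotent [OF rep_T P [OF that]] show ?thesis by (simp add: H_def A_def)
  qed
  have iP: "intertwiner m UNIV T UNIV T (P i)" if "i < k" for i
    using P [OF that] commutant_intertwiner [OF rep_T] by (simp add: idempotents_def)
  have obj_H: "obj m (H i) (A i)" if "i < k" for i by (rule rep_obj [OF rep_c [OF that]])
  \<comment> \<open>The range of an idempotent is its set of fixed points, which is closed by
    continuity.\<close>
  have "closed (H i)" if i: "i < k" for i
  proof -
    have "P i \<otimes>\<^bsub>commutant m UNIV T\<^esub> P i = P i" using P [OF i] by (simp add: idempotents_def)
    then have PP: "P i (P i x) = P i x" for x using commutant_simps(1) [of x UNIV m T "P i" "P i"] by simp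
    then have eq: "H i = {x. P i x = x}" unfolding H_def by (auto simp: PP) (metis rangeI)
    from bdd_linear_on_bound [OF intertwiner_bdd [OF iP [OF i]]] obtain K
      where K: "\<And>x. norm (P i x) \<le> K * norm x" by (metis UNIV_I)
    have "bounded_linear (P i)"
    proof (rule bounded_linear_intro)
      show "P i (x + y) = P i x + P i y" for x y by (rule intertwiner_add [OF iP [OF i]]) auto
      show "P i (r *\<^sub>R x) = r *\<^sub>R P i x" for r x
        using intertwiner_bdd [OF iP [OF i]] by (simp add: bdd_linear_on_def scaleR_scaleC)
      show "norm (P i x) \<le> norm x * K" for x using K [of x] by (simp add: mult.commute)
    qed
    then have "continuous_on UNIV (P i)" by (simp add: linear_continuous_on)
    then show ?thesis unfolding eq by (intro closed_Collect_eq continuous_on_id) auto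
  qed
  then have cl: "csubspace (H i) \<and> closed (H i)" if "i < k" for i
    using that obj_csubspace [OF obj_H] by blast
  have A: "A i j \<in> bdd_ops (H i) (H i)" if "i < k" "j < m" for i j
  proof -
    have "bdd_linear_on (H i) (T j)"
      using T [OF that(2)] by (auto simp: bdd_ops_iff intro: bdd_linear_on_subset)
    then have "bdd_linear_on (H i) (A i j)"
      using cl [OF that(1)] by (subst bdd_linear_on_cong [of _ _ "T j"]) (auto simp: A_def restrict_tuple_def)
    moreover have "A i j \<in> H i \<rightarrow>\<^sub>E H i"
      using obj_apply [OF obj_H [OF that(1)] that(2)] by (auto simp: A_def restrict_tuple_def)
    ultimately show ?thesis by (simp add: bdd_ops_iff)
  qed
  have SI: "strongly_irreducible m (H i) (A i)" if "i < k" for i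
    using strongly_irreducible_iff_prim [OF rep_c [OF that]] prim_B c(1) [OF that] by simp
  have not_similar: "\<not> similar m (H i) (A i) (H j) (A j)" if "i < k" "j < k" "i \<noteq> j" for i j
    using similar_iff_eqv [OF rep_c [OF that(1)] rep_c [OF that(2)]] eqv_t c that by simp
  have "\<exists>f g. rep f g (H (fst x)) (A (fst x)) (e x)" if "x \<in> I" for x
  proof -
    have i: "fst x < k" using that by (auto simp: I_def)
    then have "eqv (c (fst x)) (e x)" using eqv_t c e_mem te that by simp
    from rep_eqv [OF rep_c [OF i] this] show ?thesis by blast
  qed
  then obtain f g where rep: "\<And>x. x \<in> I \<Longrightarrow> rep (f x) (g x) (H (fst x)) (A (fst x)) (e x)" by metis
  define D where "D = multi_sum k n H"
  define S where "S = multi_tuple k n H A"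
  have obj_D: "obj m D S"
    unfolding D_def S_def by (intro obj_direct_sum obj_H)
  \<comment> \<open>The coordinate (i, l) of X v is the part of v in the summand e (i, l), read in
    \<open>H i\<close>; Y adds the parts up again. X is invertible but in general not
    isometric.\<close>
  define X where "X v = (\<Sum>i<k. single i (\<Sum>l<n i. single l (f (i, l) (single 0 v))))" for v
  define Y where "Y w = (\<Sum>x\<in>I. component (g x (component (component w (fst x)) (snd x))) 0)" for w
  have comp_X: "component (component (X v) i) l = (if (i, l) \<in> I then f (i, l) (single 0 v) else 0)" for v i l
    by (simp add: X_def I_def component_sum component_single component_simps if_distrib [of "\<lambda>x. component x _"] cong: if_cong)
  have f_mem: "f (i, l) y \<in> H i" if "(i, l) \<in> I" for i l y
    using rep_f_mem [OF rep [OF that]] by simp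
  have D_iff: "w \<in> D \<longleftrightarrow> (\<forall>(i, l)\<in>I. component (component w i) l \<in> H i) \<and>
      (\<forall>i l. (i, l) \<notin> I \<longrightarrow> component (component w i) l = 0)" for w
  proof
    assume w: "w \<in> D"
    have "component (component w i) l = 0" if "(i, l) \<notin> I" for i l
      using w that by (cases "i < k") (auto simp: D_def I_def direct_sum_iff not_less component_simps)
    with w show "(\<forall>(i, l)\<in>I. component (component w i) l \<in> H i) \<and>
      (\<forall>i l. (i, l) \<notin> I \<longrightarrow> component (component w i) l = 0)"
      by (auto simp: D_def I_def direct_sum_iff)
  qed (auto simp: D_def I_def direct_sum_iff component_simps intro!: fin_seq_eqI)
  have X_D: "X v \<in> D" for v
    unfolding D_iff comp_X using f_mem by auto
  have DD: "component (component w (fst x)) (snd x) \<in> H (fst x)" if "w \<in> D" "x \<in> I" for w x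
    using that unfolding D_iff by (cases x) auto
  \<comment> \<open>As e x lies below \<open>cut 1\<close>, the image of g x sits in coordinate
    0.\<close>
  have cut_g: "single 0 (component (g x v) 0) = g x v" if "x \<in> I" "v \<in> H (fst x)" for x v
  proof -
    have "app (e x) (g x v) = g x v"
      using rep_gf [OF rep [OF that(1)], of "g x v"] rep_fg [OF rep [OF that(1)] that(2)] by simp
    then have "app (cut 1) (g x v) = g x v"
      using cut_B(1) [OF e_mem [OF that(1)]] times_endo.rep_eq by metis
    moreover have "app (cut 1) y = single 0 (component y 0)" for y
      by (rule fin_seq_eqI) (auto simp: component_cut component_simps)
    ultimately show ?thesis by simp
  qed
  have YX: "Y (X v) = v" for v
  proof -
    have "Y (X v) = (\<Sum>x\<in>I. component (app (e x) (single 0 v)) 0)"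
      unfolding Y_def comp_X using rep_gf [OF rep] by (intro sum.cong) auto
    also have "\<dots> = component (app (\<Sum>x\<in>I. e x) (single 0 v)) 0"
      by (simp add: app_sum_endo component_sum)
    also have "(\<Sum>x\<in>I. e x) = cut 1"
      using sum.reindex_bij_betw [OF e, of "\<lambda>b. b"] sum_B by simp
    finally show ?thesis by (simp add: component_cut component_simps)
  qed
  have XY: "X (Y w) = w" if w: "w \<in> D" for w
  proof (intro fin_seq_eqI)
    fix i l
    show "component (component (X (Y w)) i) l = component (component w i) l"
    proof (cases "(i, l) \<in> I")
      case False
      then show ?thesis using w unfolding comp_X D_iff by auto
    next
      case True
      let ?u = "\<lambda>x. component (component w (fst x)) (snd x)"
      have "single 0 (Y w) = (\<Sum>x\<in>I. g x (?u x))"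
        unfolding Y_def single_sum using cut_g DD [OF w] by (intro sum.cong) auto
      then have "f (i, l) (single 0 (Y w)) = (\<Sum>x\<in>I. f (i, l) (g x (?u x)))"
        using intertwiner_apply_sum [OF rep_f [OF rep [OF True]] csubspace_UNIV] by simp
      \<comment> \<open>Distinct members of B are orthogonal, so \<open>rep_orth\<close> removes all
        terms but one.\<close>
      also have "\<dots> = (\<Sum>x\<in>I. if x = (i, l) then ?u (i, l) else 0)"
      proof (rule sum.cong [OF refl])
        fix x assume x: "x \<in> I"
        show "f (i, l) (g x (?u x)) = (if x = (i, l) then ?u (i, l) else 0)"
        proof (cases "x = (i, l)")
          case True
          with rep_fg [OF rep [OF x] DD [OF w x]] show ?thesis by simp
        next
          case False
          have "e (i, l) \<noteq> e x"
            using e False True x by (auto simp: bij_betw_def inj_on_def)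
          then have "orth (e (i, l)) (e x)"
            using orth_B e_mem True x by (auto simp: pairwise_def)
          with rep_orth [OF rep [OF True] rep [OF x] _ DD [OF w x]] False show ?thesis by simp
        qed
      qed
      also have "\<dots> = ?u (i, l)" using fin_I True by simp
      finally show ?thesis using True by (simp add: comp_X)
    qed
  qed
  have X: "X \<in> bdd_ops UNIV D"
    unfolding bdd_ops_iff
  proof
    show "X \<in> UNIV \<rightarrow>\<^sub>E D" using X_D by auto
    have "bdd_linear_on UNIV (\<lambda>v. single i (single l (f (i, l) (single 0 v))))" if "i < k" "l < n i" for i l
      using that intertwiner_bdd [OF rep_f [OF rep [of "(i, l)"]]]
      by (intro bdd_linear_on_compose [OF _ bdd_linear_on_single [of UNIV]]
          bdd_linear_on_compose [OF bdd_linear_on_single, of UNIV]) (auto simp: I_def)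
    then show "bdd_linear_on UNIV X"
      unfolding X_def single_sum by (intro bdd_linear_on_sum) auto
  qed
  have Yb: "bdd_linear_on D Y"
    unfolding Y_def
  proof (rule bdd_linear_on_sum)
    fix x assume x: "x \<in> I"
    have "bdd_linear_on D (\<lambda>w. component (component w (fst x)) (snd x))"
      by (rule bdd_linear_on_compose [OF bdd_linear_on_component bdd_linear_on_component [of UNIV]]) simp
    from bdd_linear_on_compose [OF bdd_linear_on_compose [OF this intertwiner_bdd [OF rep_g [OF rep [OF x]]]]
        bdd_linear_on_component [of UNIV]]
    show "bdd_linear_on D (\<lambda>w. component (g x (component (component w (fst x)) (snd x))) 0)"
      using DD x by blast
  qed
  \<comment> \<open>The restriction supplies the extensionality that \<open>bdd_ops\<close>
    demands.\<close>
  have Y: "restrict Y D \<in> bdd_ops D UNIV"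
    unfolding bdd_ops_iff using Yb bdd_linear_on_cong [of D Y "restrict Y D"] obj_csubspace [OF obj_D] by auto
  have XT: "X (T j v) = S j (X v)" if j: "j < m" for j v
  proof (intro fin_seq_eqI)
    fix i l
    have SD: "S j (X v) \<in> D" by (rule obj_apply [OF obj_D j X_D])
    show "component (component (X (T j v)) i) l = component (component (S j (X v)) i) l"
    proof (cases "(i, l) \<in> I")
      case False
      then show ?thesis using SD unfolding comp_X D_iff by auto
    next
      case True
      then have "component (X v) i \<in> copies (n i) (H i)"
        using X_D [of v] by (auto simp: D_def I_def direct_sum_iff)
      with True have "component (component (S j (X v)) i) l = A i j (component (component (X v) i) l)"
        using X_D [of v] by (simp add: S_def D_def I_def component_direct_sum_tuple)
      moreover have "single 0 (T j v) = T_inf j (single 0 v)"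
        using intertwiner_apply [OF intertwiner_single j] by simp
      ultimately show ?thesis
        using intertwiner_apply [OF rep_f [OF rep [OF True]] j, of "single 0 v"] True by (simp add: comp_X)
    qed
  qed
  show thesis
    by (rule that [OF cl A SI not_similar X [unfolded D_def] Y [unfolded D_def] _ _ XT [unfolded S_def]])
       (use YX XY X_D in \<open>auto simp: D_def\<close>)
qed

end

theorem theorem3p12:
  fixes T :: "nat \<Rightarrow> 'a::complex_hilbert \<Rightarrow> 'a"
    and m k :: nat
    and n :: "nat \<Rightarrow> nat"
  assumes separable: "separable_space (euclidean :: 'a topology)"
    and m: "1 \<le> m"
    and T: "\<forall>j<m. T j \<in> bdd_ops UNIV UNIV"
    and commuting: "\<forall>i<m. \<forall>j<m. T i \<circ> T j = T j \<circ> T i"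
    and k: "1 \<le> k"
    and n: "\<forall>i<k. 1 \<le> n i"
  shows
    "((\<exists>(H :: nat \<Rightarrow> 'a set) (A :: nat \<Rightarrow> nat \<Rightarrow> 'a \<Rightarrow> 'a).
         (\<forall>i<k. csubspace (H i) \<and> closed (H i)) \<and>
         unitarily_equivalent (UNIV :: 'a set) (direct_sum k (\<lambda>i. copies (n i) (H i))) \<and>
         (\<forall>i<k. \<forall>j<m. A i j \<in> bdd_ops (H i) (H i)) \<and>
         (\<forall>i<k. strongly_irreducible m (H i) (A i)) \<and>
         (\<forall>i<k. \<forall>j<k. i \<noteq> j \<longrightarrow> \<not> similar m (H i) (A i) (H j) (A j)) \<and>
         similar m UNIV T
           (direct_sum k (\<lambda>i. copies (n i) (H i)))
           (direct_sum_tuple k (\<lambda>i. copies (n i) (H i)) (\<lambda>i. copies_tuple (n i) (H i) (A i)))) \<and>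
      (\<forall>N\<ge>1. has_unique_finite_SI_decomposition m (copies N UNIV) (copies_tuple N UNIV T)))
     \<longleftrightarrow>
     (\<exists>h \<in> iso (idempotent_semigroup (commutant m UNIV T))
                (product_group {..<k} (\<lambda>_. nat_add_monoid)).
        h (idempotent_class (commutant m UNIV T)
             (scalar_matrix (commutant m UNIV T) \<one>\<^bsub>commutant m UNIV T\<^esub>))
        = (\<lambda>i\<in>{..<k}. n i))"
proof -
  interpret operator_tuple T m
    by standard (use T in blast)
  let ?P = "\<lambda>(H :: nat \<Rightarrow> 'a set) (A :: nat \<Rightarrow> nat \<Rightarrow> 'a \<Rightarrow> 'a). (\<forall>i<k. csubspace (H i) \<and> closed (H i)) \<and> unitarily_equivalent (UNIV :: 'a set) (multi_sum k n H) \<and>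
    (\<forall>i<k. \<forall>j<m. A i j \<in> bdd_ops (H i) (H i)) \<and> (\<forall>i<k. strongly_irreducible m (H i) (A i)) \<and>
    (\<forall>i<k. \<forall>j<k. i \<noteq> j \<longrightarrow> \<not> similar m (H i) (A i) (H j) (A j)) \<and> similar m UNIV T (multi_sum k n H) (multi_tuple k n H A)"
  have decomposition: "(\<exists>H A. ?P H A) \<longleftrightarrow> (\<exists>B t. unit_pdec k n B t)"
  proof
    assume "\<exists>H A. ?P H A"
    then show "\<exists>B t. unit_pdec k n B t"
    proof (elim exE)
      fix H :: "nat \<Rightarrow> 'a set" and A assume P: "?P H A"
      show ?thesis
        by (rule unit_pdec_of_similarity [of k H A n]) (simp_all add: P)
    qed
  next
    assume "\<exists>B t. unit_pdec k n B t"
    then show "\<exists>H A. ?P H A"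
    proof (elim exE)
      fix B t assume B: "unit_pdec k n B t"
      show ?thesis
      proof (rule similarity_of_unit_pdec [OF B n])
        fix H :: "nat \<Rightarrow> 'a set" and A X Y
        assume H: "\<And>i. i < k \<Longrightarrow> csubspace (H i) \<and> closed (H i)"
          and A: "\<And>i j. i < k \<Longrightarrow> j < m \<Longrightarrow> A i j \<in> bdd_ops (H i) (H i)"
          and SI: "\<And>i. i < k \<Longrightarrow> strongly_irreducible m (H i) (A i)"
          and ns: "\<And>i j. i < k \<Longrightarrow> j < k \<Longrightarrow> i \<noteq> j \<Longrightarrow> \<not> similar m (H i) (A i) (H j) (A j)"
          and XY: "X \<in> bdd_ops UNIV (multi_sum k n H)" "Y \<in> bdd_ops (multi_sum k n H) UNIV" "\<And>x. Y (X x) = x"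
            "\<And>y. y \<in> multi_sum k n H \<Longrightarrow> X (Y y) = y" "\<And>j x. j < m \<Longrightarrow> X (T j x) = multi_tuple k n H A j (X x)"
        have "csubspace (multi_sum k n H)"
          by (intro csubspace_direct_sum) (simp add: H)
        \<comment> \<open>The isomorphism that implements the similarity also gives, through its
          polar decomposition, the unitary one.\<close>
        then have "unitarily_equivalent (UNIV :: 'a set) (multi_sum k n H)"
          by (rule unitarily_equivalent_of_isomorphism [OF _ XY(1-4)])
        moreover have "similar m UNIV T (multi_sum k n H) (multi_tuple k n H A)"
          unfolding similar_def using XY(3-5) by (intro bexI [OF _ XY(1)] bexI [OF _ XY(2)]) simp
        ultimately show ?thesis
          by (intro exI [of _ H] exI [of _ A] conjI allI impI) (simp_all add: H A SI ns)
      qed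
    qed
  qed
  \<comment> \<open>Both statements now concern \<open>M\<close> alone, with \<open>cut\<close> in
    the role of \<open>E\<close>.\<close>
  have "unique_pdec \<and> (\<exists>B t. unit_pdec k n B t) \<longleftrightarrow>
      (\<exists>H. dimension_map k H \<and> H (cut 1) = (\<lambda>i\<in>{..<k}. n i))"
    by (intro iffI; elim exE conjE)
       (rule dimension_map_of_unique_pdec [OF _ _ n] unique_pdec_of_dimension_map; assumption)+
  then show ?thesis
    unfolding decomposition iso_iff_dimension_map unique_pdec_iff by (simp only: conj_commute)
qed

end
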